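(* Let $\mathcal{B}: g=0$ and $\mathcal{B}': g'=0$ be a pair of line arrangements in $\mathbb{P}^2$, with $g,g'\in R=\mathbb{C}[x,y,z]$, and consider the cones $\mathcal{A}=c\mathcal{B}: f=wg=0$ and $\mathcal{A}'=c\mathcal{B}': f'=wg'=0$, which are plane arrangements in $\mathbb{P}^3$ (here $f,f'\in S=\mathbb{C}[x,y,z,w]$). (1) If $\mathcal{B}$ and $\mathcal{B}'$ have isomorphic intersection lattices, then the cones $\mathcal{A}$ and $\mathcal{A}'$ also have isomorphic intersection lattices. (2) If $(\mathcal{B},\mathcal{B}')$ is a Ziegler pair satisfying the condition $(\mathrm{SPEC})$ and not satisfying the condition $(\mathrm{HF})$, then the Hilbert polynomials of the Jacobian algebras $M(f)$ and $M(f')$ are different: $P(M(f))\neq P(M(f'))$.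
   Context: A hyperplane arrangement $\mathcal{A}:f=0$ in $\mathbb{P}^n$ is given by a product $f$ of pairwise non-proportional linear forms in $T=\mathbb{C}[x_0,\dots,x_n]$. Its intersection lattice $L(\mathcal{A})$ is the intersection lattice of the corresponding central arrangement in $\mathbb{C}^{n+1}$ (all intersections of subfamilies of the hyperplanes, ordered by reverse inclusion). For a homogeneous polynomial $f\in T$, $J_f$ is the ideal generated by all first partial derivatives of $f$, and $M(f)=T/J_f$ is the graded Jacobian (Milnor) algebra. Its Hilbert function is $k\mapsto \dim_{\mathbb{C}} M(f)_k$, and its Hilbert polynomial $P(M(f))\in\mathbb{Q}[u]$ is the unique polynomial with $P(M(f))(k)=\dim M(f)_k$ for all $k$ sufficiently large. The graded Betti numbers of $M(f)$ are those of its minimal graded free resolution over $T$. The cone over a curve $g=0$ in $\mathbb{P}^2$, with $g\in\mathbb{C}[x,y,z]$, is the surface $wg=0$ in $\mathbb{P}^3$. Two hyperplane arrangements $\mathcal{A}:f=0$, $\mathcal{A}':f'=0$ in $\mathbb{P}^n$ form a Ziegler pair if $L(\mathcal{A})\cong L(\mathcal{A}')$ and the graded Betti numbers of the minimal resolutions of $M(f)$ and $M(f')$ are distinct. For such a pair: - Condition $(\mathrm{HF})$: $\dim M(f)_k=\dim M(f')_k$ for every integer $k$. - Condition $(\mathrm{SPEC})$: there exist an interval $I=[0,t_0]\subset\mathbb{R}$ and a smooth family of homogeneous polynomials $f_t$, $t\in I$, with $f_0=f$ and $f_{t_0}=f'$, such that the hyperplane arrangements $\mathcal{A}_t:f_t=0$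 have constant intersection lattice, i.e. $L(\mathcal{A}_t)\cong L(\mathcal{A}_{t'})$ for all $t,t'\in I$, and, in addition, the graded Betti numbers of the minimal resolutions of $M(f_t)$ are constant for all $0<t\le t_0$. *)

theory Defs
  imports
    "HOL-Analysis.Analysis"
    "HOL-Library.Poly_Mapping"
    "HOL-Library.Numeral_Type"
    "HOL-Computational_Algebra.Polynomial"
begin

section \<open>Polynomial rings\<close>

text \<open>The ring $\mathbb{C}[x_i : i \in I]$ for a finite type $I$ of variables.  Projective space
  $\mathbb{P}^n$ corresponds to an index type with $n + 1$ elements.\<close>

type_synonym 'n cpoly = "('n \<Rightarrow>\<^sub>0 nat) \<Rightarrow>\<^sub>0 complex"

definition const_poly :: "complex \<Rightarrow> 'n cpoly" where
  "const_poly c = Poly_Mapping.single 0 c"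

definition var :: "'n \<Rightarrow> 'n cpoly" where
  "var i = Poly_Mapping.single (Poly_Mapping.single i 1) 1"

definition mdeg :: "('n::finite \<Rightarrow>\<^sub>0 nat) \<Rightarrow> nat" where
  "mdeg m = (\<Sum>i\<in>UNIV. Poly_Mapping.lookup m i)"

definition homogeneous :: "nat \<Rightarrow> 'n::finite cpoly \<Rightarrow> bool" where
  "homogeneous k p \<longleftrightarrow> (\<forall>m\<in>Poly_Mapping.keys p. mdeg m = k)"

definition substitute :: "('n::finite \<Rightarrow> 'm cpoly) \<Rightarrow> 'n cpoly \<Rightarrow> 'm cpoly" where
  "substitute \<sigma> p =
     (\<Sum>m\<in>Poly_Mapping.keys p. const_poly (Poly_Mapping.lookup p m) *
        (\<Prod>i\<in>UNIV. \<sigma> i ^ Poly_Mapping.lookup m i))"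

definition partial_deriv :: "'n \<Rightarrow> 'n cpoly \<Rightarrow> 'n cpoly" where
  "partial_deriv i p =
     (\<Sum>m\<in>Poly_Mapping.keys p.
        Poly_Mapping.single (m - Poly_Mapping.single i 1)
          (of_nat (Poly_Mapping.lookup m i) * Poly_Mapping.lookup p m))"

section \<open>Hyperplane arrangements\<close>

definition linear_form :: "complex ^ 'n \<Rightarrow> 'n::finite cpoly" where
  "linear_form a = (\<Sum>i\<in>UNIV. const_poly (vec_nth a i) * var i)"

definition hyperplane :: "complex ^ 'n \<Rightarrow> (complex ^ 'n::finite) set" where
  "hyperplane a = {v. (\<Sum>i\<in>UNIV. vec_nth a i * vec_nth v i) = 0}"

text \<open>The empty product \<^term>\<open>1\<close>, giving the empty arrangement, is allowed.\<close>

definition defines_arrangement :: "'n::finite cpoly \<Rightarrow> bool" where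
  "defines_arrangement f \<longleftrightarrow>
     (\<exists>A. finite A \<and> 0 \<notin> A \<and> (\<forall>a\<in>A. \<forall>b\<in>A. a \<noteq> b \<longrightarrow> (\<forall>c. a \<noteq> c *s b)) \<and>
          f = (\<Prod>a\<in>A. linear_form a))"

definition arrangement :: "'n::finite cpoly \<Rightarrow> (complex ^ 'n) set set" where
  "arrangement f = {hyperplane a | a. a \<noteq> 0 \<and> linear_form a dvd f}"

text \<open>The intersection of the empty subfamily is the whole space.\<close>

definition intersection_lattice :: "'n::finite cpoly \<Rightarrow> (complex ^ 'n) set set" where
  "intersection_lattice f = {\<Inter>\<H> | \<H>. \<H> \<subseteq> arrangement f}"

definition isomorphic_lattices :: "'n::finite cpoly \<Rightarrow> 'm::finite cpoly \<Rightarrow> bool" where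
  "isomorphic_lattices f f' \<longleftrightarrow>
     (\<exists>\<phi>. bij_betw \<phi> (intersection_lattice f) (intersection_lattice f') \<and>
        (\<forall>X\<in>intersection_lattice f. \<forall>Y\<in>intersection_lattice f.
           X \<supseteq> Y \<longleftrightarrow> \<phi> X \<supseteq> \<phi> Y))"

text \<open>The cone over \<open>g = 0\<close>: the variable \<open>None\<close> is the new one, called $w$ in $wg$.\<close>

definition cone_poly :: "'n::finite cpoly \<Rightarrow> 'n option cpoly" where
  "cone_poly g = var None * substitute (\<lambda>i. var (Some i)) g"

section \<open>The Milnor algebra and its Hilbert function\<close>

definition jacobian_ideal :: "'n::finite cpoly \<Rightarrow> 'n cpoly set" where
  "jacobian_ideal f = module.span (*) {partial_deriv i f | i. i \<in> UNIV}"

text \<open>\<^term>\<open>B\<close> consists of representatives of a $\mathbb{C}$-basis of the degree \<^term>\<open>k\<close>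
  component $T_k / J_k$ of $T/J$.  Distinct elements of \<^term>\<open>B\<close> have distinct residue classes by
  the independence condition.\<close>

definition residue_basis :: "'n::finite cpoly set \<Rightarrow> nat \<Rightarrow> 'n cpoly set \<Rightarrow> bool" where
  "residue_basis J k B \<longleftrightarrow>
     finite B \<and> (\<forall>b\<in>B. homogeneous k b) \<and>
     (\<forall>c. (\<Sum>b\<in>B. const_poly (c b) * b) \<in> J \<longrightarrow> (\<forall>b\<in>B. c b = 0)) \<and>
     (\<forall>p. homogeneous k p \<longrightarrow> (\<exists>c. p - (\<Sum>b\<in>B. const_poly (c b) * b) \<in> J))"

text \<open>$\dim_{\mathbb{C}} M(f)_k$.  Degrees are natural numbers, since $M(f)_k = 0$ for $k < 0$.\<close>

definition milnor_dim :: "'n::finite cpoly \<Rightarrow> nat \<Rightarrow> nat" where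
  "milnor_dim f k = card (SOME B. residue_basis (jacobian_ideal f) k B)"

definition milnor_hilbert_poly :: "'n::finite cpoly \<Rightarrow> rat poly" where
  "milnor_hilbert_poly f =
     (THE P. \<forall>\<^sub>F k in sequentially. poly P (of_nat k) = of_nat (milnor_dim f k))"

section \<open>Minimal graded free resolutions and graded Betti numbers\<close>

text \<open>Elements of $T^r$ are functions on \<^typ>\<open>nat\<close> vanishing outside \<open>{..<r}\<close>.\<close>

definition free_module :: "nat \<Rightarrow> (nat \<Rightarrow> 'n cpoly) set" where
  "free_module r = {v. \<forall>b\<ge>r. v b = 0}"

definition mat_apply ::
  "nat \<Rightarrow> nat \<Rightarrow> (nat \<Rightarrow> nat \<Rightarrow> 'n cpoly) \<Rightarrow> (nat \<Rightarrow> 'n cpoly) \<Rightarrow> nat \<Rightarrow> 'n cpoly" where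
  "mat_apply r s D v = (\<lambda>a. if a < r then \<Sum>b<s. D a b * v b else 0)"

text \<open>A complex $\cdots \to F_2 \to F_1 \to F_0 \to T/J \to 0$ with
  $F_i = \bigoplus_{b < r_i} T(-d_{i,b})$, where \<^term>\<open>e b\<close> represents the image in $T/J$ of the
  \<open>b\<close>-th generator of $F_0$ and \<^term>\<open>D i\<close> is the matrix of $F_{i+1} \to F_i$.  The maps have
  degree zero, so a nonzero entry \<^term>\<open>D i a b\<close> is homogeneous of degree
  $d_{i+1,b} - d_{i,a}$.  The resolution is minimal if the image of $F_{i+1}$ lies in
  $\mathfrak{m} F_i$ for all $i \ge 0$, with $\mathfrak{m}$ the ideal of all polynomials without
  constant term.  The resolution is indexed by all of \<^typ>\<open>nat\<close>; the modules may be zero from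
  some point on.\<close>

definition minimal_graded_free_resolution ::
  "'n::finite cpoly set \<Rightarrow> (nat \<Rightarrow> nat) \<Rightarrow> (nat \<Rightarrow> nat \<Rightarrow> nat) \<Rightarrow>
   (nat \<Rightarrow> 'n cpoly) \<Rightarrow> (nat \<Rightarrow> nat \<Rightarrow> nat \<Rightarrow> 'n cpoly) \<Rightarrow> bool" where
  "minimal_graded_free_resolution J r d e D \<longleftrightarrow>
     (\<forall>b<r 0. homogeneous (d 0 b) (e b)) \<and>
     (\<forall>i. \<forall>a<r i. \<forall>b<r (Suc i). \<forall>m\<in>Poly_Mapping.keys (D i a b). d i a + mdeg m = d (Suc i) b) \<and>
     (\<forall>p. \<exists>v\<in>free_module (r 0). p - (\<Sum>b<r 0. v b * e b) \<in> J) \<and>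
     {v \<in> free_module (r 0). (\<Sum>b<r 0. v b * e b) \<in> J} =
       mat_apply (r 0) (r 1) (D 0) ` free_module (r 1) \<and>
     (\<forall>i. {v \<in> free_module (r (Suc i)). mat_apply (r i) (r (Suc i)) (D i) v = (\<lambda>_. 0)} =
       mat_apply (r (Suc i)) (r (Suc (Suc i))) (D (Suc i)) ` free_module (r (Suc (Suc i)))) \<and>
     (\<forall>i. \<forall>a<r i. \<forall>b<r (Suc i). Poly_Mapping.lookup (D i a b) 0 = 0)"

text \<open>The value at \<open>i\<close> and \<open>j\<close> is $\beta_{i,j}$, the number of generators of degree \<open>j\<close> of $F_i$
  in a minimal graded free resolution of $M(f)$, which is unique up to isomorphism.\<close>

definition milnor_betti :: "'n::finite cpoly \<Rightarrow> nat \<Rightarrow> nat \<Rightarrow> nat" where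
  "milnor_betti f =
     (SOME \<beta>. \<exists>r d e D. minimal_graded_free_resolution (jacobian_ideal f) r d e D \<and>
        \<beta> = (\<lambda>i j. card {b. b < r i \<and> d i b = j}))"

section \<open>Ziegler pairs\<close>

definition ziegler_pair :: "'n::finite cpoly \<Rightarrow> 'n cpoly \<Rightarrow> bool" where
  "ziegler_pair f f' \<longleftrightarrow>
     defines_arrangement f \<and> defines_arrangement f' \<and>
     isomorphic_lattices f f' \<and> milnor_betti f \<noteq> milnor_betti f'"

definition condition_HF :: "'n::finite cpoly \<Rightarrow> 'n cpoly \<Rightarrow> bool" where
  "condition_HF f f' \<longleftrightarrow> (\<forall>k. milnor_dim f k = milnor_dim f' k)"

text \<open>$C^\infty$, with one-sided derivatives at end points belonging to \<^term>\<open>I\<close>;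
  \<^term>\<open>D k\<close> is the \<open>k\<close>-th derivative.\<close>

definition smooth_on :: "real set \<Rightarrow> (real \<Rightarrow> complex) \<Rightarrow> bool" where
  "smooth_on I h \<longleftrightarrow>
     (\<exists>D. D 0 = h \<and>
        (\<forall>k. \<forall>t\<in>I. (D k has_vector_derivative D (Suc k) t) (at t within I)))"

definition smooth_family :: "real set \<Rightarrow> (real \<Rightarrow> 'n cpoly) \<Rightarrow> bool" where
  "smooth_family I F \<longleftrightarrow> (\<forall>m. smooth_on I (\<lambda>t. Poly_Mapping.lookup (F t) m))"

definition condition_SPEC :: "'n::finite cpoly \<Rightarrow> 'n cpoly \<Rightarrow> bool" where
  "condition_SPEC f f' \<longleftrightarrow>
     (\<exists>t0 F. 0 < t0 \<and> smooth_family {0..t0} F \<and> F 0 = f \<and> F t0 = f' \<and>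
        (\<forall>t\<in>{0..t0}. defines_arrangement (F t)) \<and>
        (\<forall>t\<in>{0..t0}. \<forall>t'\<in>{0..t0}. isomorphic_lattices (F t) (F t')) \<and>
        (\<forall>t\<in>{0<..t0}. \<forall>t'\<in>{0<..t0}. milnor_betti (F t) = milnor_betti (F t')))"

end

theory Submission
  imports Defs "HOL-Library.Function_Algebras"
begin

text \<open>Write $R = \mathbb{C}[x,y,z]$ and $f = wg$.  Since $g \in J_g$ by Euler's formula,
  $J_f = (g) + w J_g$, so $M(f)$ is $R/(g)$ in $w$-degree $0$ and a copy of $M(g)$ in every positive
  $w$-degree: $\dim M(f)_k = \dim (R/g)_k + \sum_{i<k} \dim M(g)_i$.  The singular locus of a line
  arrangement is finite, so $\dim M(g)_i$ is eventually constant and the Hilbert polynomial of $M(f)$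
  exists.  The lattice determines $\deg g$, so equality of the Hilbert polynomials of $M(f)$ and
  $M(f')$ means $\sum_{i<k} (\dim M(g)_i - \dim M(g')_i) = 0$ for large $k$.  Under (SPEC) every summand
  is nonnegative: the Hilbert function is upper semicontinuous at $t = 0$, and it is constant for
  $t > 0$ because it is determined by the Betti numbers.  Hence all summands vanish, which is (HF).
  Since Betti numbers are defined by a choice, this uses that minimal graded free resolutions exist.

  The cone has the hyperplanes $H \times \mathbb{C}$ and $w = 0$, so its lattice is the product of the
  lattice of the arrangement with a chain of two elements, which gives (1).\<close>

section \<open>Dimensions of finitely spanned subspaces\<close>

text \<open>No quotient module is formed. A residue basis in degree \<open>k\<close> is counted
  against the monomials of that degree, so the dimension of M(f)_k is read off from the dimension of
  \<open>jacobian_ideal f \<inter> graded_part k\<close>, a subspace of a finite-dimensional space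
  of polynomials.

  The obstacle is \<open>milnor_betti\<close>: equal values carry information only if each of them
  is the table of an actual resolution. This calls for finite generation of graded submodules of
  free modules, obtained by division with lexicographic leading monomials; hence the variables carry
  \<open>linorder\<close>. Passing from Betti numbers to dimensions happens in one degree
  \<open>k\<close> at a time: minimality puts the generators of the \<open>i\<close>-th module in
  degrees at least \<open>i\<close>, so only finitely many modules contribute.

  Equality of Hilbert polynomials speaks only about large \<open>k\<close>. It reaches every degree
  because the formula for the cone accumulates all lower degrees of M(g), and because the inequality
  coming from (SPEC) has the same sign in each of them.\<close>

context vector_space
begin

lemma finite_basis_exists:
  assumes "V \<subseteq> span W" "finite W"
  obtains B where "B \<subseteq> V" "independent B" "V \<subseteq> span B" "finite B" "card B = dim V"
proof -
  obtain B where B: "B \<subseteq> V" "independent B" "V \<subseteq> span B" "card B = dim V"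
    using basis_exists by blast
  moreover have "finite B"
    using independent_span_bound[OF assms(2) B(2)] B(1) assms(1) by blast
  ultimately show ?thesis using that by blast
qed

text \<open>\<open>dim\<close> is 0 on spaces of infinite dimension, such as a polynomial ring, so
  monotonicity asks for a finite spanning set of the larger space.\<close>

lemma dim_mono_finite:
  assumes "V \<subseteq> span W" "W \<subseteq> span T" "finite T"
  shows "dim V \<le> dim W"
proof -
  obtain B where B: "B \<subseteq> W" "independent B" "W \<subseteq> span B" "finite B" "card B = dim W"
    using finite_basis_exists[OF assms(2,3)] by blast
  have "V \<subseteq> span B" using assms(1) B(3) by (metis order_trans span_mono span_span)
  thus ?thesis using dim_le_card B by metis
qed

lemma independent_card_le_dim_finite:
  assumes "B \<subseteq> V" "independent B" "V \<subseteq> span T" "finite T"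
  shows "card B \<le> dim V"
proof -
  have "dim B \<le> dim V"
    by (rule dim_mono_finite[OF _ assms(3,4)]) (rule order_trans[OF assms(1) span_superset])
  thus ?thesis using dim_eq_card_independent[OF assms(2)] by simp
qed

text \<open>Independence of an indexed family, not of a set: two equal members would give the
  relation with coefficients 1 and -1, so injectivity comes for free. This suits families that vary
  with a parameter.\<close>

lemma independent_family_card_le_dim:
  assumes "finite Y" "\<And>c y. (\<Sum>y\<in>Y. scale (c y) (u y)) = 0 \<Longrightarrow> y \<in> Y \<Longrightarrow> c y = 0"
    and "u ` Y \<subseteq> V" "V \<subseteq> span T" "finite T"
  shows "card Y \<le> dim V"
proof -
  have inj: "inj_on u Y"
  proof (rule inj_onI, rule ccontr)
    fix a b assume ab: "a \<in> Y" "b \<in> Y" "u a = u b" "a \<noteq> b"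
    have "(\<Sum>y\<in>Y. scale (if y = a then 1 else if y = b then -1 else 0) (u y))
        = (\<Sum>y\<in>Y. (if y = a then u a else 0) + (if y = b then - u b else 0))"
      using ab(4) by (intro sum.cong refl) auto
    also have "\<dots> = 0" using assms(1) ab by (simp add: sum.distrib)
    finally show False using assms(2)[of "\<lambda>y. if y = a then 1 else if y = b then -1 else 0" a] ab(1) by simp
  qed
  have "independent (u ` Y)"
  proof (rule independent_if_scalars_zero)
    fix f x assume "(\<Sum>x\<in>u ` Y. scale (f x) x) = 0" and x: "x \<in> u ` Y"
    hence "(\<Sum>y\<in>Y. scale (f (u y)) (u y)) = 0" using inj by (simp add: sum.reindex)
    from assms(2)[OF this] show "f x = 0" using x by auto
  qed (use assms(1) in simp)
  from independent_card_le_dim_finite[OF assms(3) this assms(4,5)] show ?thesis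
    by (simp add: card_image[OF inj])
qed

lemma dual_family_independent:
  assumes "\<And>x. x \<in> X \<Longrightarrow> Vector_Spaces.linear scale (*) (\<phi> x)"
    and dual: "\<And>x y. x \<in> X \<Longrightarrow> y \<in> X \<Longrightarrow> \<phi> x (u y) = (if x = y then 1 else 0)"
    and "finite X"
  shows "independent (u ` X)" "inj_on u X"
proof -
  show inj: "inj_on u X"
  proof (rule inj_onI)
    fix x y assume "x \<in> X" "y \<in> X" "u x = u y"
    thus "x = y" using dual[of x x] dual[of x y] by (auto split: if_splits)
  qed
  show "independent (u ` X)"
  proof (rule independent_if_scalars_zero)
    show "finite (u ` X)" using assms(3) by simp
    fix f v assume s: "(\<Sum>v\<in>u ` X. scale (f v) v) = 0" and "v \<in> u ` X"
    then obtain x where x: "x \<in> X" "v = u x" by blast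
    interpret l: Vector_Spaces.linear scale "(*)" "\<phi> x" using assms(1) x by blast
    have "0 = \<phi> x (\<Sum>v\<in>u ` X. scale (f v) v)" using s by simp
    also have "\<dots> = (\<Sum>v\<in>u ` X. f v * \<phi> x v)" by (simp add: l.sum l.scale)
    also have "\<dots> = (\<Sum>y\<in>X. f (u y) * \<phi> x (u y))" using inj by (simp add: sum.reindex)
    also have "\<dots> = (\<Sum>y\<in>X. if y = x then f (u y) else 0)"
      by (intro sum.cong refl) (use dual x in auto)
    also have "\<dots> = f v" using x assms(3) by simp
    finally show "f v = 0" by simp
  qed
qed

lemma dim_dual_family:
  assumes "\<And>x. x \<in> X \<Longrightarrow> Vector_Spaces.linear scale (*) (\<phi> x)"
    and "\<And>x y. x \<in> X \<Longrightarrow> y \<in> X \<Longrightarrow> \<phi> x (u y) = (if x = y then 1 else 0)"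
    and "finite X" and "u ` X \<subseteq> V"
    and "\<And>v. v \<in> V \<Longrightarrow> v \<in> span (u ` X)"
  shows "dim V = card X"
proof (rule dim_unique[OF assms(4)])
  show "V \<subseteq> span (u ` X)" using assms(5) by blast
  show "independent (u ` X)" by (rule dual_family_independent(1)[OF assms(1-3)])
  show "card (u ` X) = card X" by (rule card_image, rule dual_family_independent(2)[OF assms(1-3)])
qed

text \<open>Stands in for the quotient map by \<open>J\<close>: extend a basis of \<open>J\<close>
  to a basis of the whole space and let \<open>q\<close> kill the former and fix the other basis
  vectors. The quotient then lives in the same type.\<close>

lemma subspace_is_kernel:
  assumes "subspace J"
  obtains q where "Vector_Spaces.linear scale scale q" "{x. q x = 0} = J"
proof -
  interpret vp: vector_space_pair scale scale by unfold_locales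
  obtain B where B: "B \<subseteq> J" "independent B" "J \<subseteq> span B"
    using maximal_independent_subset by blast
  obtain C where C: "B \<subseteq> C" "independent C" "UNIV \<subseteq> span C"
    by (rule maximal_independent_subset_extend[OF subset_UNIV B(2)])
  obtain q where q: "Vector_Spaces.linear scale scale q" "\<And>x. x \<in> C \<Longrightarrow> q x = (if x \<in> B then 0 else x)"
    using vp.linear_independent_extend[OF C(2), of "\<lambda>x. if x \<in> B then 0 else x"] by metis
  interpret q: Vector_Spaces.linear scale scale q by (rule q(1))
  have JB: "J = span B" using B assms by (metis span_minimal subset_antisym)
  have "q x = 0 \<longleftrightarrow> x \<in> span B" for x
  proof
    assume "x \<in> span B"
    thus "q x = 0"
    proof (rule q.eq_0_on_span[rotated])
      fix b assume "b \<in> B" thus "q b = 0" using q(2) C(1) by (simp add: subset_iff)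
    qed
  next
    assume qx: "q x = 0"
    let ?r = "representation C x" and ?S = "{c. representation C x c \<noteq> 0}"
    have x: "x = (\<Sum>c\<in>?S. scale (?r c) c)"
      using sum_nonzero_representation_eq[OF C(2)] C(3) by (metis UNIV_I subset_iff)
    have fin: "finite ?S" by (rule finite_representation)
    have SC: "?S \<subseteq> C" using representation_ne_zero by blast
    have "q x = (\<Sum>c\<in>?S. scale (?r c) (q c))" by (subst x) (simp add: q.sum q.scale)
    also have "\<dots> = (\<Sum>c\<in>?S. if c \<in> B then 0 else scale (?r c) c)"
      by (intro sum.cong refl) (use q(2) SC in auto)
    also have "\<dots> = (\<Sum>c\<in>?S - B. scale (?r c) c)"
      using fin by (subst sum.mono_neutral_right[of ?S "?S - B"]) (auto intro!: sum.cong)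
    finally have "(\<Sum>c\<in>?S - B. scale (?r c) c) = 0" using qx by simp
    moreover have "independent (?S - B)" using C(2) SC by (meson Diff_subset independent_mono order_trans)
    ultimately have "\<forall>c\<in>?S - B. ?r c = 0" using independentD[of "?S - B" "?S - B" ?r] fin by blast
    hence "?S \<subseteq> B" by blast
    thus "x \<in> span B" by (subst x) (intro span_sum span_scale span_base, blast)
  qed
  thus ?thesis using that q(1) JB by blast
qed

end

context vector_space_pair
begin

lemma rank_nullity:
  assumes f: "Vector_Spaces.linear s1 s2 f" and V: "vs1.subspace V" and W: "V \<subseteq> vs1.span W" "finite W"
  shows "vs1.dim V = vs1.dim {v\<in>V. f v = 0} + vs2.dim (f ` V)"
proof -
  interpret f: Vector_Spaces.linear s1 s2 f by (rule f)
  let ?K = "{v\<in>V. f v = 0}"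
  have K: "vs1.subspace ?K"
    using V by (auto simp: vs1.subspace_def f.add f.scale)
  obtain A where A: "A \<subseteq> ?K" "vs1.independent A" "?K \<subseteq> vs1.span A"
    using vs1.maximal_independent_subset by blast
  obtain B where B: "A \<subseteq> B" "B \<subseteq> V" "vs1.independent B" "V \<subseteq> vs1.span B"
    using A by (elim vs1.maximal_independent_subset_extend[of A V, rotated]) auto
  have finB: "finite B" using vs1.independent_span_bound[OF W(2) B(3)] B(2) W(1) by blast
  have inj: "inj_on f (vs1.span (B - A))"
  proof (subst f.inj_on_iff_eq_0, simp, intro ballI impI)
    fix x assume x: "x \<in> vs1.span (B - A)" "f x = 0"
    have "x \<in> V" using x(1) B(2) V by (metis Diff_subset order_trans subsetD vs1.span_minimal)
    hence xA: "x \<in> vs1.span A" using x(2) A(3) by blast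
    \<comment> \<open>The coordinates of \<open>x\<close> over \<open>B\<close> are supported in
      \<open>A\<close> and also in \<open>B - A\<close>, so all of them vanish.\<close>
    have rep: "vs1.representation B x = vs1.representation A x"
      "vs1.representation B x = vs1.representation (B - A) x"
      using vs1.representation_extend[OF B(3)] xA x(1) B(1) by blast+
    have "vs1.representation B x b = 0" for b
      using vs1.representation_ne_zero[of A x b] vs1.representation_ne_zero[of "B - A" x b] rep
      by (metis DiffD2)
    thus "x = 0"
      using vs1.sum_nonzero_representation_eq[OF B(3), of x] xA B(1)
      by (simp add: vs1.span_mono[THEN subsetD])
  qed
  have "vs2.independent (f ` (B - A))"
    by (rule f.independent_injective_image[OF vs1.independent_mono[OF B(3)] inj]) blast
  moreover have "f ` V \<subseteq> vs2.span (f ` (B - A))"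
  proof -
    have "f ` V \<subseteq> vs2.span (f ` B)" using f.spans_image[OF B(4)] .
    also have "f ` B \<subseteq> insert 0 (f ` (B - A))" using A(1) by auto
    hence "vs2.span (f ` B) \<subseteq> vs2.span (f ` (B - A))" by (metis vs2.span_insert_0 vs2.span_mono)
    finally show ?thesis .
  qed
  ultimately have "vs2.dim (f ` V) = card (f ` (B - A))"
    using B(2) by (intro vs2.dim_unique[of "f ` (B - A)"]) auto
  moreover have "card (f ` (B - A)) = card (B - A)"
    by (rule card_image) (rule inj_on_subset[OF inj vs1.span_superset])
  moreover have "vs1.dim ?K = card A" by (rule vs1.dim_unique[OF A(1,3,2) refl])
  moreover have "vs1.dim V = card B" by (rule vs1.dim_unique[OF B(2,4,3) refl])
  ultimately show ?thesis
    using finB B(1) by (simp add: card_Diff_subset finite_subset card_mono)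
qed

end

section \<open>Polynomials\<close>

interpretation cp: vector_space "\<lambda>c (p::'n cpoly). const_poly c * p"
  by unfold_locales
     (simp_all add: algebra_simps const_poly_def mult_single single_add single_one flip: mult.assoc)

text \<open>Submodules of the ring over itself are its ideals: \<open>ideal.subspace\<close> says
  that a set is an ideal, \<open>ideal.span\<close> is the ideal generated.\<close>

interpretation ideal: module "(*) :: 'n cpoly \<Rightarrow> 'n cpoly \<Rightarrow> 'n cpoly"
  by unfold_locales (simp_all add: algebra_simps)

lemma const_poly_mult_single: "const_poly c * Poly_Mapping.single m a = Poly_Mapping.single m (c * a)"
  by (simp add: const_poly_def mult_single)

lemma lookup_const_mult: "Poly_Mapping.lookup (const_poly c * p) m = c * Poly_Mapping.lookup p m"
  by (simp add: const_poly_def mult_map_scale_conv_mult[symmetric] map.rep_eq when_def)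

lemma const_poly_0 [simp]: "const_poly 0 = 0"
  and const_poly_1 [simp]: "const_poly 1 = 1"
  and const_poly_add: "const_poly (a + b) = const_poly a + const_poly b"
  and const_poly_mult: "const_poly (a * b) = const_poly a * const_poly b"
  by (simp_all add: const_poly_def single_add mult_single)

lemma const_poly_eq_0_iff [simp]: "const_poly c = 0 \<longleftrightarrow> c = 0"
  by (metis const_poly_def lookup_single_eq lookup_zero single_zero)

lemma const_poly_sum: "const_poly (\<Sum>x\<in>A. f x) = (\<Sum>x\<in>A. const_poly (f x))"
  by (induction A rule: infinite_finite_induct) (simp_all add: const_poly_add)

lemma const_poly_prod: "const_poly (\<Prod>x\<in>A. f x) = (\<Prod>x\<in>A. const_poly (f x))"
  by (induction A rule: infinite_finite_induct) (simp_all add: const_poly_mult)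

lemma poly_mapping_expand: "p = (\<Sum>m\<in>Poly_Mapping.keys p. Poly_Mapping.single m (Poly_Mapping.lookup p m))"
  by (rule poly_mapping_eqI)
     (auto simp: lookup_sum lookup_single when_def not_in_keys_iff_lookup_eq_zero)

lemma cpoly_induct [case_names single add]:
  assumes "\<And>m c. P (Poly_Mapping.single m c)" "\<And>p q. P p \<Longrightarrow> P q \<Longrightarrow> P (p + q)"
  shows "P (p :: 'a \<Rightarrow>\<^sub>0 'b::comm_monoid_add)"
proof -
  have "P (\<Sum>m\<in>A. Poly_Mapping.single m (Poly_Mapping.lookup p m))" if "finite A" for A
    using that
  proof induction
    case empty
    show ?case using assms(1)[of undefined 0] by simp
  qed (use assms in simp)
  from this[of "Poly_Mapping.keys p"] show ?thesis by (simp flip: poly_mapping_expand)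
qed

lemma homogeneousD: "homogeneous k p \<Longrightarrow> Poly_Mapping.lookup p m \<noteq> 0 \<Longrightarrow> mdeg m = k"
  by (auto simp: homogeneous_def in_keys_iff)

lemma homogeneousI: "(\<And>m. Poly_Mapping.lookup p m \<noteq> 0 \<Longrightarrow> mdeg m = k) \<Longrightarrow> homogeneous k p"
  by (auto simp: homogeneous_def in_keys_iff)

lemma homogeneous_0 [simp]: "homogeneous k 0"
  by (simp add: homogeneous_def)

lemma homogeneous_add: "homogeneous k p \<Longrightarrow> homogeneous k q \<Longrightarrow> homogeneous k (p + q)"
  by (rule homogeneousI) (metis add.right_neutral homogeneousD lookup_add)

lemma homogeneous_sum: "(\<And>x. x \<in> A \<Longrightarrow> homogeneous k (f x)) \<Longrightarrow> homogeneous k (\<Sum>x\<in>A. f x)"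
  by (induction A rule: infinite_finite_induct) (auto intro: homogeneous_add)

lemma homogeneous_const_mult: "homogeneous k p \<Longrightarrow> homogeneous k (const_poly c * p)"
  by (rule homogeneousI) (auto simp: lookup_const_mult dest: homogeneousD)

lemma homogeneous_single: "mdeg m = k \<Longrightarrow> homogeneous k (Poly_Mapping.single m c)"
  by (simp add: homogeneous_def)

lemma mdeg_0 [simp]: "mdeg 0 = 0"
  by (simp add: mdeg_def)

lemma mdeg_add: "mdeg (a + b) = mdeg a + mdeg b"
  by (simp add: mdeg_def lookup_add sum.distrib)

lemma mdeg_single [simp]: "mdeg (Poly_Mapping.single i k) = k"
  by (simp add: mdeg_def lookup_single when_def)

lemma mdeg_eq_0_iff [simp]: "mdeg m = 0 \<longleftrightarrow> m = 0"
  by (auto simp: mdeg_def poly_mapping_eq_iff fun_eq_iff)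

lemma lookup_le_mdeg: "Poly_Mapping.lookup m i \<le> mdeg m"
  by (simp add: mdeg_def member_le_sum)

lemma homogeneous_mult: "homogeneous k p \<Longrightarrow> homogeneous l q \<Longrightarrow> homogeneous (k + l) (p * q)"
  using keys_mult[of p q] by (fastforce simp: homogeneous_def mdeg_add)

lemma homogeneous_1 [simp]: "homogeneous 0 1"
  by (simp add: homogeneous_def)

lemma homogeneous_prod:
  "(\<And>x. x \<in> A \<Longrightarrow> homogeneous (d x) (f x)) \<Longrightarrow> homogeneous (\<Sum>x\<in>A. d x) (\<Prod>x\<in>A. f x)"
  by (induction A rule: infinite_finite_induct) (auto intro: homogeneous_mult)

lemma homogeneous_var [simp]: "homogeneous 1 (var i)"
  by (simp add: var_def homogeneous_single)

lemma homogeneous_linear_form [simp]: "homogeneous 1 (linear_form a)"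
  unfolding linear_form_def by (intro homogeneous_sum homogeneous_const_mult homogeneous_var)

subsection \<open>Monomials of a given degree\<close>

definition monomials :: "nat \<Rightarrow> ('n::finite \<Rightarrow>\<^sub>0 nat) set" where
  "monomials k = {m. mdeg m = k}"

lemma finite_monomials [simp]: "finite (monomials k :: ('n::finite \<Rightarrow>\<^sub>0 nat) set)"
proof (rule finite_imageD)
  show "finite (Poly_Mapping.lookup ` monomials k :: ('n \<Rightarrow> nat) set)"
  proof (rule finite_subset)
    show "Poly_Mapping.lookup ` monomials k \<subseteq> PiE (UNIV :: 'n set) (\<lambda>_. {..k})"
      using lookup_le_mdeg by (fastforce simp: monomials_def)
  qed (simp add: finite_PiE)
qed (auto simp: inj_on_def poly_mapping_eqI)

definition graded_part :: "nat \<Rightarrow> 'n::finite cpoly set" where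
  "graded_part k = {p. homogeneous k p}"

lemma subspace_graded_part: "cp.subspace (graded_part k)"
  by (auto simp: cp.subspace_def graded_part_def intro: homogeneous_add homogeneous_const_mult)

lemma homogeneous_expand:
  assumes "homogeneous k p"
  shows "p = (\<Sum>m\<in>monomials k. const_poly (Poly_Mapping.lookup p m) * Poly_Mapping.single m 1)"
proof (rule poly_mapping_eqI)
  fix n
  show "Poly_Mapping.lookup p n = Poly_Mapping.lookup
     (\<Sum>m\<in>monomials k. const_poly (Poly_Mapping.lookup p m) * Poly_Mapping.single m 1) n"
  proof (cases "n \<in> monomials k")
    case False
    hence "Poly_Mapping.lookup p n = 0"
      using homogeneousD[OF assms, of n] by (auto simp: monomials_def)
    thus ?thesis
      using False by (simp add: lookup_sum const_poly_mult_single lookup_single when_def)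
  qed (simp add: lookup_sum const_poly_mult_single lookup_single when_def)
qed

lemma graded_part_span: "graded_part k \<subseteq> cp.span ((\<lambda>m. Poly_Mapping.single m 1) ` monomials k)"
proof
  fix p :: "'a cpoly" assume "p \<in> graded_part k"
  hence "homogeneous k p" by (simp add: graded_part_def)
  show "p \<in> cp.span ((\<lambda>m. Poly_Mapping.single m 1) ` monomials k)"
    by (subst homogeneous_expand[OF \<open>homogeneous k p\<close>])
      (intro cp.span_sum cp.span_scale cp.span_base imageI)
qed

lemma complex_vector_space: "vector_space ((*) :: complex \<Rightarrow> complex \<Rightarrow> complex)"
  by unfold_locales (simp_all add: algebra_simps)

lemma linear_lookup: "Vector_Spaces.linear (\<lambda>c (p::'n cpoly). const_poly c * p) (*) (\<lambda>p. Poly_Mapping.lookup p m)"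
  unfolding Vector_Spaces.linear_iff
  using cp.vector_space_axioms complex_vector_space by (auto simp: lookup_add lookup_const_mult)

lemma dim_graded_part: "cp.dim (graded_part k :: 'n::finite cpoly set) = card (monomials k :: ('n \<Rightarrow>\<^sub>0 nat) set)"
proof (rule cp.dim_dual_family)
  show "Vector_Spaces.linear (\<lambda>c (p::'n cpoly). const_poly c * p) (*) (\<lambda>p. Poly_Mapping.lookup p m)"
    for m :: "'n \<Rightarrow>\<^sub>0 nat" by (rule linear_lookup)
  show "Poly_Mapping.lookup (Poly_Mapping.single y (1::complex)) x = (if x = y then 1 else 0)"
    for x y :: "'n \<Rightarrow>\<^sub>0 nat" by (simp add: lookup_single when_def)
  show "(\<lambda>m. Poly_Mapping.single m 1) ` monomials k \<subseteq> (graded_part k :: 'n cpoly set)"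
    by (auto simp: graded_part_def monomials_def homogeneous_single)
qed (use graded_part_span in auto)

subsection \<open>Homogeneous components\<close>

definition hcomp :: "nat \<Rightarrow> 'n::finite cpoly \<Rightarrow> 'n cpoly" where
  "hcomp k p = (\<Sum>m\<in>monomials k. Poly_Mapping.single m (Poly_Mapping.lookup p m))"

lemma lookup_hcomp: "Poly_Mapping.lookup (hcomp k p) m = (if mdeg m = k then Poly_Mapping.lookup p m else 0)"
  by (simp add: hcomp_def lookup_sum lookup_single when_def)
     (simp add: monomials_def)

lemma homogeneous_hcomp [simp]: "homogeneous k (hcomp k p)"
  by (rule homogeneousI) (auto simp: lookup_hcomp split: if_splits)

lemma hcomp_add: "hcomp k (p + q) = hcomp k p + hcomp k q"
  by (rule poly_mapping_eqI) (simp add: lookup_hcomp lookup_add)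

lemma hcomp_0 [simp]: "hcomp k 0 = 0"
  by (rule poly_mapping_eqI) (simp add: lookup_hcomp)

lemma hcomp_sum: "hcomp k (\<Sum>x\<in>A. f x) = (\<Sum>x\<in>A. hcomp k (f x))"
  by (induction A rule: infinite_finite_induct) (simp_all add: hcomp_add)

lemma hcomp_homogeneous: "homogeneous d p \<Longrightarrow> hcomp k p = (if d = k then p else 0)"
  by (rule poly_mapping_eqI) (auto simp: lookup_hcomp dest: homogeneousD)

text \<open>A homogeneous factor shifts degrees by \<open>d\<close>. The case distinction guards
  against the truncated difference \<open>k - d\<close>.\<close>

lemma hcomp_mult:
  assumes "homogeneous d q"
  shows "hcomp k (p * q) = (if d \<le> k then hcomp (k - d) p * q else 0)"
proof (induction p rule: cpoly_induct)
  case (single m c)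
  have h: "homogeneous (mdeg m + d) (Poly_Mapping.single m c * q)"
    by (intro homogeneous_mult assms homogeneous_single refl)
  show ?case
    using hcomp_homogeneous[OF h] hcomp_homogeneous[OF homogeneous_single[OF refl], of _ m c] by auto
next
  case (add p q)
  thus ?case by (simp add: distrib_right hcomp_add)
qed

subsection \<open>Substitution\<close>

lemma substitute_single:
  "substitute \<sigma> (Poly_Mapping.single m c) = const_poly c * (\<Prod>i\<in>UNIV. \<sigma> i ^ Poly_Mapping.lookup m i)"
  by (simp add: substitute_def)

lemma substitute_add: "substitute \<sigma> (p + q) = substitute \<sigma> p + substitute \<sigma> q"
  unfolding substitute_def by (rule setsum_keys_plus_distrib) (simp_all add: const_poly_add distrib_right)

lemma substitute_0 [simp]: "substitute \<sigma> 0 = 0"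
  by (simp add: substitute_def)

lemma substitute_mult: "substitute \<sigma> (p * q) = substitute \<sigma> p * substitute \<sigma> q"
proof (induction p rule: cpoly_induct)
  case (single m c)
  show ?case
  proof (induction q rule: cpoly_induct)
    case (single n d)
    show ?case
      by (simp add: mult_single substitute_single const_poly_mult lookup_add power_add prod.distrib)
  qed (simp add: distrib_left substitute_add)
qed (simp add: distrib_right substitute_add)

lemma substitute_const [simp]: "substitute \<sigma> (const_poly c) = const_poly c"
  by (simp add: substitute_single const_poly_def)

lemma substitute_1 [simp]: "substitute \<sigma> 1 = 1"
  using substitute_const[of \<sigma> 1] by simp

lemma substitute_var [simp]: "substitute \<sigma> (var i) = \<sigma> i"
proof -
  have "(\<Prod>j\<in>UNIV. \<sigma> j ^ Poly_Mapping.lookup (Poly_Mapping.single i 1) j) = (\<Prod>j\<in>UNIV. if j = i then \<sigma> j else 1)"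
    by (intro prod.cong) (auto simp: lookup_single when_def)
  thus ?thesis by (simp add: var_def substitute_single)
qed

lemma substitute_sum: "substitute \<sigma> (\<Sum>x\<in>A. f x) = (\<Sum>x\<in>A. substitute \<sigma> (f x))"
  by (induction A rule: infinite_finite_induct) (simp_all add: substitute_add)

lemma substitute_prod: "substitute \<sigma> (\<Prod>x\<in>A. f x) = (\<Prod>x\<in>A. substitute \<sigma> (f x))"
  by (induction A rule: infinite_finite_induct) (simp_all add: substitute_mult)

subsection \<open>Derivatives\<close>

lemma partial_deriv_single: "partial_deriv i (Poly_Mapping.single m c) =
    Poly_Mapping.single (m - Poly_Mapping.single i 1) (of_nat (Poly_Mapping.lookup m i) * c)"
  by (simp add: partial_deriv_def)

lemma partial_deriv_add: "partial_deriv i (p + q) = partial_deriv i p + partial_deriv i q"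
  unfolding partial_deriv_def by (rule setsum_keys_plus_distrib) (simp_all add: single_add distrib_left)

lemma partial_deriv_0 [simp]: "partial_deriv i 0 = 0"
  by (simp add: partial_deriv_def)

lemma partial_deriv_1 [simp]: "partial_deriv i 1 = 0"
  by (simp add: partial_deriv_single flip: single_one)

lemma partial_deriv_sum: "partial_deriv i (\<Sum>x\<in>A. f x) = (\<Sum>x\<in>A. partial_deriv i (f x))"
  by (induction A rule: infinite_finite_induct) (simp_all add: partial_deriv_add)

lemma single_minus_add:
  fixes m :: "'n \<Rightarrow>\<^sub>0 nat"
  assumes "Poly_Mapping.lookup m i > 0"
  shows "m - Poly_Mapping.single i 1 + n = m + n - Poly_Mapping.single i 1"
  using assms by (intro poly_mapping_eqI) (auto simp: lookup_add lookup_minus lookup_single when_def)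

lemma partial_deriv_mult: "partial_deriv i (p * q) = partial_deriv i p * q + p * partial_deriv i q"
proof (induction p rule: cpoly_induct)
  case (single m c)
  show ?case
  proof (induction q rule: cpoly_induct)
    case (single n d)
    \<comment> \<open>If \<open>i\<close> does not occur in \<open>m\<close>, truncated subtraction
      makes the two exponents differ, but then the coefficient \<open>of_nat 0\<close> kills both
      sides.\<close>
    have "Poly_Mapping.single (m + n - Poly_Mapping.single i 1) (of_nat (Poly_Mapping.lookup m i) * c * d)
        = Poly_Mapping.single (m - Poly_Mapping.single i 1 + n) (of_nat (Poly_Mapping.lookup m i) * c * d)"
      using single_minus_add[of m i n] by (cases "Poly_Mapping.lookup m i = 0") simp_all
    moreover have "Poly_Mapping.single (m + n - Poly_Mapping.single i 1) (c * (of_nat (Poly_Mapping.lookup n i) * d))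
        = Poly_Mapping.single (m + (n - Poly_Mapping.single i 1)) (c * (of_nat (Poly_Mapping.lookup n i) * d))"
      using single_minus_add[of n i m]
      by (cases "Poly_Mapping.lookup n i = 0") (simp_all add: add.commute)
    moreover have "partial_deriv i (Poly_Mapping.single m c * Poly_Mapping.single n d) =
        Poly_Mapping.single (m + n - Poly_Mapping.single i 1) (of_nat (Poly_Mapping.lookup m i) * c * d) +
        Poly_Mapping.single (m + n - Poly_Mapping.single i 1) (c * (of_nat (Poly_Mapping.lookup n i) * d))"
      by (simp add: mult_single partial_deriv_single lookup_add algebra_simps flip: single_add)
    ultimately show ?case
      by (simp add: mult_single partial_deriv_single)
  qed (simp add: distrib_left partial_deriv_add)
qed (simp add: distrib_right partial_deriv_add)

lemma partial_deriv_const [simp]: "partial_deriv i (const_poly c) = 0"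
  by (simp add: const_poly_def partial_deriv_single)

lemma partial_deriv_const_mult: "partial_deriv i (const_poly c * p) = const_poly c * partial_deriv i p"
  by (simp add: partial_deriv_mult)

lemma partial_deriv_var: "partial_deriv i (var j) = (if i = j then 1 else 0)"
  by (simp add: var_def partial_deriv_single lookup_single when_def)

lemma partial_deriv_linear_form: "partial_deriv i (linear_form a) = const_poly (vec_nth a i)"
  by (simp add: linear_form_def partial_deriv_sum partial_deriv_const_mult partial_deriv_var if_distrib cong: if_cong)

lemma homogeneous_partial_deriv:
  assumes "homogeneous d p" shows "homogeneous (d - 1) (partial_deriv i p)"
  unfolding partial_deriv_def
proof (rule homogeneous_sum)
  fix m assume m: "m \<in> Poly_Mapping.keys p"
  show "homogeneous (d - 1) (Poly_Mapping.single (m - Poly_Mapping.single i 1)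
          (of_nat (Poly_Mapping.lookup m i) * Poly_Mapping.lookup p m))"
  proof (cases "Poly_Mapping.lookup m i = 0")
    case False
    have "m - Poly_Mapping.single i 1 + Poly_Mapping.single i 1 = m"
      using False by (intro poly_mapping_eqI) (auto simp: lookup_add lookup_minus lookup_single when_def)
    hence "mdeg (m - Poly_Mapping.single i 1) + 1 = d"
      using m assms by (metis homogeneous_def mdeg_add mdeg_single)
    thus ?thesis by (intro homogeneous_single) simp
  qed simp
qed

lemma Euler_formula:
  assumes "homogeneous d p"
  shows "(\<Sum>i\<in>UNIV. var i * partial_deriv i p) = const_poly (of_nat d) * p"
proof -
  have *: "(\<Sum>i\<in>UNIV. var i * partial_deriv i (Poly_Mapping.single m c))
      = const_poly (of_nat (mdeg m)) * Poly_Mapping.single m c" for m :: "'a \<Rightarrow>\<^sub>0 nat" and c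
  proof -
    have "var i * partial_deriv i (Poly_Mapping.single m c)
        = Poly_Mapping.single m (of_nat (Poly_Mapping.lookup m i) * c)" for i
    proof (cases "Poly_Mapping.lookup m i = 0")
      case False
      hence "Poly_Mapping.single i 1 + (m - Poly_Mapping.single i 1) = m"
        by (intro poly_mapping_eqI) (auto simp: lookup_add lookup_minus lookup_single when_def)
      thus ?thesis by (simp add: var_def partial_deriv_single mult_single)
    qed (simp add: partial_deriv_single)
    moreover have "(\<Sum>i\<in>UNIV. Poly_Mapping.single m (of_nat (Poly_Mapping.lookup m i) * c))
       = Poly_Mapping.single m (\<Sum>i\<in>UNIV. of_nat (Poly_Mapping.lookup m i) * c)"
      by (rule poly_mapping_eqI) (simp add: lookup_sum lookup_single when_def)
    ultimately show ?thesis
      by (simp add: const_poly_mult_single mdeg_def sum_distrib_right)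
  qed
  let ?s = "\<lambda>m. Poly_Mapping.single m (Poly_Mapping.lookup p m)"
  have "(\<Sum>i\<in>UNIV. var i * partial_deriv i p) = (\<Sum>i\<in>UNIV. \<Sum>m\<in>Poly_Mapping.keys p. var i * partial_deriv i (?s m))"
    by (subst poly_mapping_expand[of p]) (simp add: partial_deriv_sum sum_distrib_left)
  also have "\<dots> = (\<Sum>m\<in>Poly_Mapping.keys p. \<Sum>i\<in>UNIV. var i * partial_deriv i (?s m))" by (rule sum.swap)
  also have "\<dots> = (\<Sum>m\<in>Poly_Mapping.keys p. const_poly (of_nat d) * ?s m)"
    by (intro sum.cong refl) (use assms in \<open>simp add: * homogeneous_def\<close>)
  also have "\<dots> = const_poly (of_nat d) * p"
    by (simp flip: sum_distrib_left poly_mapping_expand)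
  finally show ?thesis .
qed

lemma jacobian_ideal_contains:
  assumes "homogeneous d f" "d > 0"
  shows "f \<in> jacobian_ideal f"
proof -
  have "const_poly (1 / of_nat d) * (const_poly (of_nat d) * f) \<in> jacobian_ideal f"
    unfolding jacobian_ideal_def Euler_formula[OF assms(1), symmetric]
    by (intro ideal.span_scale ideal.span_sum ideal.span_base) blast
  thus ?thesis using assms(2) by (simp flip: mult.assoc const_poly_mult)
qed

section \<open>Hilbert functions of graded quotients\<close>

interpretation cpp: vector_space_pair
  "\<lambda>c (p::'n cpoly). const_poly c * p" "\<lambda>c (p::'m cpoly). const_poly c * p"
  by unfold_locales

lemma ideal_subspace_imp_subspace: "ideal.subspace J \<Longrightarrow> cp.subspace J"
  by (auto simp: ideal.subspace_def cp.subspace_def)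

lemma subspace_jacobian_ideal: "cp.subspace (jacobian_ideal f)"
  unfolding jacobian_ideal_def by (intro ideal_subspace_imp_subspace ideal.subspace_span)

text \<open>An ideal with homogeneous generators is graded: a component of \<open>c * x\<close> with
  \<open>x\<close> homogeneous is a component of \<open>c\<close> times \<open>x\<close>, or
  0.\<close>

lemma hcomp_in_span:
  assumes S: "\<And>s. s \<in> S \<Longrightarrow> \<exists>d. homogeneous d s" and p: "p \<in> ideal.span S"
  shows "hcomp k p \<in> ideal.span S"
  using p
proof (induction arbitrary: k rule: ideal.span_induct_alt)
  case base
  show ?case by (simp add: ideal.span_zero)
next
  case (step c x y)
  obtain d where "homogeneous d x" using S step(1) by blast
  thus ?case using step
    by (simp add: hcomp_add hcomp_mult ideal.span_add ideal.span_scale ideal.span_base ideal.span_zero)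
qed

lemma dim_quotient:
  fixes J :: "'n::finite cpoly set"
  assumes "Vector_Spaces.linear (\<lambda>c (p::'n cpoly). const_poly c * p) (\<lambda>c (p::'n cpoly). const_poly c * p) q"
    "{x. q x = 0} = J"
  shows "card (monomials k :: ('n \<Rightarrow>\<^sub>0 nat) set) = cp.dim (J \<inter> graded_part k) + cp.dim (q ` graded_part k)"
proof -
  have "cp.dim (graded_part k :: 'n cpoly set) = cp.dim {p \<in> graded_part k. q p = 0} + cp.dim (q ` graded_part k)"
    by (rule cpp.rank_nullity[OF assms(1) subspace_graded_part graded_part_span]) simp
  moreover have "{p \<in> graded_part k. q p = 0} = J \<inter> graded_part k" using assms(2) by auto
  ultimately show ?thesis by (simp add: dim_graded_part)
qed

text \<open>Only spanning modulo \<open>J\<close> is asked of \<open>B\<close>. It is applied to a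
  residue basis multiplied by a linear form, which need not stay independent.\<close>

lemma residue_spanning_card:
  fixes J :: "'n::finite cpoly set"
  assumes "cp.subspace J" "finite B"
    and B: "\<And>p. homogeneous k p \<Longrightarrow> \<exists>c. p - (\<Sum>b\<in>B. const_poly (c b) * b) \<in> J"
  shows "card (monomials k :: ('n \<Rightarrow>\<^sub>0 nat) set) \<le> card B + cp.dim (J \<inter> graded_part k)"
proof -
  obtain q where q: "Vector_Spaces.linear (\<lambda>c (p::'n cpoly). const_poly c * p) (\<lambda>c (p::'n cpoly). const_poly c * p) q"
    "{x. q x = 0} = J"
    using cp.subspace_is_kernel[OF assms(1)] by blast
  interpret q: Vector_Spaces.linear "\<lambda>c (p::'n cpoly). const_poly c * p" "\<lambda>c (p::'n cpoly). const_poly c * p" q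
    by (rule q(1))
  have "q ` graded_part k \<subseteq> cp.span (q ` B)"
  proof clarify
    fix p :: "'n cpoly" assume "p \<in> graded_part k"
    then obtain c where "p - (\<Sum>b\<in>B. const_poly (c b) * b) \<in> J"
      using B by (auto simp: graded_part_def)
    hence "q (p - (\<Sum>b\<in>B. const_poly (c b) * b)) = 0" using q(2) by auto
    hence "q p = (\<Sum>b\<in>B. const_poly (c b) * q b)" by (simp add: q.diff q.sum q.scale)
    thus "q p \<in> cp.span (q ` B)"
      by (simp add: cp.span_sum cp.span_scale cp.span_base)
  qed
  hence "cp.dim (q ` graded_part k) \<le> card (q ` B)" using assms(2) by (intro cp.dim_le_card) auto
  also have "\<dots> \<le> card B" using assms(2) by (rule card_image_le)
  finally show ?thesis using dim_quotient[OF q, of k] by simp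
qed

text \<open>Determines \<open>card B\<close> from \<open>J\<close> and \<open>k\<close> alone, so
  the choice inside \<open>milnor_dim\<close> does not affect its value.\<close>

lemma residue_basis_card:
  fixes J :: "'n::finite cpoly set"
  assumes "cp.subspace J" "residue_basis J k B"
  shows "card B + cp.dim (J \<inter> graded_part k) = card (monomials k :: ('n \<Rightarrow>\<^sub>0 nat) set)"
proof (rule antisym)
  obtain q where q: "Vector_Spaces.linear (\<lambda>c (p::'n cpoly). const_poly c * p) (\<lambda>c (p::'n cpoly). const_poly c * p) q"
    "{x. q x = 0} = J"
    using cp.subspace_is_kernel[OF assms(1)] by blast
  interpret q: Vector_Spaces.linear "\<lambda>c (p::'n cpoly). const_poly c * p" "\<lambda>c (p::'n cpoly). const_poly c * p" q
    by (rule q(1))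
  have fin: "finite B" and hom: "\<And>b. b \<in> B \<Longrightarrow> homogeneous k b"
    and indep: "\<And>c b. (\<Sum>b\<in>B. const_poly (c b) * b) \<in> J \<Longrightarrow> b \<in> B \<Longrightarrow> c b = 0"
    using assms(2) unfolding residue_basis_def by blast+
  have "card B \<le> cp.dim (q ` graded_part k)"
  proof (rule cp.independent_family_card_le_dim[OF fin])
    show "c b = 0" if "(\<Sum>b\<in>B. const_poly (c b) * q b) = 0" "b \<in> B" for c b
    proof (rule indep[OF _ that(2)])
      have "q (\<Sum>b\<in>B. const_poly (c b) * b) = 0" using that(1) by (simp add: q.sum q.scale)
      thus "(\<Sum>b\<in>B. const_poly (c b) * b) \<in> J" using q(2) by auto
    qed
    show "q ` B \<subseteq> q ` graded_part k" using hom by (auto simp: graded_part_def)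
  qed (rule q.spans_image[OF graded_part_span], simp)
  thus "card B + cp.dim (J \<inter> graded_part k) \<le> card (monomials k :: ('n \<Rightarrow>\<^sub>0 nat) set)"
    using dim_quotient[OF q, of k] by simp
  show "card (monomials k :: ('n \<Rightarrow>\<^sub>0 nat) set) \<le> card B + cp.dim (J \<inter> graded_part k)"
    using assms(2) by (intro residue_spanning_card[OF assms(1) fin]) (simp add: residue_basis_def)
qed

text \<open>Lifts a basis of the image of the degree \<open>k\<close> part under the projection
  \<open>q\<close> to homogeneous representatives.\<close>

lemma residue_basis_exists:
  fixes J :: "'n::finite cpoly set"
  assumes "cp.subspace J"
  obtains B where "residue_basis J k B"
proof -
  obtain q where q: "Vector_Spaces.linear (\<lambda>c (p::'n cpoly). const_poly c * p) (\<lambda>c (p::'n cpoly). const_poly c * p) q"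
    "{x. q x = 0} = J"
    using cp.subspace_is_kernel[OF assms(1)] by blast
  interpret q: Vector_Spaces.linear "\<lambda>c (p::'n cpoly). const_poly c * p" "\<lambda>c (p::'n cpoly). const_poly c * p" q
    by (rule q(1))
  obtain C where C: "C \<subseteq> q ` graded_part k" "cp.independent C" "q ` graded_part k \<subseteq> cp.span C" "finite C"
    by (rule cp.finite_basis_exists[OF q.spans_image[OF graded_part_span, of k]]) simp_all
  have "\<forall>c\<in>C. \<exists>b. b \<in> graded_part k \<and> q b = c" using C(1) by blast
  then obtain g where g: "\<And>c. c \<in> C \<Longrightarrow> g c \<in> graded_part k" "\<And>c. c \<in> C \<Longrightarrow> q (g c) = c"
    by metis
  have inj: "inj_on g C" by (rule inj_on_inverseI) (rule g(2))
  have qsum: "q (\<Sum>b\<in>g ` C. const_poly (c b) * b) = (\<Sum>x\<in>C. const_poly (c (g x)) * x)" for c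
    using inj g(2) by (simp add: sum.reindex q.sum q.scale)
  have "residue_basis J k (g ` C)"
    unfolding residue_basis_def
  proof (intro conjI allI impI ballI)
    show "finite (g ` C)" using C by simp
    show "homogeneous k b" if "b \<in> g ` C" for b using that g(1) by (auto simp: graded_part_def)
    fix c b assume "(\<Sum>b\<in>g ` C. const_poly (c b) * b) \<in> J" and b: "b \<in> g ` C"
    hence "(\<Sum>x\<in>C. const_poly (c (g x)) * x) = 0" using qsum[of c] q(2) by auto
    hence "c (g x) = 0" if "x \<in> C" for x
      using cp.independentD[OF C(2,4) subset_refl, of "\<lambda>x. c (g x)"] that by blast
    thus "c b = 0" using b by blast
  next
    fix p :: "'n cpoly" assume "homogeneous k p"
    hence "q p \<in> cp.span C" using C(3) by (auto simp: graded_part_def)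
    then obtain u where u: "q p = (\<Sum>x\<in>C. const_poly (u x) * x)"
      unfolding cp.span_finite[OF C(4)] by auto
    have "q (p - (\<Sum>b\<in>g ` C. const_poly (u (q b)) * b)) = 0"
      using qsum[of "\<lambda>b. u (q b)"] g(2) u by (simp add: q.diff)
    thus "\<exists>c. p - (\<Sum>b\<in>g ` C. const_poly (c b) * b) \<in> J" using q(2) by auto
  qed
  thus ?thesis using that by blast
qed

lemma residue_basis_milnor_dim:
  assumes "residue_basis (jacobian_ideal f) k B"
  shows "card B = milnor_dim f k"
proof -
  have "residue_basis (jacobian_ideal f) k (SOME B. residue_basis (jacobian_ideal f) k B)"
    using assms by (rule someI)
  thus ?thesis
    unfolding milnor_dim_def
    using residue_basis_card[OF subspace_jacobian_ideal[of f]] assms by (metis add_right_cancel)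
qed

lemma milnor_dim_eq:
  fixes f :: "'n::finite cpoly"
  shows "milnor_dim f k + cp.dim (jacobian_ideal f \<inter> graded_part k) = card (monomials k :: ('n \<Rightarrow>\<^sub>0 nat) set)"
  using residue_basis_exists[OF subspace_jacobian_ideal] residue_basis_milnor_dim
    residue_basis_card[OF subspace_jacobian_ideal] by metis

section \<open>Dickson's lemma and finite generation of graded submodules\<close>

text \<open>A decreasing sequence of naturals is constant from the place of its minimum on, so its
  tail is increasing as well.\<close>

lemma nat_seq_mono_subseq:
  fixes s :: "nat \<Rightarrow> nat"
  obtains g :: "nat \<Rightarrow> nat" where "strict_mono g" "mono (\<lambda>n. s (g n))"
proof -
  obtain g :: "nat \<Rightarrow> nat" where g: "strict_mono g" "monoseq (\<lambda>n. s (g n))"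
    using seq_monosub[of s] by blast
  show ?thesis
  proof (cases "incseq (\<lambda>n. s (g n))")
    case True
    thus ?thesis using that g by blast
  next
    case False
    hence dec: "decseq (\<lambda>n. s (g n))" using g(2) by (simp add: monoseq_iff)
    obtain n0 where n0: "\<And>n. s (g n0) \<le> s (g n)"
      using ex_has_least_nat[of "\<lambda>_. True" 0 "\<lambda>n. s (g n)"] by auto
    have "s (g (n0 + n)) = s (g n0)" for n
      using n0[of "n0 + n"] decseqD[OF dec, of n0 "n0 + n"] by simp
    hence "mono (\<lambda>n. s (g (n0 + n)))" by (simp add: mono_def)
    moreover have "strict_mono (\<lambda>n. g (n0 + n))"
      using g(1) by (simp add: strict_mono_def)
    ultimately show ?thesis using that by blast
  qed
qed

lemma vector_seq_mono_subseq:
  fixes s :: "nat \<Rightarrow> 'i \<Rightarrow> nat"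
  assumes "finite I"
  shows "\<exists>g :: nat \<Rightarrow> nat. strict_mono g \<and> (\<forall>i\<in>I. mono (\<lambda>n. s (g n) i))"
  using assms
proof induction
  case empty
  show ?case by (rule exI[of _ id]) (simp add: strict_mono_def)
next
  case (insert i I)
  then obtain g :: "nat \<Rightarrow> nat" where g: "strict_mono g" "\<And>i. i \<in> I \<Longrightarrow> mono (\<lambda>n. s (g n) i)"
    by blast
  obtain h :: "nat \<Rightarrow> nat" where h: "strict_mono h" "mono (\<lambda>n. s (g (h n)) i)"
    using nat_seq_mono_subseq[of "\<lambda>n. s (g n) i"] by blast
  have "mono (\<lambda>n. s (g (h n)) j)" if "j \<in> I" for j
    using g(2)[OF that] strict_mono_mono[OF h(1)] by (simp add: mono_def)
  moreover have "strict_mono (\<lambda>n. g (h n))" using g(1) h(1) by (simp add: strict_mono_def)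
  ultimately show ?case using h(2) by (intro exI[of _ "\<lambda>n. g (h n)"]) auto
qed

text \<open>\<open>M\<close> collects the exponents of \<open>S\<close> that are minimal for
  divisibility. An infinite \<open>M\<close> would contain an injective sequence with a subsequence
  monotone in every coordinate; its first term would divide the second, against minimality.\<close>

lemma Dickson:
  fixes S :: "('n::finite \<Rightarrow>\<^sub>0 nat) set"
  obtains M where "finite M" "M \<subseteq> S" "\<And>m. m \<in> S \<Longrightarrow> \<exists>m'\<in>M. \<exists>c. m = m' + c"
proof -
  define M where "M = {m\<in>S. \<forall>m'\<in>S. \<forall>c. m = m' + c \<longrightarrow> m' = m}"
  have "finite M"
  proof (rule ccontr)
    assume "infinite M"
    then obtain s :: "nat \<Rightarrow> 'n \<Rightarrow>\<^sub>0 nat" where s: "inj s" "range s \<subseteq> M"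
      using infinite_countable_subset by blast
    obtain g :: "nat \<Rightarrow> nat" where g: "strict_mono g" "\<And>i. mono (\<lambda>n. Poly_Mapping.lookup (s (g n)) i)"
      using vector_seq_mono_subseq[OF finite_class.finite_UNIV, of "\<lambda>n. Poly_Mapping.lookup (s n)"] by blast
    have "Poly_Mapping.lookup (s (g 0)) i \<le> Poly_Mapping.lookup (s (g 1)) i" for i
      using g(2)[of i] by (simp add: mono_def)
    hence "s (g 1) = s (g 0) + (s (g 1) - s (g 0))"
      by (intro poly_mapping_eqI) (simp add: lookup_add lookup_minus)
    moreover have "s (g 0) \<in> M" "s (g 1) \<in> M" using s(2) by auto
    ultimately have "s (g 0) = s (g 1)" unfolding M_def by blast
    hence "g 0 = g 1" using s(1) by (simp add: inj_def)
    thus False using g(1) by (simp add: strict_mono_eq)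
  qed
  moreover have "M \<subseteq> S" by (auto simp: M_def)
  moreover have "\<exists>m'\<in>M. \<exists>c. m = m' + c" if "m \<in> S" for m
    using that
  proof (induction "mdeg m" arbitrary: m rule: less_induct)
    case less
    show ?case
    proof (cases "m \<in> M")
      case True
      thus ?thesis by (metis add.right_neutral)
    next
      case False
      then obtain m' c where m': "m' \<in> S" "m = m' + c" "m' \<noteq> m"
        using less.prems by (auto simp: M_def)
      hence "mdeg c > 0" by (metis add.right_neutral mdeg_eq_0_iff neq0_conv)
      hence "mdeg m' < mdeg m" using m'(2) by (simp add: mdeg_add)
      then obtain m'' c' where "m'' \<in> M" "m' = m'' + c'" using less.hyps m'(1) by blast
      thus ?thesis using m'(2) by (metis add.assoc)
    qed
  qed
  ultimately show ?thesis using that by blast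
qed

section \<open>Free modules and their homogeneous pieces\<close>

lemma fun_sum_apply: "(\<Sum>x\<in>A. f x) a = (\<Sum>x\<in>A. f x a :: 'b::comm_monoid_add)"
  by (induction A rule: infinite_finite_induct) simp_all

text \<open>Tuples of polynomials carry two structures: \<open>fm\<close> has polynomial scalars and
  speaks of submodules, \<open>fv\<close> has complex scalars and measures dimensions.\<close>

interpretation fm: module "\<lambda>(p::'n cpoly) (v::nat \<Rightarrow> 'n cpoly) a. p * v a"
  by unfold_locales (rule ext, simp only: plus_fun_apply distrib_left distrib_right mult.assoc mult_1_left)+

interpretation fv: vector_space "\<lambda>c (v::nat \<Rightarrow> 'n cpoly) a. const_poly c * v a"
  by unfold_locales (rule ext, simp only: plus_fun_apply distrib_left distrib_right mult.assoc mult_1_left const_poly_add const_poly_mult const_poly_1)+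

definition free_part :: "nat \<Rightarrow> (nat \<Rightarrow> nat) \<Rightarrow> nat \<Rightarrow> (nat \<Rightarrow> 'n::finite cpoly) set" where
  "free_part r d k = {v \<in> free_module r. \<forall>a<r. \<forall>m. Poly_Mapping.lookup (v a) m \<noteq> 0 \<longrightarrow> d a + mdeg m = k}"

text \<open>Projection to degree \<open>k\<close> when the generator at position \<open>a\<close>
  has degree \<open>d a\<close>. Positions with \<open>d a > k\<close> contribute nothing; the guard
  is needed because \<open>k - d a\<close> truncates.\<close>

definition free_comp :: "nat \<Rightarrow> (nat \<Rightarrow> nat) \<Rightarrow> nat \<Rightarrow> (nat \<Rightarrow> 'n::finite cpoly) \<Rightarrow> nat \<Rightarrow> 'n cpoly" where
  "free_comp r d k v = (\<lambda>a. if a < r \<and> d a \<le> k then hcomp (k - d a) (v a) else 0)"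

definition graded_submodule :: "nat \<Rightarrow> (nat \<Rightarrow> nat) \<Rightarrow> (nat \<Rightarrow> 'n::finite cpoly) set \<Rightarrow> bool" where
  "graded_submodule r d N \<longleftrightarrow> fm.subspace N \<and> N \<subseteq> free_module r \<and> (\<forall>v\<in>N. \<forall>k. free_comp r d k v \<in> N)"

lemma free_comp_in_part: "free_comp r d k v \<in> free_part r d k"
  by (auto simp: free_part_def free_module_def free_comp_def lookup_hcomp split: if_splits)

lemma free_comp_of_part: "v \<in> free_part r d k \<Longrightarrow> free_comp r d k v = v"
proof (rule ext, rule poly_mapping_eqI)
  fix a m
  assume v: "v \<in> free_part r d k"
  show "Poly_Mapping.lookup (free_comp r d k v a) m = Poly_Mapping.lookup (v a) m"
  proof (cases "a < r \<and> Poly_Mapping.lookup (v a) m \<noteq> 0")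
    case True
    hence "d a + mdeg m = k" using v unfolding free_part_def by blast
    thus ?thesis using True by (auto simp: free_comp_def lookup_hcomp)
  next
    case False
    thus ?thesis using v
      by (cases "a < r") (auto simp: free_comp_def lookup_hcomp free_part_def free_module_def)
  qed
qed

lemma free_comp_decomposition:
  assumes "v \<in> free_module r"
  obtains K where "v = (\<Sum>k<K. free_comp r d k v)"
proof -
  let ?D = "\<Union>a<r. (\<lambda>m. d a + mdeg m) ` Poly_Mapping.keys (v a)"
  have "finite ?D" by (intro finite_UN_I finite_imageI finite_keys finite_lessThan)
  then obtain K where K: "\<And>x. x \<in> ?D \<Longrightarrow> x < K" unfolding finite_nat_set_iff_bounded by auto
  have "v a = (\<Sum>k<K. free_comp r d k v) a" for a
  proof (cases "a < r")
    case True
    have dK: "d a + mdeg m < K" if "Poly_Mapping.lookup (v a) m \<noteq> 0" for m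
      using that True by (intro K UN_I[of a] imageI) (simp_all add: in_keys_iff)
    show ?thesis
    proof (rule poly_mapping_eqI)
      fix m
      have "Poly_Mapping.lookup ((\<Sum>k<K. free_comp r d k v) a) m
          = (\<Sum>k<K. if k = d a + mdeg m then Poly_Mapping.lookup (v a) m else 0)"
        unfolding fun_sum_apply lookup_sum
        by (intro sum.cong refl) (auto simp: True free_comp_def lookup_hcomp)
      thus "Poly_Mapping.lookup (v a) m = Poly_Mapping.lookup ((\<Sum>k<K. free_comp r d k v) a) m"
        using dK[of m] by auto
    qed
  next
    case False
    thus ?thesis using assms by (simp add: fun_sum_apply free_comp_def free_module_def)
  qed
  thus ?thesis using that by blast
qed

lemma monomial_mult_free_part:
  assumes "u \<in> free_part r d k"
  shows "(\<lambda>a. Poly_Mapping.single c x * u a) \<in> free_part r d (mdeg c + k)"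
proof -
  have "d a + mdeg m = mdeg c + k" if a: "a < r" and m: "Poly_Mapping.lookup (Poly_Mapping.single c x * u a) m \<noteq> 0" for a m
  proof -
    have "m \<in> Poly_Mapping.keys (Poly_Mapping.single c x * u a)" using m by (simp add: in_keys_iff)
    then obtain n where "n \<in> Poly_Mapping.keys (u a)" "m = c + n"
      using keys_mult[of "Poly_Mapping.single c x" "u a"] by (auto split: if_splits)
    thus ?thesis using assms a by (auto simp: free_part_def mdeg_add in_keys_iff)
  qed
  thus ?thesis using assms by (auto simp: free_part_def free_module_def)
qed

lemma free_part_diff: "u \<in> free_part r d k \<Longrightarrow> v \<in> free_part r d k \<Longrightarrow> u - v \<in> free_part r d k"
  by (auto simp: free_part_def free_module_def lookup_minus) (metis diff_zero)

text \<open>Division by elements whose lexicographically leading monomials at position \<open>a\<close> form a Dickson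
  basis.  The degree does not change, so the leading monomial can drop only finitely often.\<close>

lemma leading_monomial_reduction:
  fixes H :: "(nat \<Rightarrow> 'n::{finite,linorder} cpoly) set"
  assumes N: "graded_submodule r d N" and H: "H = {v\<in>N. \<exists>k. v \<in> free_part r d k}"
    and "a < r" and G: "finite G" "G \<subseteq> H" "\<And>v. v \<in> H \<Longrightarrow> (\<forall>b<Suc a. v b = 0) \<Longrightarrow> v \<in> fm.span G"
  shows "\<exists>G'. finite G' \<and> G' \<subseteq> H \<and> (\<forall>v\<in>H. (\<forall>b<a. v b = 0) \<longrightarrow> v \<in> fm.span G')"
proof -
  define Z where "Z = {v\<in>H. (\<forall>b<a. v b = 0) \<and> v a \<noteq> 0}"
  define lm where "lm v = Max (Poly_Mapping.keys (v a))" for v :: "nat \<Rightarrow> 'n cpoly"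
  obtain M where M: "finite M" "M \<subseteq> lm ` Z" "\<And>m. m \<in> lm ` Z \<Longrightarrow> \<exists>m'\<in>M. \<exists>c. m = m' + c"
    by (rule Dickson[of "lm ` Z"]) (rule that)
  have "\<forall>m\<in>M. \<exists>v. v \<in> Z \<and> lm v = m" using M(2) by blast
  then obtain u where u: "\<And>m. m \<in> M \<Longrightarrow> u m \<in> Z" "\<And>m. m \<in> M \<Longrightarrow> lm (u m) = m" by metis
  define G' where "G' = G \<union> u ` M"
  have "v \<in> fm.span G'" if "v \<in> N" "v \<in> free_part r d k" "\<forall>b<a. v b = 0" for v k
    using that
  \<comment> \<open>The measure counts the monomials of degree \<open>k - d a\<close> up to the
    leading monomial of \<open>v a\<close>. The existential form also makes sense for
    \<open>v a = 0\<close>, where the count is 0.\<close>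
  proof (induction "card {m. mdeg m = k - d a \<and> (\<exists>x\<in>Poly_Mapping.keys (v a). m \<le> x)}" arbitrary: v rule: less_induct)
    case less
    have vH: "v \<in> H" using less.prems H by blast
    show ?case
    proof (cases "v a = 0")
      case True
      hence "v \<in> fm.span G" using G(3) vH less.prems(3) by (simp add: less_Suc_eq)
      thus ?thesis using fm.span_mono[of G G'] by (auto simp: G'_def)
    next
      case False
      hence vZ: "v \<in> Z" using vH less.prems(3) by (simp add: Z_def)
      then obtain m' c where m': "m' \<in> M" "lm v = m' + c" using M(3) by blast
      let ?u = "u m'"
      have uZ: "?u \<in> Z" "lm ?u = m'" using u m'(1) by blast+
      then obtain l where l: "?u \<in> free_part r d l" "?u \<in> N" and u0: "\<forall>b<a. ?u b = 0" "?u a \<noteq> 0"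
        unfolding Z_def H by blast
      have kv: "lm v \<in> Poly_Mapping.keys (v a)" and ku: "m' \<in> Poly_Mapping.keys (?u a)"
        using False u0(2) uZ(2) unfolding lm_def by (metis Max_in finite_keys keys_eq_empty)+
      \<comment> \<open>The quotient of the leading coefficients: \<open>y\<close> gets the same
        leading term at position \<open>a\<close> as \<open>v\<close>, and the difference
        \<open>w\<close> loses it.\<close>
      define x where "x = Poly_Mapping.lookup (v a) (lm v) / Poly_Mapping.lookup (?u a) m'"
      define y where "y = (\<lambda>b. Poly_Mapping.single c x * ?u b)"
      define w where "w = v - y"
      have deg: "d a + mdeg (lm v) = k" "d a + mdeg m' = l"
        using kv ku l(1) less.prems(2) \<open>a < r\<close> by (auto simp: free_part_def in_keys_iff)
      have "mdeg c + l = k" using deg m'(2) by (simp add: mdeg_add)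
      hence yp: "y \<in> free_part r d k" using monomial_mult_free_part[OF l(1), of c x] by (simp add: y_def)
      have yN: "y \<in> N" using N l(2) unfolding y_def graded_submodule_def by (intro fm.subspace_scale) blast+
      have wp: "w \<in> free_part r d k" unfolding w_def using less.prems(2) yp by (rule free_part_diff)
      have wN: "w \<in> N" unfolding w_def using N less.prems(1) yN unfolding graded_submodule_def
        by (intro fm.subspace_diff) blast+
      have w0: "\<forall>b<a. w b = 0" using less.prems(3) u0(1) by (simp add: w_def y_def)
      have ylow: "n \<le> lm v" if n: "n \<in> Poly_Mapping.keys (y a)" for n
      proof -
        obtain n' where n': "n' \<in> Poly_Mapping.keys (?u a)" "n = c + n'"
          using n keys_mult[of "Poly_Mapping.single c x" "?u a"] by (auto simp: y_def split: if_splits)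
        hence "n' \<le> m'" using uZ(2) by (metis Max_ge finite_keys lm_def)
        thus ?thesis using n'(2) m'(2) by (simp add: add.commute add_right_mono)
      qed
      have ylm: "Poly_Mapping.lookup (y a) (lm v) = Poly_Mapping.lookup (v a) (lm v)"
      proof -
        have "Poly_Mapping.lookup (Poly_Mapping.single c x * p) (m' + c) = x * Poly_Mapping.lookup p m'" for p :: "'n cpoly"
        proof (induction p rule: cpoly_induct)
          case (single m z)
          show ?case by (auto simp: mult_single lookup_single when_def add.commute)
        qed (simp add: distrib_left lookup_add)
        thus ?thesis using ku m'(2) by (simp add: y_def x_def in_keys_iff)
      qed
      have wlow: "n < lm v" if n: "n \<in> Poly_Mapping.keys (w a)" for n
      proof -
        have "n \<in> Poly_Mapping.keys (v a) \<union> Poly_Mapping.keys (y a)"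
          using n keys_diff[of "v a" "y a"] by (auto simp: w_def in_keys_iff lookup_minus)
        moreover have "n \<noteq> lm v" using n ylm by (auto simp: w_def in_keys_iff lookup_minus)
        ultimately show ?thesis using ylow[of n] by (auto simp: lm_def less_le)
      qed
      have "card {m. mdeg m = k - d a \<and> (\<exists>x\<in>Poly_Mapping.keys (w a). m \<le> x)}
          < card {m. mdeg m = k - d a \<and> (\<exists>x\<in>Poly_Mapping.keys (v a). m \<le> x)}"
      proof (rule psubset_card_mono)
        show "finite {m. mdeg m = k - d a \<and> (\<exists>x\<in>Poly_Mapping.keys (v a). m \<le> x)}"
          by (rule finite_subset[OF _ finite_monomials[of "k - d a"]]) (auto simp: monomials_def)
        have "lm v \<in> {m. mdeg m = k - d a \<and> (\<exists>x\<in>Poly_Mapping.keys (v a). m \<le> x)}"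
          using kv deg by auto
        moreover have "lm v \<notin> {m. mdeg m = k - d a \<and> (\<exists>x\<in>Poly_Mapping.keys (w a). m \<le> x)}"
          using wlow leD by blast
        moreover have "{m. mdeg m = k - d a \<and> (\<exists>x\<in>Poly_Mapping.keys (w a). m \<le> x)} \<subseteq>
          {m. mdeg m = k - d a \<and> (\<exists>x\<in>Poly_Mapping.keys (v a). m \<le> x)}"
        proof clarify
          fix m x assume "x \<in> Poly_Mapping.keys (w a)" "m \<le> x"
          hence "m \<le> lm v" using wlow[of x] by simp
          thus "\<exists>x\<in>Poly_Mapping.keys (v a). m \<le> x" using kv by (rule bexI)
        qed
        ultimately show "{m. mdeg m = k - d a \<and> (\<exists>x\<in>Poly_Mapping.keys (w a). m \<le> x)} \<subset>
          {m. mdeg m = k - d a \<and> (\<exists>x\<in>Poly_Mapping.keys (v a). m \<le> x)}" by blast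
      qed
      hence "w \<in> fm.span G'" using less.hyps wN wp w0 by blast
      moreover have "y \<in> fm.span G'"
        unfolding y_def by (intro fm.span_scale fm.span_base) (use m'(1) in \<open>simp add: G'_def\<close>)
      ultimately have "w + y \<in> fm.span G'" by (rule fm.span_add)
      thus ?thesis by (simp add: w_def)
    qed
  qed
  moreover have "finite G'" "G' \<subseteq> H" using G(1,2) M(1) u(1) by (auto simp: G'_def Z_def)
  ultimately show ?thesis unfolding H by blast
qed

text \<open>Filter by the elements that vanish in the first \<open>a\<close> positions. At
  \<open>a = r\<close> only 0 is left; going down to \<open>a = 0\<close>, each position adds
  finitely many generators. Treating homogeneous elements is enough, since every element is the sum
  of its components, which again lie in \<open>N\<close>.\<close>

lemma graded_submodule_finitely_generated:
  fixes N :: "(nat \<Rightarrow> 'n::{finite,linorder} cpoly) set"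
  assumes N: "graded_submodule r d N"
  obtains G where "finite G" "\<And>v. v \<in> G \<Longrightarrow> \<exists>k. v \<in> free_part r d k" "fm.span G = N"
proof -
  define H where "H = {v\<in>N. \<exists>k. v \<in> free_part r d k}"
  have "\<exists>G. finite G \<and> G \<subseteq> H \<and> (\<forall>v\<in>H. (\<forall>b<a. v b = 0) \<longrightarrow> v \<in> fm.span G)" if "a \<le> r" for a
    using that
  proof (induction rule: inc_induct)
    case base
    have "v = 0" if "v \<in> H" "\<forall>b<r. v b = 0" for v
    proof (rule ext)
      fix b show "v b = 0 b"
        using that by (cases "b < r") (auto simp: H_def free_part_def free_module_def)
    qed
    thus ?case by (intro exI[of _ "{}"]) auto
  next
    case (step a)
    then obtain G where "finite G" "G \<subseteq> H" "\<forall>v\<in>H. (\<forall>b<Suc a. v b = 0) \<longrightarrow> v \<in> fm.span G"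
      by metis
    with step.hyps show ?case
      by (intro leading_monomial_reduction[OF N H_def, of a G]) auto
  qed
  from this[of 0] obtain G where G: "finite G" "G \<subseteq> H" "\<And>v. v \<in> H \<Longrightarrow> v \<in> fm.span G" by auto
  have "fm.span G = N"
  proof
    show "fm.span G \<subseteq> N"
      using G(2) N by (intro fm.span_minimal) (auto simp: H_def graded_submodule_def)
    show "N \<subseteq> fm.span G"
    proof
      fix v assume v: "v \<in> N"
      hence "v \<in> free_module r" using N by (auto simp: graded_submodule_def)
      then obtain K where K: "v = (\<Sum>k<K. free_comp r d k v)"
        by (rule free_comp_decomposition)
      have "free_comp r d k v \<in> H" for k
        using v N free_comp_in_part[of r d k v] unfolding H_def graded_submodule_def by blast
      thus "v \<in> fm.span G" by (subst K) (intro fm.span_sum G(3))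
    qed
  qed
  thus ?thesis using that G(1,2) by (auto simp: H_def)
qed

section \<open>Minimal graded free resolutions\<close>

declare ideal.scale_scale [simp del] fm.scale_scale [simp del]

interpretation fvv: vector_space_pair
  "\<lambda>c (v::nat \<Rightarrow> 'n cpoly) a. const_poly c * v a" "\<lambda>c (v::nat \<Rightarrow> 'n cpoly) a. const_poly c * v a"
  by unfold_locales

interpretation fvc: vector_space_pair
  "\<lambda>c (v::nat \<Rightarrow> 'n cpoly) a. const_poly c * v a" "\<lambda>c (p::'n cpoly). const_poly c * p"
  by unfold_locales

definition degree_matrix ::
  "nat \<Rightarrow> (nat \<Rightarrow> nat) \<Rightarrow> nat \<Rightarrow> (nat \<Rightarrow> nat) \<Rightarrow> (nat \<Rightarrow> nat \<Rightarrow> 'n::finite cpoly) \<Rightarrow> bool" where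
  "degree_matrix r d s d' D \<longleftrightarrow> (\<forall>a<r. \<forall>b<s. \<forall>m\<in>Poly_Mapping.keys (D a b). d a + mdeg m = d' b)"

lemma mat_apply_add: "mat_apply r s D (u + v) = mat_apply r s D u + mat_apply r s D v"
  by (rule ext) (simp add: mat_apply_def distrib_left sum.distrib)

lemma mat_apply_scale: "mat_apply r s D (\<lambda>b. p * v b) = (\<lambda>a. p * mat_apply r s D v a)"
  by (rule ext) (simp add: mat_apply_def sum_distrib_left mult_ac)

lemma mat_apply_0 [simp]: "mat_apply r s D 0 = 0"
  by (rule ext) (simp add: mat_apply_def)

lemma linear_mat_apply: "Vector_Spaces.linear (\<lambda>c (v::nat \<Rightarrow> 'n cpoly) a. const_poly c * v a)
    (\<lambda>c (v::nat \<Rightarrow> 'n cpoly) a. const_poly c * v a) (mat_apply r s D)"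
  unfolding Vector_Spaces.linear_iff
  using fv.vector_space_axioms by (auto simp only: mat_apply_add mat_apply_scale)

lemma subspace_free_module: "fm.subspace (free_module r :: (nat \<Rightarrow> 'n cpoly) set)"
  unfolding fm.subspace_def by (simp add: free_module_def)

lemma subspace_free_part: "fv.subspace (free_part r d k :: (nat \<Rightarrow> 'n::finite cpoly) set)"
  unfolding fv.subspace_def
proof (intro conjI ballI allI)
  fix u v :: "nat \<Rightarrow> 'n cpoly" assume "u \<in> free_part r d k" "v \<in> free_part r d k"
  thus "u + v \<in> free_part r d k"
    unfolding free_part_def free_module_def by (auto simp: lookup_add) (metis add.right_neutral)
next
  fix c and v :: "nat \<Rightarrow> 'n cpoly" assume "v \<in> free_part r d k"
  thus "(\<lambda>a. const_poly c * v a) \<in> free_part r d k"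
    unfolding free_part_def free_module_def by (auto simp: lookup_const_mult)
qed (simp add: free_part_def free_module_def)

text \<open>A nonzero entry \<open>D a b\<close> is homogeneous of degree \<open>d' b - d a\<close>,
  so multiplying by it takes the component of degree \<open>k - d' b\<close> to the component of
  degree \<open>k - d a\<close>.\<close>

lemma mat_apply_free_comp:
  assumes "degree_matrix r d s d' D"
  shows "mat_apply r s D (free_comp s d' k v) = free_comp r d k (mat_apply r s D v)"
proof
  fix a
  show "mat_apply r s D (free_comp s d' k v) a = free_comp r d k (mat_apply r s D v) a"
  proof (cases "a < r")
    case True
    have "D a b * free_comp s d' k v b = (if d a \<le> k then hcomp (k - d a) (D a b * v b) else 0)" if b: "b < s" for b
    proof (cases "D a b = 0")
      case False
      then obtain m where m: "m \<in> Poly_Mapping.keys (D a b)" by (metis all_not_in_conv keys_eq_empty)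
      have deg: "d a + mdeg n = d' b" if "n \<in> Poly_Mapping.keys (D a b)" for n
        using assms True b that by (auto simp: degree_matrix_def)
      have "homogeneous (d' b - d a) (D a b)" using deg by (fastforce simp: homogeneous_def)
      from hcomp_mult[OF this, of "k - d a" "v b"] show ?thesis
        using deg[OF m] b by (auto simp: free_comp_def mult.commute)
    qed simp
    thus ?thesis using True by (simp add: mat_apply_def free_comp_def[of r] hcomp_sum)
  qed (simp add: mat_apply_def free_comp_def)
qed

lemma graded_submodule_kernel:
  assumes "degree_matrix r d s d' D"
  shows "graded_submodule s d' {v \<in> free_module s. mat_apply r s D v = (\<lambda>_. 0)}"
  unfolding graded_submodule_def
proof (intro conjI ballI allI)
  show "fm.subspace {v \<in> free_module s. mat_apply r s D v = (\<lambda>_. 0)}"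
    using subspace_free_module[of s]
    by (auto simp: fm.subspace_def mat_apply_add mat_apply_scale simp flip: zero_fun_def)
  fix v k assume "v \<in> {v \<in> free_module s. mat_apply r s D v = (\<lambda>_. 0)}"
  thus "free_comp s d' k v \<in> {v \<in> free_module s. mat_apply r s D v = (\<lambda>_. 0)}"
    by (simp add: mat_apply_free_comp[OF assms]) (simp add: free_comp_def free_module_def fun_eq_iff)
qed auto

lemma lookup_mult_0:
  "Poly_Mapping.lookup (p * q) (0 :: 'n::finite \<Rightarrow>\<^sub>0 nat) = (Poly_Mapping.lookup p 0 * Poly_Mapping.lookup q 0 :: complex)"
proof (induction p rule: cpoly_induct)
  case (single m c)
  show ?case
  proof (induction q rule: cpoly_induct)
    case (single n d)
    have "m + n = 0 \<longleftrightarrow> m = 0 \<and> n = 0" by (metis add_is_0 mdeg_add mdeg_eq_0_iff)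
    thus ?case by (auto simp: mult_single lookup_single when_def)
  qed (simp add: distrib_left lookup_add)
qed (simp add: distrib_right lookup_add)

text \<open>A homogeneous generating set of minimal cardinality admits only syzygies with entries in
  the maximal ideal: a unit entry would make one generator redundant.\<close>

lemma minimal_generators:
  fixes N :: "(nat \<Rightarrow> 'n::{finite,linorder} cpoly) set"
  assumes N: "graded_submodule r d N"
  obtains s d' D where "degree_matrix r d s d' D" "N = mat_apply r s D ` free_module s"
    "\<And>v b. v \<in> free_module s \<Longrightarrow> mat_apply r s D v = (\<lambda>_. 0) \<Longrightarrow> b < s \<Longrightarrow> Poly_Mapping.lookup (v b) 0 = 0"
proof -
  define P where "P G \<longleftrightarrow> finite G \<and> (\<forall>v\<in>G. \<exists>k. v \<in> free_part r d k) \<and> fm.span G = N" for G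
  have "\<exists>G. P G" using graded_submodule_finitely_generated[OF N] unfolding P_def by metis
  then obtain G where G: "P G" and min: "\<And>G'. P G' \<Longrightarrow> card G \<le> card G'"
    using ex_has_least_nat[of P _ card] by blast
  define s where "s = card G"
  have finG: "finite G" and spanG: "fm.span G = N" and homG: "\<And>v. v \<in> G \<Longrightarrow> \<exists>k. v \<in> free_part r d k"
    using G by (auto simp: P_def)
  obtain e where e: "bij_betw e {..<s} G"
    using ex_bij_betw_nat_finite[OF finG] by (auto simp: s_def atLeast0LessThan)
  have eG: "e b \<in> G" if "b < s" for b using e that by (auto simp: bij_betw_def)
  have "\<forall>b\<in>{..<s}. \<exists>k. e b \<in> free_part r d k" using homG eG by simp
  then obtain d' where d': "\<And>b. b < s \<Longrightarrow> e b \<in> free_part r d (d' b)" by (metis lessThan_iff)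
  define D where "D = (\<lambda>a b. e b a)"
  have dm: "degree_matrix r d s d' D"
    using d' by (auto simp: degree_matrix_def D_def free_part_def in_keys_iff)
  have app: "mat_apply r s D v = (\<Sum>b<s. (\<lambda>a. v b * e b a))" for v
  proof
    fix a
    have "e b a = 0" if "b < s" "\<not> a < r" for b
      using d'[OF that(1)] that(2) by (simp add: free_part_def free_module_def)
    thus "mat_apply r s D v a = (\<Sum>b<s. (\<lambda>a. v b * e b a)) a"
      by (simp add: mat_apply_def fun_sum_apply D_def mult.commute)
  qed
  have img: "N = mat_apply r s D ` free_module s"
  proof
    show "mat_apply r s D ` free_module s \<subseteq> N"
      unfolding spanG[symmetric] app
      by (intro image_subsetI fm.span_sum fm.span_scale fm.span_base eG) simp
    show "N \<subseteq> mat_apply r s D ` free_module s"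
    proof
      fix v assume "v \<in> N"
      then obtain u where "v = (\<Sum>x\<in>G. (\<lambda>a. u x * x a))"
        unfolding spanG[symmetric] fm.span_finite[OF finG] by blast
      also have "\<dots> = (\<Sum>b<s. (\<lambda>a. u (e b) * e b a))"
        by (rule sum.reindex_bij_betw[OF e, symmetric])
      also have "\<dots> = mat_apply r s D (\<lambda>b. if b < s then u (e b) else 0)"
        unfolding app by (intro sum.cong) auto
      finally have "v = mat_apply r s D (\<lambda>b. if b < s then u (e b) else 0)" .
      thus "v \<in> mat_apply r s D ` free_module s"
        by (simp add: free_module_def)
    qed
  qed
  have "Poly_Mapping.lookup (v b0) 0 = 0"
    if v: "v \<in> free_module s" "mat_apply r s D v = (\<lambda>_. 0)" "b0 < s" for v b0
  proof (rule ccontr)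
    assume nz: "Poly_Mapping.lookup (v b0) 0 \<noteq> 0"
    define c where "c = Poly_Mapping.lookup (v b0) 0"
    \<comment> \<open>The entry of the syzygy at \<open>b0\<close> merely has a nonzero constant
      term; in the component of degree \<open>d' b0\<close> this entry is the constant
      \<open>c\<close> itself, which can be inverted.\<close>
    define u where "u = free_comp s d' (d' b0) v"
    have "mat_apply r s D u = (\<lambda>_. 0)"
      unfolding u_def mat_apply_free_comp[OF dm] v(2) by (simp add: free_comp_def fun_eq_iff)
    hence "(\<Sum>b<s. (\<lambda>a. u b * e b a)) = 0" by (simp add: app zero_fun_def)
    hence "(\<lambda>a. u b0 * e b0 a) + (\<Sum>b\<in>{..<s} - {b0}. (\<lambda>a. u b * e b a)) = 0"
      using v(3) by (subst (asm) sum.remove[of _ b0]) auto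
    moreover have "u b0 = const_poly c"
    proof (rule poly_mapping_eqI)
      fix m show "Poly_Mapping.lookup (u b0) m = Poly_Mapping.lookup (const_poly c) m"
        using v(3) by (auto simp: u_def free_comp_def lookup_hcomp const_poly_def lookup_single when_def c_def)
    qed
    ultimately have eq: "(\<lambda>a. const_poly c * e b0 a) = - (\<Sum>b\<in>{..<s} - {b0}. (\<lambda>a. u b * e b a))"
      by (simp add: eq_neg_iff_add_eq_0)
    have eb: "e b \<in> G - {e b0}" if "b \<in> {..<s} - {b0}" for b
      using that e v(3) by (auto simp: bij_betw_def inj_on_def)
    have "(\<lambda>a. const_poly c * e b0 a) \<in> fm.span (G - {e b0})"
      unfolding eq by (intro fm.span_neg fm.span_sum fm.span_scale fm.span_base eb)
    hence "(\<lambda>a. const_poly (1 / c) * (const_poly c * e b0 a)) \<in> fm.span (G - {e b0})"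
      by (rule fm.span_scale)
    moreover have "c \<noteq> 0" using nz by (simp add: c_def)
    ultimately have red: "e b0 \<in> fm.span (G - {e b0})" by simp
    have "G \<subseteq> fm.span (G - {e b0})"
    proof
      fix x assume "x \<in> G"
      thus "x \<in> fm.span (G - {e b0})" using red by (cases "x = e b0") (auto intro: fm.span_base)
    qed
    hence "fm.span (G - {e b0}) = N"
      unfolding spanG[symmetric] by (metis Diff_subset fm.span_mono fm.span_span subset_antisym)
    hence "P (G - {e b0})" using finG homG by (auto simp: P_def)
    from min[OF this] show False
      using eG[OF v(3)] finG by (metis card_Diff1_less leD)
  qed
  thus ?thesis using that[OF dm img] by blast
qed

section \<open>Construction of a minimal resolution by iterated syzygies\<close>

definition minimal_submodule :: "nat \<Rightarrow> (nat \<Rightarrow> nat) \<Rightarrow> (nat \<Rightarrow> 'n::finite cpoly) set \<Rightarrow> bool" where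
  "minimal_submodule r d N \<longleftrightarrow> graded_submodule r d N \<and> (\<forall>v\<in>N. \<forall>a<r. Poly_Mapping.lookup (v a) 0 = 0)"

text \<open>The columns of \<open>D\<close> are minimal generators of \<open>N\<close>. The syzygies
  again satisfy the invariant \<open>minimal_submodule\<close>, being graded and without constant
  terms, so they can serve as the next \<open>N\<close>.\<close>

definition resolution_step where
  "resolution_step r d N s d' D \<longleftrightarrow>
     degree_matrix r d s d' D \<and> N = mat_apply r s D ` free_module s \<and>
     (\<forall>a<r. \<forall>b<s. Poly_Mapping.lookup (D a b) 0 = 0) \<and>
     minimal_submodule s d' {v \<in> free_module s. mat_apply r s D v = (\<lambda>_. 0)}"

lemma mat_apply_unit:
  assumes "b < s"
  shows "mat_apply r s D (\<lambda>x. if x = b then 1 else 0) = (\<lambda>a. if a < r then D a b else 0)"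
  using assms by (auto simp: mat_apply_def fun_eq_iff if_distrib cong: if_cong)

text \<open>A column of \<open>D\<close> is the image of a unit vector, hence an element of
  \<open>N\<close>, and elements of \<open>N\<close> have no constant terms; so the entries of
  \<open>D\<close> have none either.\<close>

lemma resolution_step_exists:
  fixes N :: "(nat \<Rightarrow> 'n::{finite,linorder} cpoly) set"
  assumes "minimal_submodule r d N"
  obtains s d' D where "resolution_step r d N s d' D"
proof -
  obtain s d' D where D: "degree_matrix r d s d' D" "N = mat_apply r s D ` free_module s"
    "\<And>v b. v \<in> free_module s \<Longrightarrow> mat_apply r s D v = (\<lambda>_. 0) \<Longrightarrow> b < s \<Longrightarrow> Poly_Mapping.lookup (v b) 0 = 0"
    using minimal_generators assms unfolding minimal_submodule_def by metis
  have "Poly_Mapping.lookup (D a b) 0 = 0" if ab: "a < r" "b < s" for a b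
  proof -
    have "(\<lambda>x. if x = b then 1 else 0) \<in> free_module s" using ab by (simp add: free_module_def)
    hence "(\<lambda>a. if a < r then D a b else 0) \<in> N"
      unfolding D(2) mat_apply_unit[OF ab(2), symmetric] by (rule imageI)
    thus ?thesis using assms ab(1) by (fastforce simp: minimal_submodule_def)
  qed
  hence "resolution_step r d N s d' D"
    unfolding resolution_step_def minimal_submodule_def
    using D graded_submodule_kernel[OF D(1)] by blast
  thus ?thesis using that by blast
qed

lemma resolution_of_submodule:
  fixes N0 :: "(nat \<Rightarrow> 'n::{finite,linorder} cpoly) set"
  assumes "minimal_submodule r0 d0 N0"
  obtains r d N D where "r 0 = r0" "d 0 = d0" "N 0 = N0"
    "\<And>i. resolution_step (r i) (d i) (N i) (r (Suc i)) (d (Suc i)) (D i)"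
    "\<And>i. N (Suc i) = {v \<in> free_module (r (Suc i)). mat_apply (r i) (r (Suc i)) (D i) v = (\<lambda>_. 0)}"
proof -
  \<comment> \<open>The invariant is a premise inside the choice, so that the step function
    \<open>F\<close> is total and can be iterated before the invariant is known for the later
    stages.\<close>
  have "\<forall>S. \<exists>T. (case S of (r, d, N) \<Rightarrow> minimal_submodule r d N \<longrightarrow>
      (case T of (s, d', D) \<Rightarrow> resolution_step r d (N :: (nat \<Rightarrow> 'n cpoly) set) s d' D))"
  proof
    fix S :: "nat \<times> (nat \<Rightarrow> nat) \<times> (nat \<Rightarrow> 'n cpoly) set"
    obtain r d N where S: "S = (r, d, N)" by (cases S)
    show "\<exists>T. (case S of (r, d, N) \<Rightarrow> minimal_submodule r d N \<longrightarrow>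
      (case T of (s, d', D) \<Rightarrow> resolution_step r d N s d' D))"
    proof (cases "minimal_submodule r d N")
      case True
      then obtain s d' D where "resolution_step r d N s d' D" by (rule resolution_step_exists)
      thus ?thesis by (intro exI[of _ "(s, d', D)"]) (simp add: S)
    qed (simp add: S)
  qed
  then obtain F where "\<forall>S. (case S of (r, d, N) \<Rightarrow> minimal_submodule r d N \<longrightarrow>
      (case F S of (s, d', D) \<Rightarrow> resolution_step r d (N :: (nat \<Rightarrow> 'n cpoly) set) s d' D))"
    by (rule choice[THEN exE])
  hence F: "resolution_step r d N s d' D" if "minimal_submodule r d N" "F (r, d, N) = (s, d', D)"
    for r d s d' D and N :: "(nat \<Rightarrow> 'n cpoly) set"
    using that spec[of _ "(r, d, N)"] by (simp split: prod.splits)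
  define nxt where "nxt S = (case S of (r, d, N) \<Rightarrow> case F S of (s, d', D) \<Rightarrow>
      (s, d', {v \<in> free_module s. mat_apply r s D v = (\<lambda>_. 0)}))" for S
  define S where "S i = (nxt ^^ i) (r0, d0, N0)" for i
  define r where "r i = fst (S i)" for i
  define d where "d i = fst (snd (S i))" for i
  define N where "N i = snd (snd (S i))" for i
  define D where "D i = snd (snd (F (S i)))" for i
  have S: "S i = (r i, d i, N i)" for i by (simp add: r_def d_def N_def)
  have Suc: "S (Suc i) = (case F (S i) of (s, d', D) \<Rightarrow> (s, d', {v \<in> free_module s. mat_apply (r i) s D v = (\<lambda>_. 0)}))" for i
    by (simp add: S_def nxt_def r_def split: prod.splits)
  have FS: "F (r i, d i, N i) = (r (Suc i), d (Suc i), D i)" for i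
    unfolding S[symmetric] using Suc[of i] by (simp add: r_def d_def D_def split: prod.splits)
  have NS: "N (Suc i) = {v \<in> free_module (r (Suc i)). mat_apply (r i) (r (Suc i)) (D i) v = (\<lambda>_. 0)}" for i
    using Suc[of i] FS[of i] unfolding S by simp
  have good: "minimal_submodule (r i) (d i) (N i)" for i
  proof (induction i)
    case 0
    show ?case using assms by (simp add: r_def d_def N_def S_def)
  next
    case (Suc i)
    from F[OF this FS] show ?case by (simp add: resolution_step_def NS)
  qed
  show ?thesis
    by (rule that[of r d N D]) (use F[OF good FS] NS in \<open>simp_all add: r_def d_def N_def S_def\<close>)
qed

text \<open>For a proper ideal take one generator 1 of degree 0: a nonzero constant term of an
  element of \<open>J\<close> would itself lie in \<open>J\<close>, as the component of degree 0,
  and make \<open>J\<close> everything. The unit ideal, which occurs for a single hyperplane, has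
  the zero resolution.\<close>

lemma minimal_resolution_exists:
  fixes J :: "'n::{finite,linorder} cpoly set"
  assumes J: "ideal.subspace J" and hc: "\<And>p k. p \<in> J \<Longrightarrow> hcomp k p \<in> J"
  obtains r d e D where "minimal_graded_free_resolution J r d e D"
proof (cases "J = UNIV")
  case True
  have "minimal_graded_free_resolution J (\<lambda>_. 0) (\<lambda>_ _. 0) (\<lambda>_. 0) (\<lambda>_ _ _. 0)"
    using True by (auto simp: minimal_graded_free_resolution_def free_module_def mat_apply_def image_def fun_eq_iff)
  thus ?thesis using that by blast
next
  case False
  define N0 :: "(nat \<Rightarrow> 'n cpoly) set" where "N0 = {v \<in> free_module 1. v 0 \<in> J}"
  have "minimal_submodule 1 (\<lambda>_. 0) N0"
    unfolding minimal_submodule_def graded_submodule_def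
  proof (intro conjI ballI allI impI)
    show "fm.subspace N0"
      using subspace_free_module[of 1] J by (auto simp: fm.subspace_def ideal.subspace_def N0_def)
    show "free_comp 1 (\<lambda>_. 0) k v \<in> N0" if "v \<in> N0" for v k
      using that hc by (auto simp: N0_def free_comp_def free_module_def)
    fix v and a :: nat assume v: "v \<in> N0" "a < 1"
    show "Poly_Mapping.lookup (v a) 0 = 0"
    proof (rule ccontr)
      assume nz: "Poly_Mapping.lookup (v a) 0 \<noteq> 0"
      define c where "c = Poly_Mapping.lookup (v 0) 0"
      have "hcomp 0 (v 0) \<in> J" using v by (intro hc) (simp add: N0_def)
      moreover have "hcomp 0 (v 0) = const_poly c"
        by (rule poly_mapping_eqI) (simp add: lookup_hcomp const_poly_def lookup_single when_def c_def)
      ultimately have "p * const_poly (1 / c) * const_poly c \<in> J" for p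
        using J by (simp add: ideal.subspace_scale)
      moreover have "c \<noteq> 0" using nz v(2) by (simp add: c_def)
      ultimately have "p \<in> J" for p by (simp add: mult.assoc flip: const_poly_mult)
      thus False using False by blast
    qed
  qed (auto simp: N0_def)
  then obtain r d N D where R: "r 0 = 1" "d 0 = (\<lambda>_. 0)" "N 0 = N0"
    "\<And>i. resolution_step (r i) (d i) (N i) (r (Suc i)) (d (Suc i)) (D i)"
    "\<And>i. N (Suc i) = {v \<in> free_module (r (Suc i)). mat_apply (r i) (r (Suc i)) (D i) v = (\<lambda>_. 0)}"
    by (rule resolution_of_submodule) (rule that)
  have "minimal_graded_free_resolution J r d (\<lambda>_. 1) D"
    unfolding minimal_graded_free_resolution_def
  proof (intro conjI allI impI ballI)
    show "homogeneous (d 0 b) 1" for b by (simp add: R)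
    show "d i a + mdeg m = d (Suc i) b" if "a < r i" "b < r (Suc i)" "m \<in> Poly_Mapping.keys (D i a b)" for i a b m
      using R(4)[of i] that by (simp add: resolution_step_def degree_matrix_def)
    show "Poly_Mapping.lookup (D i a b) 0 = 0" if "a < r i" "b < r (Suc i)" for i a b
      using R(4)[of i] that by (simp add: resolution_step_def)
    show "\<exists>v\<in>free_module (r 0). p - (\<Sum>b<r 0. v b * 1) \<in> J" for p
      using ideal.subspace_0[OF J]
      by (intro bexI[of _ "\<lambda>b. if b = 0 then p else 0"]) (simp_all add: R free_module_def)
    have "N i = mat_apply (r i) (r (Suc i)) (D i) ` free_module (r (Suc i))" for i
      using R(4)[of i] by (simp add: resolution_step_def)
    from this[of 0] this[of "Suc i" for i]
    show "{v \<in> free_module (r 0). (\<Sum>b<r 0. v b * 1) \<in> J} = mat_apply (r 0) (r 1) (D 0) ` free_module (r 1)"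
      and "{v \<in> free_module (r (Suc i)). mat_apply (r i) (r (Suc i)) (D i) v = (\<lambda>_. 0)} =
       mat_apply (r (Suc i)) (r (Suc (Suc i))) (D (Suc i)) ` free_module (r (Suc (Suc i)))" for i
      by (simp_all add: R N0_def)
  qed
  thus ?thesis using that by blast
qed

section \<open>Betti numbers determine the Hilbert function\<close>

text \<open>Indexes a basis of the degree \<open>k\<close> part of T(-j). The form with addition is
  empty for \<open>j > k\<close>, whereas \<open>monomials (k - j)\<close> would contain the
  monomial 1.\<close>

definition shifted_monomials :: "nat \<Rightarrow> nat \<Rightarrow> ('n::finite \<Rightarrow>\<^sub>0 nat) set" where
  "shifted_monomials j k = {m. j + mdeg m = k}"

lemma finite_shifted_monomials [simp]: "finite (shifted_monomials j k)"
  by (rule finite_subset[OF _ finite_monomials[of "k - j"]]) (auto simp: shifted_monomials_def monomials_def)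

lemma linear_lookup_component: "Vector_Spaces.linear (\<lambda>c (v::nat \<Rightarrow> 'n cpoly) a. const_poly c * v a) (*)
    (\<lambda>v. Poly_Mapping.lookup (v b) m)"
  unfolding Vector_Spaces.linear_iff
  using fv.vector_space_axioms complex_vector_space by (auto simp: lookup_add lookup_const_mult)

lemma free_part_expand:
  assumes "v \<in> free_part r d k"
  shows "v = (\<Sum>(b, m)\<in>Sigma {..<r} (\<lambda>b. shifted_monomials (d b) k).
    (\<lambda>a. const_poly (Poly_Mapping.lookup (v b) m) * (if a = b then Poly_Mapping.single m 1 else 0)))"
    (is "v = sum ?F ?X")
proof (rule ext, rule poly_mapping_eqI)
  fix a n
  have "Poly_Mapping.lookup (sum ?F ?X a) n
      = (\<Sum>(b, m)\<in>?X. if b = a \<and> m = n then Poly_Mapping.lookup (v a) n else 0)"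
    unfolding fun_sum_apply lookup_sum
    by (intro sum.cong refl) (auto simp: lookup_const_mult lookup_single when_def split: prod.splits)
  also have "\<dots> = (\<Sum>x\<in>?X. if x = (a, n) then Poly_Mapping.lookup (v a) n else 0)"
    by (intro sum.cong refl) (auto split: if_splits)
  also have "\<dots> = (if (a, n) \<in> ?X then Poly_Mapping.lookup (v a) n else 0)"
    by (subst sum.delta) auto
  also have "\<dots> = Poly_Mapping.lookup (v a) n"
    using assms
    by (cases "a < r") (auto simp: free_part_def free_module_def shifted_monomials_def)
  finally show "Poly_Mapping.lookup (v a) n = Poly_Mapping.lookup (sum ?F ?X a) n" by simp
qed

lemma free_part_span:
  "(free_part r d k :: (nat \<Rightarrow> 'n::finite cpoly) set) \<subseteq>
     fv.span ((\<lambda>(b, m) a. if a = b then Poly_Mapping.single m 1 else 0) `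
       Sigma {..<r} (\<lambda>b. shifted_monomials (d b) k))" (is "_ \<subseteq> fv.span (?u ` ?X)")
proof
  fix v :: "nat \<Rightarrow> 'n cpoly" assume v: "v \<in> free_part r d k"
  have "(\<Sum>(b, m)\<in>?X. (\<lambda>a. const_poly (Poly_Mapping.lookup (v b) m) * ?u (b, m) a)) \<in> fv.span (?u ` ?X)"
    unfolding case_prod_unfold by (intro fv.span_sum fv.span_scale fv.span_base) force
  thus "v \<in> fv.span (?u ` ?X)" using free_part_expand[OF v] by simp
qed

lemma dim_free_part:
  "fv.dim (free_part r d k :: (nat \<Rightarrow> 'n::finite cpoly) set)
     = (\<Sum>b<r. card (shifted_monomials (d b) k :: ('n \<Rightarrow>\<^sub>0 nat) set))"
proof -
  let ?X = "Sigma {..<r} (\<lambda>b. shifted_monomials (d b) k) :: (nat \<times> ('n \<Rightarrow>\<^sub>0 nat)) set"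
  let ?u = "\<lambda>(b, m) a. if a = b then Poly_Mapping.single m 1 else 0 :: 'n cpoly"
  have "fv.dim (free_part r d k :: (nat \<Rightarrow> 'n cpoly) set) = card ?X"
  proof (rule fv.dim_dual_family[where \<phi> = "\<lambda>(b, m) v. Poly_Mapping.lookup (v b) m" and u = ?u])
    show "Vector_Spaces.linear (\<lambda>c (v::nat \<Rightarrow> 'n cpoly) a. const_poly c * v a) (*)
      (case x of (b, m) \<Rightarrow> \<lambda>v. Poly_Mapping.lookup (v b) m)" for x
      using linear_lookup_component by (cases x) simp
    show "(case x of (b, m) \<Rightarrow> \<lambda>v. Poly_Mapping.lookup (v b) m) (?u y) = (if x = y then 1 else 0)" for x y
      by (auto simp: lookup_single when_def split: prod.splits)
    show "?u ` ?X \<subseteq> free_part r d k"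
      by (auto simp: free_part_def free_module_def shifted_monomials_def lookup_single when_def split: if_splits)
  qed (use free_part_span in auto)
  thus ?thesis by (simp add: card_SigmaI)
qed

text \<open>Groups generators by degree, so that the dimension of a graded piece depends only on the
  number of generators in each degree.\<close>

lemma sum_card_fibres:
  fixes d h :: "nat \<Rightarrow> nat"
  assumes "\<And>j. j > k \<Longrightarrow> h j = 0"
  shows "(\<Sum>b<r. h (d b)) = (\<Sum>j\<le>k. card {b. b < r \<and> d b = j} * h j)"
proof -
  let ?T = "d ` {..<r} \<union> {..k}"
  have "(\<Sum>b<r. h (d b)) = (\<Sum>j\<in>?T. \<Sum>b\<in>{b\<in>{..<r}. d b = j}. h (d b))"
    by (rule sum.group[symmetric]) auto
  also have "\<dots> = (\<Sum>j\<in>?T. card {b. b < r \<and> d b = j} * h j)"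
  proof (intro sum.cong refl)
    fix j
    have "(\<Sum>b\<in>{b\<in>{..<r}. d b = j}. h (d b)) = (\<Sum>b\<in>{b\<in>{..<r}. d b = j}. h j)"
      by (intro sum.cong) auto
    thus "(\<Sum>b\<in>{b\<in>{..<r}. d b = j}. h (d b)) = card {b. b < r \<and> d b = j} * h j" by simp
  qed
  also have "\<dots> = (\<Sum>j\<le>k. card {b. b < r \<and> d b = j} * h j)"
    by (rule sum.mono_neutral_right) (auto simp: assms)
  finally show ?thesis .
qed

lemma shifted_monomials_empty: "j > k \<Longrightarrow> card (shifted_monomials j k) = 0"
  by (simp add: shifted_monomials_def)

locale minimal_resolution =
  fixes J :: "'n::finite cpoly set" and r d e D
  assumes res: "minimal_graded_free_resolution J r d e D"
    and ideal: "ideal.subspace J"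
    and hcomp_closed: "\<And>p k. p \<in> J \<Longrightarrow> hcomp k p \<in> J"
begin

abbreviation V :: "nat \<Rightarrow> nat \<Rightarrow> (nat \<Rightarrow> 'n cpoly) set" where
  "V k i \<equiv> free_part (r i) (d i) k"

abbreviation L :: "nat \<Rightarrow> (nat \<Rightarrow> 'n cpoly) \<Rightarrow> nat \<Rightarrow> 'n cpoly" where
  "L i \<equiv> mat_apply (r i) (r (Suc i)) (D i)"

text \<open>The rank in degree \<open>k\<close> of the differential from the module at
  \<open>Suc i\<close> to the module at \<open>i\<close>.\<close>

definition w where "w k i = fv.dim (L i ` V k (Suc i))"

lemma degree_D: "degree_matrix (r i) (d i) (r (Suc i)) (d (Suc i)) (D i)"
  using res by (simp add: minimal_graded_free_resolution_def degree_matrix_def)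

lemma free_part_subset: "V k i \<subseteq> free_module (r i)"
  by (simp add: free_part_def)

text \<open>The degree \<open>k\<close> component of any preimage is again a preimage, because the
  differential respects degrees. Thus exactness passes to each degree.\<close>

lemma V_image:
  assumes "v \<in> V k i" "v \<in> L i ` free_module (r (Suc i))"
  shows "v \<in> L i ` V k (Suc i)"
proof -
  obtain u where u: "v = L i u" using assms(2) by blast
  have "L i (free_comp (r (Suc i)) (d (Suc i)) k u) = v"
    using mat_apply_free_comp[OF degree_D] free_comp_of_part[OF assms(1)] u by metis
  thus ?thesis using free_comp_in_part by (metis imageI)
qed

lemma L_in_V:
  assumes "v \<in> V k (Suc i)"
  shows "L i v \<in> V k i"
proof -
  have "L i v = free_comp (r i) (d i) k (L i v)"
    using mat_apply_free_comp[OF degree_D[of i], of k v] free_comp_of_part[OF assms] by simp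
  thus ?thesis using free_comp_in_part by metis
qed

lemma exact: "{v \<in> V k (Suc i). L i v = 0} = L (Suc i) ` V k (Suc (Suc i))"
proof -
  have ex: "{v \<in> free_module (r (Suc i)). L i v = (\<lambda>_. 0)} = L (Suc i) ` free_module (r (Suc (Suc i)))"
    using res by (simp add: minimal_graded_free_resolution_def)
  show ?thesis
  proof
    show "{v \<in> V k (Suc i). L i v = 0} \<subseteq> L (Suc i) ` V k (Suc (Suc i))"
    proof clarify
      fix v assume v: "v \<in> V k (Suc i)" "L i v = 0"
      hence "v \<in> L (Suc i) ` free_module (r (Suc (Suc i)))"
        unfolding ex[symmetric] using free_part_subset by (auto simp: zero_fun_def)
      thus "v \<in> L (Suc i) ` V k (Suc (Suc i))" using V_image v(1) by blast
    qed
    show "L (Suc i) ` V k (Suc (Suc i)) \<subseteq> {v \<in> V k (Suc i). L i v = 0}"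
    proof clarify
      fix v assume v: "v \<in> V k (Suc (Suc i))"
      hence "L (Suc i) v \<in> {v \<in> free_module (r (Suc i)). L i v = (\<lambda>_. 0)}"
        unfolding ex using free_part_subset by blast
      thus "L (Suc i) v \<in> V k (Suc i) \<and> L i (L (Suc i) v) = 0"
        using L_in_V[OF v] by (simp add: zero_fun_def)
    qed
  qed
qed

lemma dim_V: "fv.dim (V k (Suc i)) = w k (Suc i) + w k i"
proof -
  have "fv.dim (V k (Suc i)) = fv.dim {v \<in> V k (Suc i). L i v = 0} + fv.dim (L i ` V k (Suc i))"
    by (rule fvv.rank_nullity[OF linear_mat_apply subspace_free_part free_part_span]) simp
  thus ?thesis by (simp add: exact w_def)
qed

text \<open>No column of a differential is zero: otherwise a unit vector would be a cycle, hence a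
  boundary, yet boundaries have no constant terms. A nonzero entry has no constant term either, so
  degrees rise by at least 1 per step. In degree \<open>k\<close> the resolution therefore stops
  after position \<open>k\<close>.\<close>

lemma degree_ge: "b < r i \<Longrightarrow> i \<le> d i b"
proof (induction i arbitrary: b)
  case (Suc i)
  have min: "Poly_Mapping.lookup (D j a b) 0 = 0" if "a < r j" "b < r (Suc j)" for j a b
    using res that by (simp add: minimal_graded_free_resolution_def)
  let ?e = "\<lambda>x. if x = b then 1 else 0 :: 'n cpoly"
  have "\<exists>a<r i. D i a b \<noteq> 0"
  proof (rule ccontr)
    assume "\<not> ?thesis"
    hence "L i ?e = (\<lambda>_. 0)" using mat_apply_unit[OF Suc.prems, of "r i" "D i"] by auto
    moreover have "?e \<in> free_module (r (Suc i))" using Suc.prems by (simp add: free_module_def)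
    ultimately have "?e \<in> L (Suc i) ` free_module (r (Suc (Suc i)))"
      using res unfolding minimal_graded_free_resolution_def by blast
    then obtain u where u: "?e = L (Suc i) u" by blast
    have "Poly_Mapping.lookup (L (Suc i) u b) 0 = 0"
      using Suc.prems min[of b "Suc i"] by (simp add: mat_apply_def lookup_sum lookup_mult_0)
    thus False by (simp flip: u)
  qed
  then obtain a m where a: "a < r i" "m \<in> Poly_Mapping.keys (D i a b)"
    by (metis all_not_in_conv keys_eq_empty)
  have "m \<noteq> 0" using min[OF a(1) Suc.prems] a(2) by (auto simp: in_keys_iff)
  hence "mdeg m > 0" by (metis mdeg_eq_0_iff neq0_conv)
  moreover have "d i a + mdeg m = d (Suc i) b"
    using degree_D[of i] a Suc.prems by (auto simp: degree_matrix_def)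
  ultimately show ?case using Suc.IH[OF a(1)] by simp
qed simp

lemma dim_V_0: "i > k \<Longrightarrow> fv.dim (V k i) = 0"
  unfolding dim_free_part using degree_ge[of _ i]
  by (intro sum.neutral ballI shifted_monomials_empty) fastforce

text \<open>A lift to polynomials of the map from the module at position 0 onto the quotient by
  \<open>J\<close>.\<close>

definition aug where "aug v = (\<Sum>b<r 0. v b * e b)"

lemma aug_add: "aug (u + v) = aug u + aug v"
  by (simp add: aug_def distrib_right sum.distrib)

lemma aug_scale: "aug (\<lambda>b. const_poly c * v b) = const_poly c * aug v"
  by (simp add: aug_def sum_distrib_left mult.assoc)

lemma aug_free_comp: "aug (free_comp (r 0) (d 0) k v) = hcomp k (aug v)"
  unfolding aug_def hcomp_sum
proof (intro sum.cong refl)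
  fix b assume b: "b \<in> {..<r 0}"
  hence "homogeneous (d 0 b) (e b)" using res by (simp add: minimal_graded_free_resolution_def)
  from hcomp_mult[OF this] show "free_comp (r 0) (d 0) k v b * e b = hcomp k (v b * e b)"
    using b by (simp add: free_comp_def)
qed

lemma aug_homogeneous: "v \<in> V k 0 \<Longrightarrow> homogeneous k (aug v)"
  by (metis aug_free_comp free_comp_of_part homogeneous_hcomp)

text \<open>Rank-nullity for \<open>aug\<close> followed by the projection modulo \<open>J\<close>:
  the kernel is the image of the first differential, of dimension \<open>w k 0\<close>, and the
  image is the degree \<open>k\<close> part of the quotient. The additive form avoids subtraction of
  naturals.\<close>

lemma quotient_dim:
  "cp.dim (J \<inter> graded_part k) + fv.dim (V k 0) = card (monomials k :: ('n \<Rightarrow>\<^sub>0 nat) set) + w k 0"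
proof -
  obtain q where q: "Vector_Spaces.linear (\<lambda>c (p::'n cpoly). const_poly c * p) (\<lambda>c (p::'n cpoly). const_poly c * p) q"
    "{x. q x = 0} = J"
    using cp.subspace_is_kernel[OF ideal_subspace_imp_subspace[OF ideal]] by blast
  interpret q: Vector_Spaces.linear "\<lambda>c (p::'n cpoly). const_poly c * p" "\<lambda>c (p::'n cpoly). const_poly c * p" q
    by (rule q(1))
  have qJ: "q x = 0 \<longleftrightarrow> x \<in> J" for x using q(2) by blast
  have lin: "Vector_Spaces.linear (\<lambda>c (v::nat \<Rightarrow> 'n cpoly) a. const_poly c * v a) (\<lambda>c (p::'n cpoly). const_poly c * p) (\<lambda>v. q (aug v))"
    unfolding Vector_Spaces.linear_iff
    using fv.vector_space_axioms cp.vector_space_axioms by (simp add: aug_add aug_scale q.add q.scale)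
  have "fv.dim (V k 0) = fv.dim {v \<in> V k 0. q (aug v) = 0} + cp.dim ((\<lambda>v. q (aug v)) ` V k 0)"
    by (rule fvc.rank_nullity[OF lin subspace_free_part free_part_span]) simp
  moreover have "{v \<in> V k 0. q (aug v) = 0} = L 0 ` V k (Suc 0)"
  proof -
    have ex: "{v \<in> free_module (r 0). aug v \<in> J} = L 0 ` free_module (r 1)"
      using res by (simp add: minimal_graded_free_resolution_def aug_def)
    show ?thesis
    proof
      show "{v \<in> V k 0. q (aug v) = 0} \<subseteq> L 0 ` V k (Suc 0)"
      proof clarify
        fix v assume v: "v \<in> V k 0" "q (aug v) = 0"
        hence "v \<in> L 0 ` free_module (r (Suc 0))"
          using ex free_part_subset[of 0 k] qJ by auto
        thus "v \<in> L 0 ` V k (Suc 0)" by (rule V_image[OF v(1)])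
      qed
      show "L 0 ` V k (Suc 0) \<subseteq> {v \<in> V k 0. q (aug v) = 0}"
      proof clarify
        fix v assume v: "v \<in> V k (Suc 0)"
        hence "v \<in> free_module (r 1)" using free_part_subset[of "Suc 0" k] by auto
        hence "L 0 v \<in> {v \<in> free_module (r 0). aug v \<in> J}" unfolding ex by simp
        thus "L 0 v \<in> V k 0 \<and> q (aug (L 0 v)) = 0" using L_in_V[OF v] qJ by simp
      qed
    qed
  qed
  moreover have "(\<lambda>v. q (aug v)) ` V k 0 = q ` graded_part k"
  proof
    show "(\<lambda>v. q (aug v)) ` V k 0 \<subseteq> q ` graded_part k"
      using aug_homogeneous by (auto simp: graded_part_def)
    show "q ` graded_part k \<subseteq> (\<lambda>v. q (aug v)) ` V k 0"
    proof clarify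
      fix p :: "'n cpoly" assume p: "p \<in> graded_part k"
      have "\<exists>v\<in>free_module (r 0). p - aug v \<in> J"
        using res by (simp add: minimal_graded_free_resolution_def aug_def)
      then obtain v where "p - aug v \<in> J" by blast
      hence "hcomp k (p - aug v) \<in> J" by (rule hcomp_closed)
      moreover have "hcomp k (p - aug v) + hcomp k (aug v) = p"
        using p by (simp add: graded_part_def hcomp_homogeneous flip: hcomp_add)
      ultimately have "p - aug (free_comp (r 0) (d 0) k v) \<in> J"
        unfolding aug_free_comp by (simp add: eq_diff_eq[symmetric])
      hence "q p = q (aug (free_comp (r 0) (d 0) k v))" using qJ[symmetric] by (simp add: q.diff)
      thus "q p \<in> (\<lambda>v. q (aug v)) ` V k 0" using free_comp_in_part by blast
    qed
  qed
  ultimately show ?thesis using dim_quotient[OF q, of k] by (simp add: w_def)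
qed

end

text \<open>By exactness two consecutive ranks add up to the dimension of the piece between them.
  Ranks at positions from \<open>k\<close> on vanish, so descending induction determines all of them
  from the dimensions of the free pieces, hence from the Betti numbers.\<close>

lemma hilbert_function_eq_of_betti_eq:
  fixes J J' :: "'n::finite cpoly set"
  assumes "minimal_resolution J r d e D" "minimal_resolution J' r' d' e' D'"
    and betti: "\<And>i j. card {b. b < r i \<and> d i b = j} = card {b. b < r' i \<and> d' i b = j}"
  shows "cp.dim (J \<inter> graded_part k) = cp.dim (J' \<inter> graded_part k)"
proof -
  interpret A: minimal_resolution J r d e D by fact
  interpret B: minimal_resolution J' r' d' e' D' by fact
  have dimV: "fv.dim (free_part (r i) (d i) k :: (nat \<Rightarrow> 'n cpoly) set)
      = fv.dim (free_part (r' i) (d' i) k :: (nat \<Rightarrow> 'n cpoly) set)" for i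
  proof -
    let ?h = "\<lambda>j. card (shifted_monomials j k :: ('n \<Rightarrow>\<^sub>0 nat) set)"
    have "(\<Sum>b<r i. ?h (d i b)) = (\<Sum>b<r' i. ?h (d' i b))"
      using sum_card_fibres[of k ?h "d i" "r i"] sum_card_fibres[of k ?h "d' i" "r' i"]
      by (simp add: shifted_monomials_empty betti)
    thus ?thesis by (simp add: dim_free_part)
  qed
  have w: "A.w k i = B.w k i" for i
  proof (cases "i \<le> k")
    case True
    thus ?thesis
    proof (induction rule: inc_induct)
      case base
      show ?case using A.dim_V[of k k] B.dim_V[of k k] A.dim_V_0[of k "Suc k"] B.dim_V_0[of k "Suc k"] by simp
    next
      case (step n)
      show ?case using A.dim_V[of n k] B.dim_V[of n k] dimV[of "Suc n"] step.IH by simp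
    qed
  next
    case False
    thus ?thesis using A.dim_V[of i k] B.dim_V[of i k] A.dim_V_0[of k "Suc i"] B.dim_V_0[of k "Suc i"] by simp
  qed
  show ?thesis using A.quotient_dim[of k] B.quotient_dim[of k] dimV[of 0] w[of 0] by simp
qed

lemma milnor_dim_eq_of_betti_eq:
  fixes f f' :: "'n::{finite,linorder} cpoly"
  assumes "homogeneous m f" "homogeneous m' f'" and eq: "milnor_betti f = milnor_betti f'"
  shows "milnor_dim f k = milnor_dim f' k"
proof -
  have ex: "\<exists>r d e D. minimal_resolution (jacobian_ideal f) r d e D \<and>
      milnor_betti f = (\<lambda>i j. card {b. b < r i \<and> d i b = j})" if "homogeneous m f" for m and f :: "'n cpoly"
  proof -
    have I: "ideal.subspace (jacobian_ideal f)" unfolding jacobian_ideal_def by (rule ideal.subspace_span)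
    have H: "hcomp k p \<in> jacobian_ideal f" if "p \<in> jacobian_ideal f" for k p
      using that homogeneous_partial_deriv[OF \<open>homogeneous m f\<close>]
      unfolding jacobian_ideal_def by (intro hcomp_in_span) auto
    obtain r d e D where "minimal_graded_free_resolution (jacobian_ideal f) r d e D"
      using minimal_resolution_exists[OF I H] by blast
    hence "\<exists>\<beta>. \<exists>r d e D. minimal_graded_free_resolution (jacobian_ideal f) r d e D \<and>
        \<beta> = (\<lambda>i j. card {b. b < r i \<and> d i b = j})" by blast
    from someI_ex[OF this] obtain r d e D where "minimal_graded_free_resolution (jacobian_ideal f) r d e D"
      "milnor_betti f = (\<lambda>i j. card {b. b < r i \<and> d i b = j})"
      unfolding milnor_betti_def by blast
    thus ?thesis using I H minimal_resolution.intro by blast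
  qed
  obtain r d e D where 1: "minimal_resolution (jacobian_ideal f) r d e D"
    "milnor_betti f = (\<lambda>i j. card {b. b < r i \<and> d i b = j})" using ex[OF assms(1)] by blast
  obtain r' d' e' D' where 2: "minimal_resolution (jacobian_ideal f') r' d' e' D'"
    "milnor_betti f' = (\<lambda>i j. card {b. b < r' i \<and> d' i b = j})" using ex[OF assms(2)] by blast
  have "cp.dim (jacobian_ideal f \<inter> graded_part k) = cp.dim (jacobian_ideal f' \<inter> graded_part k)"
  proof (rule hilbert_function_eq_of_betti_eq[OF 1(1) 2(1)])
    show "card {b. b < r i \<and> d i b = j} = card {b. b < r' i \<and> d' i b = j}" for i j
      using eq unfolding 1(2) 2(2) by (simp add: fun_eq_iff)
  qed
  thus ?thesis using milnor_dim_eq[of f k] milnor_dim_eq[of f' k] by simp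
qed

section \<open>The Milnor algebra of a cone\<close>

definition embed_monomial :: "('n::finite \<Rightarrow>\<^sub>0 nat) \<Rightarrow> ('n option \<Rightarrow>\<^sub>0 nat)" where
  "embed_monomial m = (\<Sum>i\<in>UNIV. Poly_Mapping.single (Some i) (Poly_Mapping.lookup m i))"

definition restrict_monomial :: "('n::finite option \<Rightarrow>\<^sub>0 nat) \<Rightarrow> ('n \<Rightarrow>\<^sub>0 nat)" where
  "restrict_monomial M = (\<Sum>i\<in>UNIV. Poly_Mapping.single i (Poly_Mapping.lookup M (Some i)))"

lemma lookup_embed_monomial:
  "Poly_Mapping.lookup (embed_monomial m) x = (case x of None \<Rightarrow> 0 | Some i \<Rightarrow> Poly_Mapping.lookup m i)"
  by (cases x) (auto simp: embed_monomial_def lookup_sum lookup_single when_def)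

lemma lookup_restrict_monomial [simp]:
  "Poly_Mapping.lookup (restrict_monomial M) i = Poly_Mapping.lookup M (Some i)"
  by (auto simp: restrict_monomial_def lookup_sum lookup_single when_def)

lemma restrict_monomial_add: "restrict_monomial (M + N) = restrict_monomial M + restrict_monomial N"
  by (rule poly_mapping_eqI) (simp add: lookup_add)

lemma restrict_embed [simp]: "restrict_monomial (embed_monomial m) = m"
  by (rule poly_mapping_eqI) (simp add: lookup_embed_monomial)

lemma restrict_monomial_0 [simp]: "restrict_monomial 0 = 0"
  by (rule poly_mapping_eqI) simp

lemma restrict_monomial_None [simp]: "restrict_monomial (Poly_Mapping.single None k) = 0"
  by (rule poly_mapping_eqI) (simp add: lookup_single when_def)

lemma monomial_split:
  "Poly_Mapping.single None (Poly_Mapping.lookup M None) + embed_monomial (restrict_monomial M) = M"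
  by (rule poly_mapping_eqI) (simp add: lookup_add lookup_embed_monomial lookup_single when_def split: option.splits)

lemma mdeg_embed_monomial [simp]: "mdeg (embed_monomial m) = mdeg m"
  by (simp add: mdeg_def lookup_embed_monomial UNIV_option_conv sum.reindex)

lemma mdeg_split: "mdeg M = Poly_Mapping.lookup M None + mdeg (restrict_monomial M)"
  by (subst monomial_split[of M, symmetric]) (simp add: mdeg_add del: monomial_split)

lemma var_power: "var i ^ k = Poly_Mapping.single (Poly_Mapping.single i k) 1"
  by (induction k) (simp_all add: var_def mult_single flip: single_add)

lemma prod_single: "(\<Prod>x\<in>A. Poly_Mapping.single (f x) 1) = Poly_Mapping.single (\<Sum>x\<in>A. f x) (1::complex)"
  by (induction A rule: infinite_finite_induct) (simp_all add: mult_single)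

abbreviation lift_poly :: "'n::finite cpoly \<Rightarrow> 'n option cpoly" where
  "lift_poly \<equiv> substitute (\<lambda>i. var (Some i))"

lemma lift_poly_single: "lift_poly (Poly_Mapping.single m c) = Poly_Mapping.single (embed_monomial m) c"
  by (simp add: substitute_single var_power prod_single const_poly_mult_single embed_monomial_def)

lemma homogeneous_lift_poly: "homogeneous k p \<Longrightarrow> homogeneous k (lift_poly p)"
  by (subst poly_mapping_expand[of p])
    (auto simp: substitute_sum lift_poly_single homogeneous_def[of k p]
      intro!: homogeneous_sum homogeneous_single)

lemma partial_deriv_None_lift: "partial_deriv None (lift_poly p) = 0"
  by (induction p rule: cpoly_induct)
    (simp_all add: lift_poly_single substitute_add partial_deriv_add partial_deriv_single lookup_embed_monomial)

lemma partial_deriv_Some_lift: "partial_deriv (Some i) (lift_poly p) = lift_poly (partial_deriv i p)"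
proof (induction p rule: cpoly_induct)
  case (single m c)
  have "embed_monomial m - Poly_Mapping.single (Some i) 1 = embed_monomial (m - Poly_Mapping.single i 1)"
    by (rule poly_mapping_eqI)
       (simp add: lookup_minus lookup_embed_monomial lookup_single when_def split: option.splits)
  thus ?case by (simp add: lift_poly_single partial_deriv_single lookup_embed_monomial)
qed (simp add: substitute_add partial_deriv_add)

lemma partial_deriv_None_cone: "partial_deriv None (cone_poly g) = lift_poly g"
  by (simp add: cone_poly_def partial_deriv_mult partial_deriv_var partial_deriv_None_lift)

lemma partial_deriv_Some_cone: "partial_deriv (Some i) (cone_poly g) = var None * lift_poly (partial_deriv i g)"
  by (simp add: cone_poly_def partial_deriv_mult partial_deriv_var partial_deriv_Some_lift)

text \<open>The coefficient of $w^j$ of a polynomial in $R[w]$.\<close>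

definition wcoeff :: "nat \<Rightarrow> 'n::finite option cpoly \<Rightarrow> 'n cpoly" where
  "wcoeff j p = (\<Sum>M\<in>Poly_Mapping.keys p. Poly_Mapping.single (restrict_monomial M)
     (if Poly_Mapping.lookup M None = j then Poly_Mapping.lookup p M else 0))"

lemma wcoeff_single: "wcoeff j (Poly_Mapping.single M c)
    = Poly_Mapping.single (restrict_monomial M) (if Poly_Mapping.lookup M None = j then c else 0)"
  by (simp add: wcoeff_def)

lemma wcoeff_add: "wcoeff j (p + q) = wcoeff j p + wcoeff j q"
  unfolding wcoeff_def by (rule setsum_keys_plus_distrib) (simp_all add: single_add)

lemma wcoeff_0 [simp]: "wcoeff j 0 = 0"
  by (simp add: wcoeff_def)

lemma wcoeff_sum: "wcoeff j (\<Sum>x\<in>A. f x) = (\<Sum>x\<in>A. wcoeff j (f x))"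
  by (induction A rule: infinite_finite_induct) (simp_all add: wcoeff_add)

lemma wcoeff_mult_lift: "wcoeff j (p * lift_poly q) = wcoeff j p * q"
proof (induction p rule: cpoly_induct)
  case (single M c)
  show ?case
  proof (induction q rule: cpoly_induct)
    case (single m d)
    show ?case
      by (simp add: lift_poly_single mult_single wcoeff_single lookup_add lookup_embed_monomial restrict_monomial_add)
  qed (simp add: substitute_add distrib_left wcoeff_add)
qed (simp add: distrib_right wcoeff_add)

lemma wcoeff_mult_var: "wcoeff j (p * var None) = (case j of 0 \<Rightarrow> 0 | Suc i \<Rightarrow> wcoeff i p)"
proof (induction p rule: cpoly_induct)
  case (single M c)
  show ?case
    by (simp add: var_def mult_single wcoeff_single lookup_add restrict_monomial_add split: nat.splits)
qed (simp add: distrib_right wcoeff_add split: nat.splits)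

lemma wcoeff_mult_var_power: "wcoeff j (p * var None ^ i) = (if i \<le> j then wcoeff (j - i) p else 0)"
proof (induction i arbitrary: p)
  case (Suc i)
  have "wcoeff j (p * var None ^ Suc i) = wcoeff j ((p * var None) * var None ^ i)"
    by (simp add: mult_ac)
  thus ?case unfolding Suc by (auto simp: wcoeff_mult_var split: nat.splits) (metis Suc_diff_Suc Suc_le_eq diff_Suc_Suc nat.inject)+
qed simp

lemma wcoeff_lift: "wcoeff j (lift_poly q) = (if j = 0 then q else 0)"
proof -
  have "wcoeff j (Poly_Mapping.single 0 1) = (if j = 0 then 1 else 0 :: 'a cpoly)"
    by (simp add: wcoeff_single del: single_one) simp
  thus ?thesis using wcoeff_mult_lift[of j 1 q] by simp
qed

lemma wcoeff_power_lift: "wcoeff j (var None ^ i * lift_poly q) = (if i = j then q else 0)"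
  using wcoeff_mult_var_power[of j "lift_poly q" i] by (auto simp: wcoeff_lift mult.commute)

lemma wcoeff_const_mult: "wcoeff j (const_poly c * p) = const_poly c * wcoeff j p"
  using wcoeff_mult_lift[of j p "const_poly c"] by (simp add: mult.commute)

lemma homogeneous_wcoeff:
  assumes "homogeneous k p" shows "homogeneous (k - j) (wcoeff j p)"
  unfolding wcoeff_def
proof (rule homogeneous_sum)
  fix M assume "M \<in> Poly_Mapping.keys p"
  hence "mdeg M = k" using assms by (simp add: homogeneous_def)
  thus "homogeneous (k - j) (Poly_Mapping.single (restrict_monomial M)
     (if Poly_Mapping.lookup M None = j then Poly_Mapping.lookup p M else 0))"
    using mdeg_split[of M] by (auto intro!: homogeneous_single)
qed

lemma wcoeff_expand:
  assumes "\<And>M. M \<in> Poly_Mapping.keys p \<Longrightarrow> Poly_Mapping.lookup M None \<le> K"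
  shows "p = (\<Sum>j\<le>K. var None ^ j * lift_poly (wcoeff j p))"
proof -
  let ?c = "\<lambda>j M. if Poly_Mapping.lookup M None = j then Poly_Mapping.lookup p M else 0"
  have "(\<Sum>j\<le>K. var None ^ j * lift_poly (wcoeff j p))
      = (\<Sum>j\<le>K. \<Sum>M\<in>Poly_Mapping.keys p. var None ^ j * Poly_Mapping.single (embed_monomial (restrict_monomial M)) (?c j M))"
    by (simp add: wcoeff_def substitute_sum sum_distrib_left lift_poly_single)
  also have "\<dots> = (\<Sum>M\<in>Poly_Mapping.keys p. \<Sum>j\<le>K. var None ^ j * Poly_Mapping.single (embed_monomial (restrict_monomial M)) (?c j M))"
    by (rule sum.swap)
  also have "\<dots> = (\<Sum>M\<in>Poly_Mapping.keys p. Poly_Mapping.single M (Poly_Mapping.lookup p M))"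
  proof (intro sum.cong refl)
    fix M assume "M \<in> Poly_Mapping.keys p"
    hence le: "Poly_Mapping.lookup M None \<le> K" by (rule assms)
    have "(\<Sum>j\<le>K. var None ^ j * Poly_Mapping.single (embed_monomial (restrict_monomial M)) (?c j M))
       = (\<Sum>j\<le>K. if j = Poly_Mapping.lookup M None then Poly_Mapping.single M (Poly_Mapping.lookup p M) else 0)"
      by (intro sum.cong refl) (auto simp: var_power mult_single monomial_split)
    thus "(\<Sum>j\<le>K. var None ^ j * Poly_Mapping.single (embed_monomial (restrict_monomial M)) (?c j M))
       = Poly_Mapping.single M (Poly_Mapping.lookup p M)" using le by simp
  qed
  also have "\<dots> = p" by (simp flip: poly_mapping_expand)
  finally show ?thesis by simp
qed

text \<open>$J_{wg} = (g) + w J_g$, since $g \<in> J_g$; so its $w^0$-part is $(g)$ and its higher parts are $J_g$.\<close>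

definition cone_ideal_part :: "'n::finite cpoly \<Rightarrow> nat \<Rightarrow> 'n cpoly set" where
  "cone_ideal_part g j = (if j = 0 then ideal.span {g} else jacobian_ideal g)"

lemma ideal_subspace_cone_ideal_part: "ideal.subspace (cone_ideal_part g j)"
  by (simp add: cone_ideal_part_def jacobian_ideal_def)

text \<open>The derivative by the new variable is \<open>g\<close>, whose multiples may occur in
  every coefficient; this is where membership of \<open>g\<close> in its own Jacobian ideal enters.
  The other derivatives carry a factor w and leave the coefficient of w^0 untouched.\<close>

lemma jacobian_ideal_coneD:
  assumes g: "g \<in> jacobian_ideal g" and p: "p \<in> jacobian_ideal (cone_poly g)"
  shows "wcoeff j p \<in> cone_ideal_part g j"
  using p unfolding jacobian_ideal_def[of "cone_poly g"]
proof (induction rule: ideal.span_induct_alt)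
  case base
  show ?case by (simp add: ideal.subspace_0[OF ideal_subspace_cone_ideal_part])
next
  case (step c x y)
  then obtain i where x: "x = partial_deriv i (cone_poly g)" by blast
  have "wcoeff j (c * x) \<in> cone_ideal_part g j"
  proof (cases i)
    case None
    hence "wcoeff j (c * x) = wcoeff j c * g"
      by (simp add: x partial_deriv_None_cone wcoeff_mult_lift)
    thus ?thesis
      using g by (simp add: cone_ideal_part_def jacobian_ideal_def ideal.span_scale ideal.span_base)
  next
    case (Some a)
    have "c * x = (c * lift_poly (partial_deriv a g)) * var None"
      by (simp add: x Some partial_deriv_Some_cone mult_ac)
    hence "wcoeff j (c * x) = (case j of 0 \<Rightarrow> 0 | Suc i \<Rightarrow> wcoeff i c * partial_deriv a g)"
      by (simp add: wcoeff_mult_var wcoeff_mult_lift split: nat.split)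
    moreover have "q * partial_deriv a g \<in> jacobian_ideal g" for q
      unfolding jacobian_ideal_def by (intro ideal.span_scale ideal.span_base) blast
    ultimately show ?thesis
      by (simp add: cone_ideal_part_def ideal.span_zero split: nat.split)
  qed
  thus ?case using step(2) ideal.subspace_add[OF ideal_subspace_cone_ideal_part]
    by (simp add: wcoeff_add)
qed

lemma jacobian_ideal_coneI:
  assumes "p \<in> cone_ideal_part g j"
  shows "var None ^ j * lift_poly p \<in> jacobian_ideal (cone_poly g)"
proof (cases j)
  case 0
  then obtain c where "p = c * g" using assms by (auto simp: cone_ideal_part_def ideal.span_singleton)
  hence "var None ^ j * lift_poly p = lift_poly c * partial_deriv None (cone_poly g)"
    by (simp add: 0 substitute_mult partial_deriv_None_cone)
  thus ?thesis unfolding jacobian_ideal_def by (auto intro: ideal.span_scale ideal.span_base)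
next
  case (Suc i)
  hence "p \<in> ideal.span {partial_deriv i g |i. i \<in> UNIV}" using assms by (simp add: cone_ideal_part_def jacobian_ideal_def)
  hence "var None * lift_poly p \<in> jacobian_ideal (cone_poly g)"
  proof (induction rule: ideal.span_induct_alt)
    case base
    show ?case by (simp add: jacobian_ideal_def ideal.span_zero)
  next
    case (step c x y)
    then obtain a where x: "x = partial_deriv a g" by blast
    have "var None * lift_poly (c * x + y) = lift_poly c * partial_deriv (Some a) (cone_poly g) + var None * lift_poly y"
      by (simp add: x partial_deriv_Some_cone substitute_mult substitute_add distrib_left mult_ac)
    moreover have "partial_deriv (Some a) (cone_poly g) \<in> jacobian_ideal (cone_poly g)"
      unfolding jacobian_ideal_def by (rule ideal.span_base) blast
    ultimately show ?case using step(2) unfolding jacobian_ideal_def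
      by (simp add: ideal.span_add ideal.span_scale)
  qed
  hence "var None ^ i * (var None * lift_poly p) \<in> jacobian_ideal (cone_poly g)"
    unfolding jacobian_ideal_def by (rule ideal.span_scale)
  thus ?thesis by (simp add: Suc mult_ac)
qed

lemma residue_basis_nonzero:
  assumes "residue_basis J k B" "ideal.subspace J" shows "0 \<notin> B"
proof
  assume "0 \<in> B"
  have "(\<Sum>b\<in>B. const_poly (if b = 0 then 1 else 0) * b) = 0" by (rule sum.neutral) auto
  hence "(\<Sum>b\<in>B. const_poly ((\<lambda>b. if b = 0 then 1 else 0) b) * b) \<in> J"
    using ideal.subspace_0[OF assms(2)] by simp
  moreover have "\<forall>c. (\<Sum>b\<in>B. const_poly (c b) * b) \<in> J \<longrightarrow> (\<forall>b\<in>B. c b = 0)"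
    using assms(1) by (simp add: residue_basis_def)
  ultimately have "\<forall>b\<in>B. (\<lambda>b. if b = 0 then 1 else 0) b = (0::complex)" by (elim allE impE)
  thus False using \<open>0 \<in> B\<close> by auto
qed

text \<open>The Jacobian ideal of the cone splits along the powers of w, so residue bases of the
  parts, multiplied by w^j, combine to one. Relations and expansions are read off coefficientwise by
  \<open>wcoeff\<close>.\<close>

lemma residue_basis_cone:
  fixes g :: "'n::finite cpoly"
  assumes g: "g \<in> jacobian_ideal g"
    and C: "\<And>j. j \<le> k \<Longrightarrow> residue_basis (cone_ideal_part g j) (k - j) (C j)"
  shows "card (\<Union>j\<le>k. (\<lambda>x. var None ^ j * lift_poly x) ` C j) = (\<Sum>j\<le>k. card (C j))"
    and "residue_basis (jacobian_ideal (cone_poly g)) k (\<Union>j\<le>k. (\<lambda>x. var None ^ j * lift_poly x) ` C j)"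
proof -
  define h where "h = (\<lambda>(j, x :: 'n cpoly). var None ^ j * lift_poly x)"
  let ?X = "Sigma {..k} C"
  have B: "(\<Union>j\<le>k. (\<lambda>x. var None ^ j * lift_poly x) ` C j) = h ` ?X" by (force simp: h_def)
  \<comment> \<open>This keeps the pieces for different powers of w disjoint: a common element would
    have coefficient 0.\<close>
  have nz: "x \<noteq> 0" if "j \<le> k" "x \<in> C j" for j x
    using residue_basis_nonzero[OF C[OF that(1)] ideal_subspace_cone_ideal_part] that(2) by metis
  have finC: "finite (C j)" if "j \<le> k" for j using C[OF that] by (simp add: residue_basis_def)
  have inj: "inj_on h ?X"
  proof (rule inj_onI, clarify)
    fix i x j y
    assume *: "i \<le> k" "x \<in> C i" "j \<le> k" "y \<in> C j" "h (i, x) = h (j, y)"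
    have "wcoeff i (h (i, x)) = x" "wcoeff i (h (j, y)) = (if j = i then y else 0)"
      by (simp_all add: h_def wcoeff_power_lift)
    hence "x = (if j = i then y else 0)" using *(5) by simp
    thus "i = j \<and> x = y" using nz[OF *(1,2)] by (cases "j = i") simp_all
  qed
  have finX: "finite ?X" using finC by auto
  show "card (\<Union>j\<le>k. (\<lambda>x. var None ^ j * lift_poly x) ` C j) = (\<Sum>j\<le>k. card (C j))"
    unfolding B card_image[OF inj] using finC by (simp add: card_SigmaI)
  have sum: "(\<Sum>b\<in>h ` ?X. const_poly (c b) * b) = (\<Sum>j\<le>k. \<Sum>x\<in>C j. const_poly (c (h (j, x))) * h (j, x))" for c
    by (subst sum.Sigma) (use finC inj in \<open>auto simp: sum.reindex case_prod_unfold\<close>)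
  show "residue_basis (jacobian_ideal (cone_poly g)) k (\<Union>j\<le>k. (\<lambda>x. var None ^ j * lift_poly x) ` C j)"
    unfolding B residue_basis_def
  proof (intro conjI ballI allI impI)
    show "finite (h ` ?X)" using finX by simp
    show "homogeneous k b" if b: "b \<in> h ` ?X" for b
    proof -
      obtain j x where jx: "j \<le> k" "x \<in> C j" "b = h (j, x)" using b by auto
      have "homogeneous j (var None ^ j :: 'n option cpoly)" by (simp add: var_power homogeneous_single)
      moreover have "homogeneous (k - j) (lift_poly x)"
        using C[OF jx(1)] jx(2) by (intro homogeneous_lift_poly) (simp add: residue_basis_def)
      ultimately have "homogeneous (j + (k - j)) (var None ^ j * lift_poly x)" by (rule homogeneous_mult)
      thus ?thesis using jx by (simp add: h_def)
    qed
    fix c b assume s: "(\<Sum>b\<in>h ` ?X. const_poly (c b) * b) \<in> jacobian_ideal (cone_poly g)" and b: "b \<in> h ` ?X"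
    obtain j x where jx: "j \<le> k" "x \<in> C j" "b = h (j, x)" using b by auto
    have "wcoeff j (\<Sum>b\<in>h ` ?X. const_poly (c b) * b)
        = (\<Sum>i\<le>k. if i = j then \<Sum>x\<in>C j. const_poly (c (h (j, x))) * x else 0)"
      unfolding sum wcoeff_sum
      by (intro sum.cong refl) (auto simp: wcoeff_const_mult h_def wcoeff_power_lift)
    also have "\<dots> = (\<Sum>x\<in>C j. const_poly (c (h (j, x))) * x)" using jx(1) by simp
    finally have "(\<Sum>x\<in>C j. const_poly (c (h (j, x))) * x) \<in> cone_ideal_part g j"
      using jacobian_ideal_coneD[OF g s, of j] by simp
    with C[OF jx(1)] have "\<forall>x\<in>C j. c (h (j, x)) = 0"
      unfolding residue_basis_def by (elim conjE) (drule spec[of _ "\<lambda>x. c (h (j, x))"], simp)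
    thus "c b = 0" using jx by simp
  next
    fix p :: "'n option cpoly" assume p: "homogeneous k p"
    have "\<exists>c. wcoeff j p - (\<Sum>x\<in>C j. const_poly (c x) * x) \<in> cone_ideal_part g j" if "j \<le> k" for j
      using C[OF that] homogeneous_wcoeff[OF p, of j] by (simp add: residue_basis_def)
    hence "\<forall>j\<in>{..k}. \<exists>c. wcoeff j p - (\<Sum>x\<in>C j. const_poly (c x) * x) \<in> cone_ideal_part g j" by simp
    from bchoice[OF this] obtain c where
      c: "\<And>j. j \<le> k \<Longrightarrow> wcoeff j p - (\<Sum>x\<in>C j. const_poly (c j x) * x) \<in> cone_ideal_part g j"
      by auto
    define c' where "c' b = (case inv_into ?X h b of (j, x) \<Rightarrow> c j x)" for b
    have c': "c' (h (j, x)) = c j x" if "j \<le> k" "x \<in> C j" for j x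
      using inv_into_f_f[OF inj, of "(j, x)"] that by (simp add: c'_def)
    have "p = (\<Sum>j\<le>k. var None ^ j * lift_poly (wcoeff j p))"
      by (rule wcoeff_expand) (use p lookup_le_mdeg in \<open>metis homogeneous_def\<close>)
    moreover have "(\<Sum>b\<in>h ` ?X. const_poly (c' b) * b)
        = (\<Sum>j\<le>k. var None ^ j * lift_poly (\<Sum>x\<in>C j. const_poly (c j x) * x))"
      unfolding sum
    proof (intro sum.cong refl)
      fix j assume "j \<in> {..k}"
      thus "(\<Sum>x\<in>C j. const_poly (c' (h (j, x))) * h (j, x)) = var None ^ j * lift_poly (\<Sum>x\<in>C j. const_poly (c j x) * x)"
        using c'[of j] by (auto simp: substitute_sum substitute_mult sum_distrib_left h_def mult.left_commute intro!: sum.cong)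
    qed
    ultimately have "p - (\<Sum>b\<in>h ` ?X. const_poly (c' b) * b)
        = (\<Sum>j\<le>k. var None ^ j * lift_poly (wcoeff j p)) - (\<Sum>j\<le>k. var None ^ j * lift_poly (\<Sum>x\<in>C j. const_poly (c j x) * x))"
      by simp
    also have "\<dots> = (\<Sum>j\<le>k. var None ^ j * lift_poly (wcoeff j p - (\<Sum>x\<in>C j. const_poly (c j x) * x)))"
    proof -
      have "lift_poly (a - b) = lift_poly a - lift_poly b" for a b :: "'n cpoly"
        unfolding eq_diff_eq by (simp flip: substitute_add)
      thus ?thesis by (simp add: right_diff_distrib sum_subtractf)
    qed
    also have "\<dots> \<in> jacobian_ideal (cone_poly g)"
      unfolding jacobian_ideal_def
      by (intro ideal.span_sum jacobian_ideal_coneI[unfolded jacobian_ideal_def] c) simp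
    finally show "\<exists>c. p - (\<Sum>b\<in>h ` ?X. const_poly (c b) * b) \<in> jacobian_ideal (cone_poly g)" by blast
  qed
qed

section \<open>The dimension formula for the cone\<close>

lemma dim_principal_ideal:
  fixes g :: "'n::{finite,linorder} cpoly"
  assumes "homogeneous d g" "g \<noteq> 0" "d \<le> k"
  shows "cp.dim (ideal.span {g} \<inter> graded_part k) = card (monomials (k - d) :: ('n \<Rightarrow>\<^sub>0 nat) set)"
proof -
  have lin: "Vector_Spaces.linear (\<lambda>c (p::'n cpoly). const_poly c * p) (\<lambda>c (p::'n cpoly). const_poly c * p) (\<lambda>p. p * g)"
    unfolding Vector_Spaces.linear_iff using cp.vector_space_axioms by (simp add: distrib_right mult.assoc)
  have "(\<lambda>p. p * g) ` graded_part (k - d) = ideal.span {g} \<inter> graded_part k"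
  proof
    show "(\<lambda>p. p * g) ` graded_part (k - d) \<subseteq> ideal.span {g} \<inter> graded_part k"
      using homogeneous_mult[OF _ assms(1), of "k - d"] assms(3)
      by (auto simp: ideal.span_singleton graded_part_def)
    show "ideal.span {g} \<inter> graded_part k \<subseteq> (\<lambda>p. p * g) ` graded_part (k - d)"
    proof
      fix x assume "x \<in> ideal.span {g} \<inter> graded_part k"
      then obtain p where p: "x = p * g" "homogeneous k x" unfolding ideal.span_singleton graded_part_def by blast
      have "x = hcomp (k - d) p * g"
        using hcomp_mult[OF assms(1), of k p] hcomp_homogeneous[OF p(2), of k] assms(3) unfolding p(1) by argo
      thus "x \<in> (\<lambda>p. p * g) ` graded_part (k - d)" by (auto simp: graded_part_def)
    qed
  qed
  moreover have "{p \<in> graded_part (k - d). p * g = 0} = {0 :: 'n cpoly}"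
    using assms(2) by (auto simp: graded_part_def)
  moreover have "cp.dim {0 :: 'n cpoly} = 0"    by (rule cp.dim_unique[OF _ _ cp.independent_empty]) simp_all
  ultimately show ?thesis
    using cpp.rank_nullity[OF lin subspace_graded_part graded_part_span] dim_graded_part[where 'n = 'n, of "k - d"]
    by fastforce
qed

text \<open>The part without w is R/(g), whose dimension is a difference of two monomial counts
  because multiplication by \<open>g\<close> is injective. The negative count is moved to the left
  to stay within the naturals.\<close>

lemma milnor_dim_cone:
  fixes g :: "'n::{finite,linorder} cpoly"
  assumes g: "homogeneous d g" "g \<noteq> 0" "d > 0" and "d \<le> k"
  shows "milnor_dim (cone_poly g) k + card (monomials (k - d) :: ('n \<Rightarrow>\<^sub>0 nat) set)
     = card (monomials k :: ('n \<Rightarrow>\<^sub>0 nat) set) + (\<Sum>i<k. milnor_dim g i)"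
proof -
  have sub: "cp.subspace (cone_ideal_part g j)" for j
    by (intro ideal_subspace_imp_subspace ideal_subspace_cone_ideal_part)
  define C where "C j = (SOME B. residue_basis (cone_ideal_part g j) (k - j) B)" for j
  have C: "residue_basis (cone_ideal_part g j) (k - j) (C j)" for j
    unfolding C_def using residue_basis_exists[OF sub] by (metis someI_ex)
  have gJ: "g \<in> jacobian_ideal g" by (rule jacobian_ideal_contains[OF g(1,3)])
  have "milnor_dim (cone_poly g) k = (\<Sum>j\<le>k. card (C j))"
    using residue_basis_milnor_dim[OF residue_basis_cone(2)[OF gJ C]] residue_basis_cone(1)[OF gJ C]
    by simp
  also have "\<dots> = card (C 0) + (\<Sum>j<k. card (C (Suc j)))"
    by (simp add: sum.atMost_shift)
  \<comment> \<open>Next to w^(j+1) there remains degree \<open>k - Suc j\<close> of M(g); reversing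
    the index lists all degrees below \<open>k\<close> once.\<close>
  also have "(\<Sum>j<k. card (C (Suc j))) = (\<Sum>j<k. milnor_dim g (k - Suc j))"
    using C[of "Suc j" for j] by (intro sum.cong residue_basis_milnor_dim) (auto simp: cone_ideal_part_def)
  also have "\<dots> = (\<Sum>i<k. milnor_dim g i)" by (rule sum.nat_diff_reindex)
  finally have "milnor_dim (cone_poly g) k = card (C 0) + (\<Sum>i<k. milnor_dim g i)" .
  moreover have "card (C 0) + cp.dim (ideal.span {g} \<inter> graded_part k) = card (monomials k :: ('n \<Rightarrow>\<^sub>0 nat) set)"
    using residue_basis_card[OF sub C[of 0]] by (simp add: cone_ideal_part_def)
  ultimately show ?thesis using dim_principal_ideal[OF g(1,2) assms(4)] by simp
qed

section \<open>Line arrangements: the Hilbert function is eventually constant\<close>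

lemma lookup_linear_form: "Poly_Mapping.lookup (linear_form a) (Poly_Mapping.single i 1) = vec_nth a i"
proof -
  have "Poly_Mapping.lookup (linear_form a) (Poly_Mapping.single i 1) = (\<Sum>j\<in>UNIV. if j = i then vec_nth a j else 0)"
    unfolding linear_form_def lookup_sum
    by (intro sum.cong refl) (auto simp: lookup_const_mult var_def lookup_single when_def poly_mapping_eq_iff fun_eq_iff split: if_splits)
  thus ?thesis by simp
qed

lemma linear_form_eq_0_iff [simp]: "linear_form a = 0 \<longleftrightarrow> a = 0"
proof
  assume "linear_form a = 0"
  hence "vec_nth a i = 0" for i using lookup_linear_form[of a i] by simp
  thus "a = 0" by (simp add: vec_eq_iff)
qed (simp add: linear_form_def)

lemma linear_form_add: "linear_form (a + b) = linear_form a + linear_form b"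
  by (simp add: linear_form_def const_poly_add distrib_right sum.distrib)

lemma linear_form_scale: "linear_form (c *s a) = const_poly c * linear_form a"
  by (simp add: linear_form_def sum_distrib_left const_poly_mult mult.assoc del: cp.scale_scale ideal.scale_scale)

lemma linear_form_axis: "linear_form (axis i 1) = var i"
proof -
  have "linear_form (axis i 1) = (\<Sum>j\<in>UNIV. if j = i then var j else 0)"
    unfolding linear_form_def by (intro sum.cong refl) (auto simp: axis_def)
  thus ?thesis by simp
qed

lemma homogeneous_prod_linear_forms: "homogeneous (card A) (\<Prod>a\<in>A. linear_form a)"
  using homogeneous_prod[of A "\<lambda>_. 1", OF homogeneous_linear_form] by simp

section \<open>A line through no multiple point of the arrangement\<close>

definition cdet3 :: "complex ^ 3 \<Rightarrow> complex ^ 3 \<Rightarrow> complex ^ 3 \<Rightarrow> complex" where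
  "cdet3 u v w = u$1 * (v$2 * w$3 - v$3 * w$2) + u$2 * (v$3 * w$1 - v$1 * w$3) + u$3 * (v$1 * w$2 - v$2 * w$1)"

lemma Cramer3: "cdet3 u v w *s x = cdet3 x v w *s u + cdet3 u x w *s v + cdet3 u v x *s w"
  by (simp add: vec_eq_iff forall_3 cdet3_def algebra_simps)

text \<open>Look for \<open>l\<close> on the conic (1, s, s^2). The determinant with
  \<open>a\<close> and \<open>b\<close> is then a polynomial in s whose coefficients are the entries
  of their cross product, nonzero for non-proportional vectors; finitely many such polynomials have
  a common non-root.\<close>

lemma generic_line:
  fixes A :: "(complex ^ 3) set"
  assumes "finite A" "0 \<notin> A" "\<forall>a\<in>A. \<forall>b\<in>A. a \<noteq> b \<longrightarrow> (\<forall>c. a \<noteq> c *s b)"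
  obtains l where "l \<noteq> 0" "\<And>a b. a \<in> A \<Longrightarrow> b \<in> A \<Longrightarrow> a \<noteq> b \<Longrightarrow> cdet3 l a b \<noteq> 0"
proof -
  define P where "P a b = [:a$2 * b$3 - a$3 * b$2, a$3 * b$1 - a$1 * b$3, a$1 * b$2 - a$2 * b$1:]" for a b :: "complex ^ 3"
  have nz: "P a b \<noteq> 0" if ab: "a \<in> A" "b \<in> A" "a \<noteq> b" for a b
  proof
    assume "P a b = 0"
    hence c: "a$2 * b$3 = a$3 * b$2" "a$3 * b$1 = a$1 * b$3" "a$1 * b$2 = a$2 * b$1" by (auto simp: P_def)
    have "b \<noteq> 0" using ab assms(2) by auto
    then obtain j where j: "b$j \<noteq> 0" by (auto simp: vec_eq_iff)
    have "a$i * b$j = a$j * b$i" for i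
      using exhaust_3[of i] exhaust_3[of j] c by auto
    hence "a = (a$j / b$j) *s b" using j by (simp add: vec_eq_iff field_simps)
    thus False using assms(3) ab by blast
  qed
  define R where "R = (\<Union>a\<in>A. \<Union>b\<in>A - {a}. {s. poly (P a b) s = 0})"
  have "finite R" unfolding R_def using assms(1) nz by (intro finite_UN_I poly_roots_finite) auto
  then obtain s where s: "s \<notin> R" using ex_new_if_finite[OF infinite_UNIV_char_0] by blast
  define l :: "complex ^ 3" where "l = vector [1, s, s^2]"
  have l: "l$1 = 1" "l$2 = s" "l$3 = s^2" by (simp_all add: l_def)
  have "cdet3 l a b = poly (P a b) s" for a b
    by (simp add: P_def cdet3_def l algebra_simps power2_eq_square)
  moreover have "l \<noteq> 0" using l(1) by auto
  ultimately show ?thesis using that[of l] s by (auto simp: R_def)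
qed

subsection \<open>Radicals\<close>

text \<open>The algebraic form of V(uv) = V(u) \<union> V(v), with the exponents added.\<close>

lemma radical_insert_mult:
  assumes "x ^ n \<in> ideal.span (insert u S)" "x ^ m \<in> ideal.span (insert v S)"
  shows "x ^ (n + m) \<in> ideal.span (insert (u * v) S)"
proof -
  obtain a where a: "x ^ n - a * u \<in> ideal.span S" using assms(1) by (auto simp: ideal.span_breakdown_eq)
  obtain b where b: "x ^ m - b * v \<in> ideal.span S" using assms(2) by (auto simp: ideal.span_breakdown_eq)
  have "x ^ (n + m) - (a * b) * (u * v) = x ^ m * (x ^ n - a * u) + (a * u) * (x ^ m - b * v)"
    by (simp add: power_add algebra_simps)
  also have "\<dots> \<in> ideal.span S" by (intro ideal.span_add ideal.span_scale a b)
  finally show ?thesis by (auto simp: ideal.span_breakdown_eq)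
qed

lemma radical_insert_prod:
  assumes "finite B" "\<And>b. b \<in> B \<Longrightarrow> \<exists>n. x ^ n \<in> ideal.span (insert (f b) S)"
  shows "\<exists>n. x ^ n \<in> ideal.span (insert (\<Prod>b\<in>B. f b) S)"
  using assms
proof (induction B rule: finite_induct)
  case empty
  have "x ^ 0 \<in> ideal.span (insert 1 S)" by (rule ideal.span_base) simp
  thus ?case by (metis prod.empty)
next
  case (insert b B)
  then obtain n m where "x ^ n \<in> ideal.span (insert (f b) S)" "x ^ m \<in> ideal.span (insert (\<Prod>b\<in>B. f b) S)"
    by blast
  from radical_insert_mult[OF this] show ?case using insert.hyps by auto
qed

text \<open>A case distinction for radicals: if a product vanishes modulo \<open>S\<close>, each
  factor may be assumed to vanish in turn. It replaces an argument with points and the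
  Nullstellensatz.\<close>

lemma radical_prod:
  assumes "finite B" "(\<Prod>b\<in>B. f b) \<in> ideal.span S" "\<And>b. b \<in> B \<Longrightarrow> \<exists>n. x ^ n \<in> ideal.span (insert (f b) S)"
  shows "\<exists>n. x ^ n \<in> ideal.span S"
proof -
  obtain n where "x ^ n \<in> ideal.span (insert (\<Prod>b\<in>B. f b) S)"
    using radical_insert_prod[of B x f S] assms(1,3) by blast
  then obtain k where "x ^ n - k * (\<Prod>b\<in>B. f b) \<in> ideal.span S" by (auto simp: ideal.span_breakdown_eq)
  from ideal.span_add[OF this ideal.span_scale[OF assms(2), of k]] show ?thesis by auto
qed

text \<open>The singular locus of the arrangement does not meet a generic line: modulo the ideal
  \<open>(J_g, \<ell>)\<close> some \<open>a\<close> vanishes, hence (by the product rule) so does \<open>\<Prod>b\<noteq>a. b\<close>, hence some \<open>b \<noteq> a\<close>,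
  and \<open>\<ell>, a, b\<close> span all linear forms.\<close>

lemma variables_in_radical:
  fixes A :: "(complex ^ 3) set"
  assumes A: "finite A" "0 \<notin> A" "A \<noteq> {}" and g: "g = (\<Prod>a\<in>A. linear_form a)"
    and l: "\<And>a b. a \<in> A \<Longrightarrow> b \<in> A \<Longrightarrow> a \<noteq> b \<Longrightarrow> cdet3 l a b \<noteq> 0"
  shows "\<exists>n. var j ^ n \<in> ideal.span (insert (linear_form l) {partial_deriv i g |i. i \<in> UNIV})"
proof (rule radical_prod[OF A(1)])
  define S where "S = insert (linear_form l) {partial_deriv i g |i. i \<in> UNIV}"
  have hom: "homogeneous (card A) g"
    unfolding g by (rule homogeneous_prod_linear_forms)
  have "g \<in> jacobian_ideal g" using jacobian_ideal_contains[OF hom] A by (simp add: card_gt_0_iff)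
  hence "g \<in> ideal.span S"
    unfolding jacobian_ideal_def S_def by (rule ideal.span_mono[THEN subsetD, rotated]) blast
  thus "(\<Prod>a\<in>A. linear_form a) \<in> ideal.span (insert (linear_form l) {partial_deriv i g |i. i \<in> UNIV})"
    unfolding g S_def .
  fix a assume a: "a \<in> A"
  have "\<exists>n. var j ^ n \<in> ideal.span (insert (linear_form a) S)"
  proof (rule radical_prod)
    show "finite (A - {a})" using A(1) by simp
    let ?G = "\<Prod>b\<in>A - {a}. linear_form b"
    \<comment> \<open>The derivative of \<open>linear_form a\<close> in direction \<open>i\<close>
      is the constant \<open>a$i\<close>. With \<open>a$i\<close> nonzero, the product rule modulo
      \<open>linear_form a\<close> recovers the product of the other forms.\<close>
    have "a \<noteq> 0" using a A(2) by auto
    then obtain i where i: "a$i \<noteq> 0" by (auto simp: vec_eq_iff)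
    have "g = linear_form a * ?G" unfolding g using A(1) a by (rule prod.remove)
    hence "partial_deriv i g = const_poly (a$i) * ?G + linear_form a * partial_deriv i ?G"
      by (simp add: partial_deriv_mult partial_deriv_linear_form)
    hence "const_poly (a$i) * ?G = partial_deriv i g - partial_deriv i ?G * linear_form a"
      by (simp add: mult.commute)
    also have "\<dots> \<in> ideal.span (insert (linear_form a) S)"
      by (intro ideal.span_diff ideal.span_scale ideal.span_base) (auto simp: S_def)
    finally have "const_poly (1 / a$i) * (const_poly (a$i) * ?G) \<in> ideal.span (insert (linear_form a) S)"
      by (rule ideal.span_scale)
    thus "?G \<in> ideal.span (insert (linear_form a) S)" using i by simp
    fix b assume b: "b \<in> A - {a}"
    let ?D = "cdet3 l a b" and ?x = "axis j 1 :: complex ^ 3"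
    have D: "?D \<noteq> 0" using l a b by auto
    have "linear_form (?D *s ?x) = linear_form (cdet3 ?x a b *s l + cdet3 l ?x b *s a + cdet3 l a ?x *s b)"
      by (rule arg_cong[OF Cramer3])
    hence "const_poly ?D * var j = const_poly (cdet3 ?x a b) * linear_form l
        + const_poly (cdet3 l ?x b) * linear_form a + const_poly (cdet3 l a ?x) * linear_form b"
      by (simp add: linear_form_add linear_form_scale linear_form_axis)
    also have "\<dots> \<in> ideal.span (insert (linear_form b) (insert (linear_form a) S))"
      by (intro ideal.span_add ideal.span_scale ideal.span_base) (auto simp: S_def)
    finally have "const_poly (1 / ?D) * (const_poly ?D * var j) \<in> ideal.span (insert (linear_form b) (insert (linear_form a) S))"
      by (rule ideal.span_scale)
    hence "var j ^ 1 \<in> ideal.span (insert (linear_form b) (insert (linear_form a) S))" using D by simp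
    thus "\<exists>n. var j ^ n \<in> ideal.span (insert (linear_form b) (insert (linear_form a) S))" by blast
  qed
  thus "\<exists>n. var j ^ n \<in> ideal.span (insert (linear_form a) (insert (linear_form l) {partial_deriv i g |i. i \<in> UNIV}))"
    by (simp add: S_def)
qed

text \<open>Pigeonhole: a monomial of degree above the sum of the exponents \<open>n j\<close> is
  divisible by some \<open>var j ^ n j\<close>.\<close>

lemma homogeneous_in_ideal_of_radical:
  fixes S :: "'n::finite cpoly set"
  assumes "\<And>j. \<exists>n. var j ^ n \<in> ideal.span S"
  obtains K where "\<And>k p. k \<ge> K \<Longrightarrow> homogeneous k p \<Longrightarrow> p \<in> ideal.span S"
proof -
  obtain n where n: "\<And>j. var j ^ n j \<in> ideal.span S" using assms by metis
  define K where "K = (\<Sum>j\<in>UNIV. n j)"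
  have mon: "Poly_Mapping.single m 1 \<in> ideal.span S" if "mdeg m \<ge> Suc K" for m
  proof -
    have "\<exists>j. Poly_Mapping.lookup m j \<ge> n j"
    proof (rule ccontr)
      assume "\<not> ?thesis"
      hence "mdeg m \<le> K" unfolding mdeg_def K_def by (intro sum_mono) (simp add: not_le less_imp_le)
      thus False using that by simp
    qed
    then obtain j where j: "n j \<le> Poly_Mapping.lookup m j" by blast
    have "m = (m - Poly_Mapping.single j (n j)) + Poly_Mapping.single j (n j)"
      using j by (intro poly_mapping_eqI) (auto simp: lookup_add lookup_minus lookup_single when_def)
    hence "Poly_Mapping.single m 1 = Poly_Mapping.single (m - Poly_Mapping.single j (n j)) 1 * var j ^ n j"
      by (simp add: var_power mult_single)
    thus ?thesis using n[of j] by (simp add: ideal.span_scale)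
  qed
  have "p \<in> ideal.span S" if "k \<ge> Suc K" "homogeneous k p" for k p
    by (subst homogeneous_expand[OF that(2)])
      (intro ideal.span_sum ideal.span_scale mon, use that(1) in \<open>simp add: monomials_def\<close>)
  thus ?thesis using that by blast
qed

text \<open>Multiplication by a generic linear form is surjective on the Milnor algebra in high degrees.\<close>

lemma milnor_dim_Suc_le:
  fixes A :: "(complex ^ 3) set"
  assumes A: "finite A" "0 \<notin> A" "A \<noteq> {}" "\<forall>a\<in>A. \<forall>b\<in>A. a \<noteq> b \<longrightarrow> (\<forall>c. a \<noteq> c *s b)"
    and g: "g = (\<Prod>a\<in>A. linear_form a)"
  obtains K where "\<And>k. k \<ge> K \<Longrightarrow> milnor_dim g (Suc k) \<le> milnor_dim g k"
proof -
  obtain l where l: "l \<noteq> 0" "\<And>a b. a \<in> A \<Longrightarrow> b \<in> A \<Longrightarrow> a \<noteq> b \<Longrightarrow> cdet3 l a b \<noteq> 0"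
    using generic_line[OF A(1,2,4)] by blast
  obtain K where K: "\<And>k p. k \<ge> K \<Longrightarrow> homogeneous k p \<Longrightarrow>
      p \<in> ideal.span (insert (linear_form l) {partial_deriv i g |i. i \<in> UNIV})"
    using homogeneous_in_ideal_of_radical[OF variables_in_radical[OF A(1-3) g l(2)]] by blast
  have hom: "homogeneous (card A) g"
    unfolding g by (rule homogeneous_prod_linear_forms)
  have hc: "hcomp k p \<in> jacobian_ideal g" if "p \<in> jacobian_ideal g" for k p
    using that homogeneous_partial_deriv[OF hom] unfolding jacobian_ideal_def by (intro hcomp_in_span) auto
  have "milnor_dim g (Suc k) \<le> milnor_dim g k" if "k \<ge> K" for k
  proof -
    obtain B where B: "residue_basis (jacobian_ideal g) k B"
      using residue_basis_exists[OF subspace_jacobian_ideal] by blast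
    hence fin: "finite B" by (simp add: residue_basis_def)
    let ?f = "\<lambda>b. b * linear_form l"
    have inj: "inj_on ?f B" using l(1) by (simp add: inj_on_def)
    \<comment> \<open>Modulo the Jacobian ideal \<open>p\<close> is a multiple of
      \<open>linear_form l\<close>. Comparing components of degree \<open>Suc k\<close> makes the
      cofactor homogeneous of degree \<open>k\<close>, where it expands in \<open>B\<close>.\<close>
    have "\<exists>c. p - (\<Sum>b\<in>?f ` B. const_poly (c b) * b) \<in> jacobian_ideal g" if p: "homogeneous (Suc k) p" for p
    proof -
      have "p \<in> ideal.span (insert (linear_form l) {partial_deriv i g |i. i \<in> UNIV})"
        using K p \<open>k \<ge> K\<close> by (meson le_SucI)
      then obtain c where "p - c * linear_form l \<in> jacobian_ideal g"
        by (auto simp: ideal.span_breakdown_eq jacobian_ideal_def)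
      hence "hcomp (Suc k) (p - c * linear_form l) \<in> jacobian_ideal g" by (rule hc)
      moreover have "hcomp (Suc k) (p - c * linear_form l) + hcomp (Suc k) (c * linear_form l) = p"
        using p by (simp add: hcomp_homogeneous flip: hcomp_add)
      moreover have "hcomp (Suc k) (c * linear_form l) = hcomp k c * linear_form l"
        by (simp add: hcomp_mult[OF homogeneous_linear_form])
      ultimately have 1: "p - hcomp k c * linear_form l \<in> jacobian_ideal g"
        by (metis add_diff_cancel_right')
      obtain u where "hcomp k c - (\<Sum>b\<in>B. const_poly (u b) * b) \<in> jacobian_ideal g"
        using B homogeneous_hcomp[of k c] unfolding residue_basis_def by blast
      hence "linear_form l * (hcomp k c - (\<Sum>b\<in>B. const_poly (u b) * b)) \<in> jacobian_ideal g"
        unfolding jacobian_ideal_def by (rule ideal.span_scale)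
      with 1 have "p - hcomp k c * linear_form l + linear_form l * (hcomp k c - (\<Sum>b\<in>B. const_poly (u b) * b)) \<in> jacobian_ideal g"
        unfolding jacobian_ideal_def by (rule ideal.span_add)
      also have "p - hcomp k c * linear_form l + linear_form l * (hcomp k c - (\<Sum>b\<in>B. const_poly (u b) * b))
          = p - linear_form l * (\<Sum>b\<in>B. const_poly (u b) * b)" by (simp add: algebra_simps)
      also have "linear_form l * (\<Sum>b\<in>B. const_poly (u b) * b) = (\<Sum>b\<in>?f ` B. const_poly (u (inv_into B ?f b)) * b)"
      proof -
        have "(\<Sum>b\<in>?f ` B. const_poly (u (inv_into B ?f b)) * b) = (\<Sum>b\<in>B. const_poly (u (inv_into B ?f (?f b))) * ?f b)"
          by (rule sum.reindex[OF inj, unfolded o_def])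
        also have "\<dots> = (\<Sum>b\<in>B. const_poly (u b) * ?f b)"
          by (intro sum.cong refl) (simp add: inv_into_f_f[OF inj])
        also have "\<dots> = linear_form l * (\<Sum>b\<in>B. const_poly (u b) * b)"
          by (simp add: sum_distrib_left mult_ac)
        finally show ?thesis by simp
      qed
      finally show ?thesis by (rule exI[of _ "\<lambda>b. u (inv_into B ?f b)"])
    qed
    hence "card (monomials (Suc k) :: (3 \<Rightarrow>\<^sub>0 nat) set) \<le> card (?f ` B) + cp.dim (jacobian_ideal g \<inter> graded_part (Suc k))"
      using fin by (intro residue_spanning_card[OF subspace_jacobian_ideal]) auto
    moreover have "card (?f ` B) = milnor_dim g k"
      using card_image[OF inj] residue_basis_milnor_dim[OF B] by simp
    ultimately show ?thesis using milnor_dim_eq[of g "Suc k"] by simp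
  qed
  thus ?thesis using that by blast
qed

lemma eventually_const_of_decreasing:
  fixes h :: "nat \<Rightarrow> nat"
  assumes "\<And>k. k \<ge> K \<Longrightarrow> h (Suc k) \<le> h k"
  obtains K' c where "\<And>k. k \<ge> K' \<Longrightarrow> h k = c"
proof -
  obtain n where n: "n \<ge> K" "\<And>m. m \<ge> K \<Longrightarrow> h n \<le> h m"
    using ex_has_least_nat[of "\<lambda>n. n \<ge> K" K h] by auto
  have "h k = h n" if "k \<ge> n" for k
    using that
  proof (induction rule: dec_induct)
    case (step k)
    thus ?case using assms[of k] n(2)[of "Suc k"] n(1) by simp
  qed simp
  thus ?thesis using that by blast
qed

subsection \<open>The Hilbert polynomial of the cone\<close>

text \<open>Twice the binomial coefficient of \<open>k + 2\<close> over 2, free of division; the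
  exponents of two variables determine the third.\<close>

lemma card_monomials_3: "2 * card (monomials k :: (3 \<Rightarrow>\<^sub>0 nat) set) = (k + 1) * (k + 2)"
proof -
  let ?X = "Sigma {..k} (\<lambda>a. {..k - a})"
  let ?u = "\<lambda>(a, b). Poly_Mapping.single (1::3) a + Poly_Mapping.single 2 b + Poly_Mapping.single 3 (k - a - b)"
  have mdeg3: "mdeg m = Poly_Mapping.lookup m 1 + Poly_Mapping.lookup m 2 + Poly_Mapping.lookup m 3" for m :: "3 \<Rightarrow>\<^sub>0 nat"
    by (simp add: mdeg_def sum_3)
  have "bij_betw ?u ?X (monomials k)"
  proof (rule bij_betw_byWitness[where f' = "\<lambda>m. (Poly_Mapping.lookup m 1, Poly_Mapping.lookup m 2)"])
    show "\<forall>x\<in>?X. (Poly_Mapping.lookup (?u x) 1, Poly_Mapping.lookup (?u x) 2) = x"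
      by (auto simp: lookup_add lookup_single when_def)
    show "\<forall>m\<in>monomials k. ?u (Poly_Mapping.lookup m 1, Poly_Mapping.lookup m 2) = m"
    proof
      fix m :: "3 \<Rightarrow>\<^sub>0 nat" assume m: "m \<in> monomials k"
      show "?u (Poly_Mapping.lookup m 1, Poly_Mapping.lookup m 2) = m"
      proof (rule poly_mapping_eqI)
        fix i :: 3
        show "Poly_Mapping.lookup (?u (Poly_Mapping.lookup m 1, Poly_Mapping.lookup m 2)) i = Poly_Mapping.lookup m i"
          using m exhaust_3[of i] by (auto simp: monomials_def mdeg3 lookup_add lookup_single when_def)
      qed
    qed
    show "?u ` ?X \<subseteq> monomials k" by (auto simp: monomials_def mdeg_add)
    show "(\<lambda>m. (Poly_Mapping.lookup m 1, Poly_Mapping.lookup m (2::3))) ` monomials k \<subseteq> ?X"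
      by (auto simp: monomials_def mdeg3)
  qed
  from bij_betw_same_card[OF this] have "card (monomials k :: (3 \<Rightarrow>\<^sub>0 nat) set) = card ?X" by simp
  also have "\<dots> = (\<Sum>a\<le>k. Suc (k - a))" by (simp add: card_SigmaI)
  also have "\<dots> = (\<Sum>a\<le>k. Suc a)" by (rule sum.nat_diff_reindex[of Suc "Suc k", unfolded lessThan_Suc_atMost, simplified])
  also have "2 * \<dots> = (k + 1) * (k + 2)" by (induction k) auto
  finally show ?thesis .
qed

lemma cone_hilbert_polynomial_exists:
  fixes A :: "(complex ^ 3) set"
  assumes A: "finite A" "0 \<notin> A" "A \<noteq> {}" "\<forall>a\<in>A. \<forall>b\<in>A. a \<noteq> b \<longrightarrow> (\<forall>c. a \<noteq> c *s b)"
    and g: "g = (\<Prod>a\<in>A. linear_form a)"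
  shows "\<exists>P :: rat poly. \<forall>\<^sub>F k in sequentially. poly P (of_nat k) = of_nat (milnor_dim (cone_poly g) k)"
proof -
  let ?d = "card A"
  have hom: "homogeneous ?d g" unfolding g by (rule homogeneous_prod_linear_forms)
  have g0: "g \<noteq> 0" using A(1,2) by (auto simp: g)
  have d: "?d > 0" using A(1,3) by (simp add: card_gt_0_iff)
  obtain K0 where K0: "\<And>k. k \<ge> K0 \<Longrightarrow> milnor_dim g (Suc k) \<le> milnor_dim g k"
    using milnor_dim_Suc_le[OF A g] by blast
  obtain K c where K: "\<And>k. k \<ge> K \<Longrightarrow> milnor_dim g k = c"
    using eventually_const_of_decreasing[of K0 "milnor_dim g", OF K0] by blast
  define s where "s = (\<Sum>i<K. milnor_dim g i)"
  have sum: "(\<Sum>i<k. milnor_dim g i) = s + (k - K) * c" if "k \<ge> K" for k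
    using that by (induction rule: dec_induct) (simp_all add: s_def K Suc_diff_le)
  \<comment> \<open>The first summand is the Hilbert polynomial of R/(g). The second is the sum of
    the Hilbert function of M(g), \<open>s\<close> up to \<open>K\<close> and then the constant
    value \<open>c\<close> in each further degree.\<close>
  define P :: "rat poly" where "P = smult (1/2) ([:1, 1:] * [:2, 1:] - [:1 - of_nat ?d, 1:] * [:2 - of_nat ?d, 1:])
      + [:of_nat s - of_nat K * of_nat c, of_nat c:]"
  have "poly P (of_nat k) = of_nat (milnor_dim (cone_poly g) k)" if k: "k \<ge> K + ?d" for k
  proof -
    have "milnor_dim (cone_poly g) k + card (monomials (k - ?d) :: (3 \<Rightarrow>\<^sub>0 nat) set)
        = card (monomials k :: (3 \<Rightarrow>\<^sub>0 nat) set) + (s + (k - K) * c)"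
      using milnor_dim_cone[OF hom g0 d, of k] sum[of k] k by simp
    hence "2 * milnor_dim (cone_poly g) k + (k - ?d + 1) * (k - ?d + 2) = (k + 1) * (k + 2) + 2 * (s + (k - K) * c)"
      by (metis add_mult_distrib2 card_monomials_3)
    hence "of_nat (2 * milnor_dim (cone_poly g) k + (k - ?d + 1) * (k - ?d + 2))
        = (of_nat ((k + 1) * (k + 2) + 2 * (s + (k - K) * c)) :: rat)" by (rule arg_cong)
    moreover have "of_nat (k - ?d) = (of_nat k - of_nat ?d :: rat)" "of_nat (k - K) = (of_nat k - of_nat K :: rat)"
      using k by (simp_all add: of_nat_diff)
    ultimately have "2 * of_nat (milnor_dim (cone_poly g) k) + (of_nat k - of_nat ?d + 1) * (of_nat k - of_nat ?d + 2)
       = ((of_nat k + 1) * (of_nat k + 2) + 2 * (of_nat s + (of_nat k - of_nat K) * of_nat c) :: rat)"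
      by (simp only: of_nat_add of_nat_mult of_nat_numeral of_nat_1)
    thus ?thesis unfolding P_def by (simp add: field_simps)
  qed
  thus ?thesis by (intro exI[of _ P]) (auto simp: eventually_sequentially)
qed

text \<open>The definite description is meaningful once existence is supplied: the difference of two
  candidates has infinitely many roots.\<close>

lemma milnor_hilbert_poly_eventually:
  assumes ex: "\<exists>P :: rat poly. \<forall>\<^sub>F k in sequentially. poly P (of_nat k) = of_nat (milnor_dim f k)"
  shows "\<forall>\<^sub>F k in sequentially. poly (milnor_hilbert_poly f) (of_nat k) = of_nat (milnor_dim f k)"
proof -
  have "P = Q" if "\<forall>\<^sub>F k in sequentially. poly P (of_nat k) = of_nat (milnor_dim f k)"
    "\<forall>\<^sub>F k in sequentially. poly Q (of_nat k) = of_nat (milnor_dim f k)" for P Q :: "rat poly"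
  proof -
    have "\<forall>\<^sub>F k in sequentially. poly P (of_nat k) = poly Q (of_nat k)"
      using that by eventually_elim simp
    then obtain K where K: "\<And>k. k \<ge> K \<Longrightarrow> poly P (of_nat k) = poly Q (of_nat k)"
      by (auto simp: eventually_sequentially)
    have "infinite (of_nat ` {K..} :: rat set)" by (simp add: finite_image_iff inj_on_def infinite_Ici)
    moreover have "of_nat ` {K..} \<subseteq> {x. poly (P - Q) x = 0}" using K by auto
    ultimately have "infinite {x. poly (P - Q) x = 0}" by (metis finite_subset)
    hence "P - Q = 0" using poly_roots_finite by blast
    thus ?thesis by simp
  qed
  hence "\<exists>!P :: rat poly. \<forall>\<^sub>F k in sequentially. poly P (of_nat k) = of_nat (milnor_dim f k)"
    using ex by blast
  from theI'[OF this] show ?thesis unfolding milnor_hilbert_poly_def .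
qed

section \<open>Intersection lattices\<close>

definition dot :: "complex ^ 'n::finite \<Rightarrow> complex ^ 'n \<Rightarrow> complex" where
  "dot a v = (\<Sum>i\<in>UNIV. a$i * v$i)"

lemma mem_hyperplane: "v \<in> hyperplane a \<longleftrightarrow> dot a v = 0"
  by (simp add: hyperplane_def dot_def)

lemma dot_add: "dot a (u + v) = dot a u + dot a v"
  by (simp add: dot_def distrib_left sum.distrib)

lemma dot_scale: "dot a (c *s v) = c * dot a v"
  by (simp add: dot_def sum_distrib_left mult.left_commute)

lemma dot_0 [simp]: "dot a 0 = 0"
  by (simp add: dot_def)

lemma dot_scale_left: "dot (c *s a) v = c * dot a v"
  by (simp add: dot_def sum_distrib_left mult.assoc)

lemma dot_axis: "dot a (axis i 1) = a$i"
proof -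
  have "dot a (axis i 1) = (\<Sum>j\<in>UNIV. if j = i then a$j else 0)"
    unfolding dot_def by (intro sum.cong refl) (auto simp: axis_def)
  thus ?thesis by simp
qed

lemma hyperplane_neq_UNIV: "a \<noteq> 0 \<Longrightarrow> hyperplane a \<noteq> UNIV"
  using mem_hyperplane[of _ a] dot_axis[of a] by (metis UNIV_I vec_eq_iff zero_index)

lemma hyperplane_subset_imp_proportional:
  assumes "hyperplane b \<subseteq> hyperplane a" "b \<noteq> 0"
  shows "\<exists>c. a = c *s b"
proof -
  obtain j where j: "b$j \<noteq> 0" using assms(2) by (auto simp: vec_eq_iff)
  have "a$i * b$j = a$j * b$i" for i
  proof -
    \<comment> \<open>A vector of the hyperplane of \<open>b\<close> supported on the coordinates
      \<open>i\<close> and \<open>j\<close>; pairing it with \<open>a\<close> gives a 2 by 2 minor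
      of the pair.\<close>
    let ?v = "b$j *s axis i 1 + (- b$i) *s axis j 1"
    have "dot b ?v = 0" by (simp only: dot_add dot_scale dot_axis) simp
    hence "dot a ?v = 0" using assms(1) by (auto simp: mem_hyperplane)
    thus ?thesis by (simp only: dot_add dot_scale dot_axis) (simp add: algebra_simps)
  qed
  hence "a = (a$j / b$j) *s b" using j by (simp add: vec_eq_iff field_simps)
  thus ?thesis by blast
qed

lemma hyperplane_subset_imp_eq:
  assumes "hyperplane b \<subseteq> hyperplane a" "a \<noteq> 0" "b \<noteq> 0"
  shows "hyperplane b = hyperplane a"
proof -
  obtain c where c: "a = c *s b" using hyperplane_subset_imp_proportional assms by blast
  hence "c \<noteq> 0" using assms(2) by auto
  thus ?thesis by (auto simp: mem_hyperplane c dot_scale_left)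
qed

text \<open>Over an infinite field a subspace is not a finite union of proper subspaces: a vector
  avoiding the earlier hyperplanes is moved by a multiple \<open>s\<close> of one avoiding the new
  hyperplane, and only finitely many \<open>s\<close> are bad.\<close>

lemma subspace_avoids_hyperplanes:
  assumes "finite A" and H: "\<And>u v s. u \<in> H \<Longrightarrow> v \<in> H \<Longrightarrow> u + s *s v \<in> H" "0 \<in> H"
    and "\<And>a. a \<in> A \<Longrightarrow> \<exists>v\<in>H. dot a v \<noteq> 0"
  shows "\<exists>v\<in>H. \<forall>a\<in>A. dot a v \<noteq> 0"
  using assms(1,4)
proof (induction A rule: finite_induct)
  case (insert a A)
  then obtain v u where v: "v \<in> H" "\<forall>a\<in>A. dot a v \<noteq> 0" and u: "u \<in> H" "dot a u \<noteq> 0" by blast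
  let ?bad = "(\<lambda>b. - dot b v / dot b u) ` insert a A"
  have "finite ?bad" using insert.hyps by simp
  then obtain s where s: "s \<notin> ?bad" using ex_new_if_finite[OF infinite_UNIV_char_0] by blast
  have "dot b (v + s *s u) \<noteq> 0" if b: "b \<in> insert a A" for b
  proof
    assume "dot b (v + s *s u) = 0"
    hence e: "dot b v + s * dot b u = 0" by (simp add: dot_add dot_scale)
    hence "dot b u \<noteq> 0" using b u(2) v(2) by auto
    hence "s = - dot b v / dot b u" using e by (simp add: field_simps add_eq_0_iff)
    thus False using s b by blast
  qed
  thus ?case using H(1)[OF v(1) u(1)] by blast
qed (use H in auto)

lemma substitute_linear_form: "substitute (\<lambda>i. const_poly (v$i)) (linear_form a) = const_poly (dot a v)"
  by (simp add: linear_form_def substitute_sum substitute_mult dot_def const_poly_sum const_poly_mult)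

text \<open>Divisibility by \<open>linear_form b\<close> makes the product vanish on the hyperplane
  of \<open>b\<close>. That hyperplane is not covered by finitely many proper subspaces, so a single
  factor vanishes on all of it and has the same hyperplane.\<close>

lemma arrangement_prod:
  assumes "finite A" "0 \<notin> A"
  shows "arrangement (\<Prod>a\<in>A. linear_form a) = hyperplane ` A"
proof
  show "hyperplane ` A \<subseteq> arrangement (\<Prod>a\<in>A. linear_form a)"
  proof clarify
    fix a assume a: "a \<in> A"
    hence "linear_form a dvd (\<Prod>a\<in>A. linear_form a)" using assms(1) by (simp add: dvd_prodI)
    thus "hyperplane a \<in> arrangement (\<Prod>a\<in>A. linear_form a)"
      using a assms(2) unfolding arrangement_def by blast
  qed
  show "arrangement (\<Prod>a\<in>A. linear_form a) \<subseteq> hyperplane ` A"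
  proof
    fix X assume "X \<in> arrangement (\<Prod>a\<in>A. linear_form a)"
    then obtain b h where b: "X = hyperplane b" "b \<noteq> 0" and h: "(\<Prod>a\<in>A. linear_form a) = linear_form b * h"
      unfolding arrangement_def dvd_def by blast
    have zero: "(\<Prod>a\<in>A. dot a v) = 0" if "v \<in> hyperplane b" for v
    proof -
      have "const_poly (\<Prod>a\<in>A. dot a v) = (0 :: 'a cpoly)"
        using arg_cong[OF h, of "substitute (\<lambda>i. const_poly (v$i))"] that
        by (simp add: substitute_prod substitute_mult substitute_linear_form const_poly_prod mem_hyperplane)
      thus ?thesis by simp
    qed
    have "\<not> (\<forall>a\<in>A. \<exists>v\<in>hyperplane b. dot a v \<noteq> 0)"
    proof
      assume "\<forall>a\<in>A. \<exists>v\<in>hyperplane b. dot a v \<noteq> 0"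
      hence "\<exists>v\<in>hyperplane b. \<forall>a\<in>A. dot a v \<noteq> 0"
        by (intro subspace_avoids_hyperplanes assms(1)) (auto simp: mem_hyperplane dot_add dot_scale)
      thus False using zero assms(1) by auto
    qed
    then obtain a where "a \<in> A" "hyperplane b \<subseteq> hyperplane a" by (auto simp: mem_hyperplane subset_iff)
    thus "X \<in> hyperplane ` A" using hyperplane_subset_imp_eq b assms(2) by blast
  qed
qed

lemma defines_arrangement_degree:
  assumes "defines_arrangement f"
  obtains A where "finite A" "0 \<notin> A" "\<forall>a\<in>A. \<forall>b\<in>A. a \<noteq> b \<longrightarrow> (\<forall>c. a \<noteq> c *s b)"
    "f = (\<Prod>a\<in>A. linear_form a)" "card A = card (arrangement f)" "arrangement f = hyperplane ` A"
proof -
  obtain A where A: "finite A" "0 \<notin> A" "\<forall>a\<in>A. \<forall>b\<in>A. a \<noteq> b \<longrightarrow> (\<forall>c. a \<noteq> c *s b)"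
    "f = (\<Prod>a\<in>A. linear_form a)"
    using assms unfolding defines_arrangement_def by blast
  have "inj_on hyperplane A"
  proof (rule inj_onI, rule ccontr)
    fix a b assume ab: "a \<in> A" "b \<in> A" "hyperplane a = hyperplane b" "a \<noteq> b"
    hence "\<exists>c. a = c *s b" using A(2) by (intro hyperplane_subset_imp_proportional) auto
    thus False using A(3) ab by blast
  qed
  hence "card A = card (arrangement f)" using arrangement_prod[OF A(1,2)] A(4) by (simp add: card_image)
  thus ?thesis using that A arrangement_prod[OF A(1,2)] by blast
qed

lemma UNIV_in_intersection_lattice: "UNIV \<in> intersection_lattice f"
  unfolding intersection_lattice_def by (auto intro!: exI[of _ "{}"])

lemma arrangement_subset_lattice: "H \<in> arrangement f \<Longrightarrow> H \<in> intersection_lattice f"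
  unfolding intersection_lattice_def by (auto intro!: exI[of _ "{H}"])

text \<open>Recognises the hyperplanes from inclusion alone, as the maximal proper members (the
  atoms for reverse inclusion), so that lattice isomorphisms preserve them.\<close>

lemma arrangement_coatoms:
  "arrangement f = {H\<in>intersection_lattice f. H \<noteq> UNIV \<and>
     (\<forall>X\<in>intersection_lattice f. H \<subseteq> X \<longrightarrow> X = H \<or> X = UNIV)}"
proof (rule set_eqI, rule iffI)
  fix H assume H: "H \<in> arrangement f"
  then obtain a where a: "H = hyperplane a" "a \<noteq> 0" unfolding arrangement_def by blast
  have "X = H \<or> X = UNIV" if X: "X \<in> intersection_lattice f" "H \<subseteq> X" for X
  proof -
    obtain \<H> where h: "X = \<Inter>\<H>" "\<H> \<subseteq> arrangement f" using X(1) unfolding intersection_lattice_def by blast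
    show ?thesis
    proof (cases "\<H> = {}")
      case False
      then obtain H' where H': "H' \<in> \<H>" by blast
      then obtain b where b: "H' = hyperplane b" "b \<noteq> 0" using h(2) unfolding arrangement_def by blast
      have "H \<subseteq> H'" using X(2) h(1) H' by blast
      hence "H = H'" using hyperplane_subset_imp_eq a b by blast
      thus ?thesis using X(2) h(1) H' by blast
    qed (simp add: h)
  qed
  thus "H \<in> {H\<in>intersection_lattice f. H \<noteq> UNIV \<and> (\<forall>X\<in>intersection_lattice f. H \<subseteq> X \<longrightarrow> X = H \<or> X = UNIV)}"
    using H arrangement_subset_lattice hyperplane_neq_UNIV[OF a(2)] a(1) by blast
next
  fix H assume "H \<in> {H\<in>intersection_lattice f. H \<noteq> UNIV \<and> (\<forall>X\<in>intersection_lattice f. H \<subseteq> X \<longrightarrow> X = H \<or> X = UNIV)}"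
  hence H: "H \<in> intersection_lattice f" "H \<noteq> UNIV" "\<And>X. X \<in> intersection_lattice f \<Longrightarrow> H \<subseteq> X \<Longrightarrow> X = H \<or> X = UNIV"
    by blast+
  obtain \<H> where h: "H = \<Inter>\<H>" "\<H> \<subseteq> arrangement f" using H(1) unfolding intersection_lattice_def by blast
  have "\<H> \<noteq> {}" using H(2) h(1) by auto
  then obtain H' where H': "H' \<in> \<H>" by blast
  then obtain b where b: "H' = hyperplane b" "b \<noteq> 0" using h(2) unfolding arrangement_def by blast
  have "H' \<in> arrangement f" using H' h(2) by blast
  moreover have "H \<subseteq> H'" using H' h(1) by blast
  ultimately have "H' = H \<or> H' = UNIV" using H(3) arrangement_subset_lattice by blast
  hence "H' = H" using hyperplane_neq_UNIV[OF b(2)] b(1) by blast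
  thus "H \<in> arrangement f" using \<open>H' \<in> arrangement f\<close> by simp
qed

text \<open>An order isomorphism fixes the largest member \<open>UNIV\<close> and so carries coatoms
  to coatoms. The number of hyperplanes is the degree of the defining polynomial.\<close>

lemma card_arrangement_eq:
  assumes "isomorphic_lattices f f'"
  shows "card (arrangement f) = card (arrangement f')"
proof -
  let ?L = "intersection_lattice f" and ?L' = "intersection_lattice f'"
  obtain \<phi> where bij: "bij_betw \<phi> ?L ?L'"
    and *: "\<forall>X\<in>?L. \<forall>Y\<in>?L. Y \<subseteq> X \<longleftrightarrow> \<phi> Y \<subseteq> \<phi> X"
    using assms unfolding isomorphic_lattices_def by (elim exE conjE)
  have ord: "Y \<subseteq> X \<longleftrightarrow> \<phi> Y \<subseteq> \<phi> X" if "X \<in> ?L" "Y \<in> ?L" for X Y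
    using * that by simp
  have im: "\<phi> ` ?L = ?L'" and inj: "inj_on \<phi> ?L" using bij by (auto simp: bij_betw_def)
  have top: "\<phi> UNIV = UNIV"
  proof -
    have "UNIV \<in> \<phi> ` ?L" unfolding im by (rule UNIV_in_intersection_lattice)
    then obtain X where X: "UNIV = \<phi> X" "X \<in> ?L" by (rule imageE)
    have "\<phi> X \<subseteq> \<phi> UNIV" using ord[OF UNIV_in_intersection_lattice X(2)] by simp
    thus ?thesis unfolding X(1)[symmetric] by (rule top.extremum_uniqueI)
  qed
  have eqv: "\<phi> X = \<phi> Y \<longleftrightarrow> X = Y" if "X \<in> ?L" "Y \<in> ?L" for X Y
    using inj that by (auto simp: inj_on_def)
  have coatom: "\<phi> H \<in> arrangement f' \<longleftrightarrow> H \<in> arrangement f" if H: "H \<in> ?L" for H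
  proof -
    have "(\<forall>X\<in>?L'. \<phi> H \<subseteq> X \<longrightarrow> X = \<phi> H \<or> X = UNIV) \<longleftrightarrow> (\<forall>X\<in>?L. \<phi> H \<subseteq> \<phi> X \<longrightarrow> \<phi> X = \<phi> H \<or> \<phi> X = \<phi> UNIV)"
      unfolding im[symmetric] top by blast
    also have "\<dots> \<longleftrightarrow> (\<forall>X\<in>?L. H \<subseteq> X \<longrightarrow> X = H \<or> X = UNIV)"
      using ord[OF _ H] eqv H UNIV_in_intersection_lattice[of f] by (intro ball_cong refl) simp
    finally show ?thesis
      unfolding arrangement_coatoms[of f] arrangement_coatoms[of f']
      using H im eqv[OF H UNIV_in_intersection_lattice] top by auto
  qed
  have sub: "arrangement f \<subseteq> ?L" "arrangement f' \<subseteq> ?L'" using arrangement_subset_lattice by blast+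
  have "\<phi> ` arrangement f = arrangement f'"
  proof
    show "\<phi> ` arrangement f \<subseteq> arrangement f'" using coatom sub by blast
    show "arrangement f' \<subseteq> \<phi> ` arrangement f"
    proof
      fix X assume X: "X \<in> arrangement f'"
      then obtain H where "H \<in> ?L" "X = \<phi> H" using sub im by blast
      thus "X \<in> \<phi> ` arrangement f" using X coatom by blast
    qed
  qed
  moreover have "inj_on \<phi> (arrangement f)" using inj sub by (meson inj_on_subset)
  ultimately show ?thesis by (metis card_image)
qed

subsection \<open>The lattice of a cone\<close>

definition vec_extend :: "complex ^ 'n::finite \<Rightarrow> complex ^ 'n option" where
  "vec_extend a = (\<chi> x. case x of None \<Rightarrow> 0 | Some i \<Rightarrow> a$i)"

definition vec_restrict :: "complex ^ ('n::finite option) \<Rightarrow> complex ^ 'n" where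
  "vec_restrict v = (\<chi> i. v$(Some i))"

definition cylinder :: "(complex ^ 'n::finite) set \<Rightarrow> (complex ^ 'n option) set" where
  "cylinder X = {v. vec_restrict v \<in> X}"

definition base_hyperplane :: "(complex ^ 'n::finite option) set" where
  "base_hyperplane = {v. v$None = 0}"

lemma vec_extend_restrict [simp]: "vec_restrict (vec_extend a) = a"
  by (simp add: vec_restrict_def vec_extend_def vec_eq_iff)

lemma dot_extend: "dot (vec_extend a) v = dot a (vec_restrict v)"
  by (simp add: dot_def vec_extend_def vec_restrict_def UNIV_option_conv sum.reindex)

lemma hyperplane_extend: "hyperplane (vec_extend a) = cylinder (hyperplane a)"
  by (auto simp: mem_hyperplane cylinder_def dot_extend)

lemma hyperplane_axis_None: "hyperplane (axis None 1) = base_hyperplane"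
proof -
  have "dot (axis None 1) v = v$None" for v :: "complex ^ 'a option"
    using dot_axis[of v None] by (simp add: dot_def mult.commute)
  thus ?thesis by (auto simp: mem_hyperplane base_hyperplane_def)
qed

lemma lift_linear_form: "lift_poly (linear_form a) = linear_form (vec_extend a)"
  by (simp add: linear_form_def substitute_sum substitute_mult vec_extend_def UNIV_option_conv sum.reindex)

lemma arrangement_cone:
  assumes "defines_arrangement g"
  shows "arrangement (cone_poly g) = insert base_hyperplane (cylinder ` arrangement g)"
proof -
  obtain A where A: "finite A" "0 \<notin> A" "g = (\<Prod>a\<in>A. linear_form a)" "arrangement g = hyperplane ` A"
    using defines_arrangement_degree[OF assms] by metis
  have inj: "inj_on vec_extend A" by (metis inj_onI vec_extend_restrict)
  have None: "axis None 1 \<notin> vec_extend ` A"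
  proof
    assume "axis None 1 \<in> vec_extend ` A"
    then obtain a :: "complex ^ 'a" where "axis None 1 = vec_extend a" by blast
    from arg_cong[OF this, of "\<lambda>v. v $ None"] show False by (simp add: vec_extend_def)
  qed
  have zero: "0 \<notin> insert (axis None 1) (vec_extend ` A)"
  proof
    assume *: "0 \<in> insert (axis None 1) (vec_extend ` A)"
    have "axis None 1 \<noteq> (0 :: complex ^ 'a option)" by (simp add: axis_eq_0_iff)
    then obtain a where "a \<in> A" "vec_extend a = 0" using * by auto
    hence "a = 0" using vec_extend_restrict[of a] by (simp add: vec_restrict_def vec_eq_iff)
    thus False using \<open>a \<in> A\<close> A(2) by simp
  qed
  have "cone_poly g = (\<Prod>a\<in>insert (axis None 1) (vec_extend ` A). linear_form a)"
    using A(1) None inj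
    by (simp add: cone_poly_def A(3) substitute_prod lift_linear_form linear_form_axis prod.reindex)
  hence "arrangement (cone_poly g) = hyperplane ` insert (axis None 1) (vec_extend ` A)"
    using arrangement_prod[OF _ zero] A(1) by simp
  thus ?thesis by (simp add: A(4) image_image hyperplane_extend hyperplane_axis_None)
qed

lemma cylinder_Inter: "cylinder (\<Inter>\<H>) = \<Inter>(cylinder ` \<H>)"
  by (auto simp: cylinder_def)

lemma intersection_lattice_cone:
  assumes "defines_arrangement g"
  shows "intersection_lattice (cone_poly g) =
    cylinder ` intersection_lattice g \<union> (\<lambda>X. cylinder X \<inter> base_hyperplane) ` intersection_lattice g"
proof
  show "intersection_lattice (cone_poly g) \<subseteq>
    cylinder ` intersection_lattice g \<union> (\<lambda>X. cylinder X \<inter> base_hyperplane) ` intersection_lattice g"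
  proof
    fix Z assume "Z \<in> intersection_lattice (cone_poly g)"
    then obtain \<H> where Z: "Z = \<Inter>\<H>" "\<H> \<subseteq> insert base_hyperplane (cylinder ` arrangement g)"
      unfolding intersection_lattice_def arrangement_cone[OF assms] by blast
    define \<K> where "\<K> = {H\<in>arrangement g. cylinder H \<in> \<H>}"
    have K: "\<Inter>\<K> \<in> intersection_lattice g" unfolding intersection_lattice_def \<K>_def by blast
    have "\<H> = cylinder ` \<K> \<or> \<H> = insert base_hyperplane (cylinder ` \<K>)"
      using Z(2) unfolding \<K>_def by blast
    hence "Z = cylinder (\<Inter>\<K>) \<or> Z = cylinder (\<Inter>\<K>) \<inter> base_hyperplane"
      unfolding Z(1) cylinder_Inter by auto
    thus "Z \<in> cylinder ` intersection_lattice g \<union> (\<lambda>X. cylinder X \<inter> base_hyperplane) ` intersection_lattice g"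
      using K by blast
  qed
  show "cylinder ` intersection_lattice g \<union> (\<lambda>X. cylinder X \<inter> base_hyperplane) ` intersection_lattice g
    \<subseteq> intersection_lattice (cone_poly g)"
  proof
    fix Z assume "Z \<in> cylinder ` intersection_lattice g \<union> (\<lambda>X. cylinder X \<inter> base_hyperplane) ` intersection_lattice g"
    then obtain \<H> where h: "\<H> \<subseteq> arrangement g" "Z = cylinder (\<Inter>\<H>) \<or> Z = cylinder (\<Inter>\<H>) \<inter> base_hyperplane"
      unfolding intersection_lattice_def by blast
    have "Z = \<Inter>(cylinder ` \<H>) \<or> Z = \<Inter>(insert base_hyperplane (cylinder ` \<H>))"
      using h(2) unfolding cylinder_Inter by auto
    moreover have "cylinder ` \<H> \<subseteq> arrangement (cone_poly g)"
      "insert base_hyperplane (cylinder ` \<H>) \<subseteq> arrangement (cone_poly g)"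
      using h(1) unfolding arrangement_cone[OF assms] by blast+
    ultimately show "Z \<in> intersection_lattice (cone_poly g)"
      unfolding intersection_lattice_def by blast
  qed
qed

lemma zero_in_lattice: "X \<in> intersection_lattice f \<Longrightarrow> 0 \<in> X"
  by (auto simp: intersection_lattice_def arrangement_def mem_hyperplane)

lemma cylinder_subset_iff [simp]: "cylinder X \<subseteq> cylinder Y \<longleftrightarrow> X \<subseteq> Y"
  by (auto simp: cylinder_def) (metis vec_extend_restrict subsetD mem_Collect_eq)

lemma cylinder_Int_subset_iff [simp]: "cylinder X \<inter> base_hyperplane \<subseteq> cylinder Y \<longleftrightarrow> X \<subseteq> Y"
proof
  assume *: "cylinder X \<inter> base_hyperplane \<subseteq> cylinder Y"
  show "X \<subseteq> Y"
  proof
    fix x assume "x \<in> X"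
    hence "vec_extend x \<in> cylinder X \<inter> base_hyperplane"
      by (simp add: cylinder_def base_hyperplane_def) (simp add: vec_extend_def)
    hence "vec_extend x \<in> cylinder Y" using * by blast
    thus "x \<in> Y" by (simp add: cylinder_def)
  qed
qed (auto simp: cylinder_def)

text \<open>The unit vector of the new coordinate lies in every cylinder over a set containing 0.
  Hence the two kinds of members of the cone's lattice never coincide.\<close>

lemma not_cylinder_subset_base: "0 \<in> X \<Longrightarrow> \<not> cylinder X \<subseteq> base_hyperplane"
proof
  assume "0 \<in> X" "cylinder X \<subseteq> base_hyperplane"
  moreover have "vec_restrict (axis None 1) = (0 :: complex ^ 'a)"
    by (simp add: vec_restrict_def axis_def vec_eq_iff)
  ultimately have "(axis None 1 :: complex ^ 'a option) \<in> base_hyperplane" by (simp add: cylinder_def subset_iff)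
  thus False by (simp add: base_hyperplane_def)
qed

lemma isomorphic_lattices_cone:
  assumes g: "defines_arrangement g" and g': "defines_arrangement g'" and "isomorphic_lattices g g'"
  shows "isomorphic_lattices (cone_poly g) (cone_poly g')"
proof -
  let ?L = "intersection_lattice g" and ?L' = "intersection_lattice g'"
  obtain \<phi> where bij: "bij_betw \<phi> ?L ?L'"
    and *: "\<forall>X\<in>?L. \<forall>Y\<in>?L. Y \<subseteq> X \<longleftrightarrow> \<phi> Y \<subseteq> \<phi> X"
    using assms(3) unfolding isomorphic_lattices_def by (elim exE conjE)
  have ord: "Y \<subseteq> X \<longleftrightarrow> \<phi> Y \<subseteq> \<phi> X" if "X \<in> ?L" "Y \<in> ?L" for X Y
    using * that by simp
  have im: "\<phi> ` ?L = ?L'" using bij by (simp add: bij_betw_def)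
  \<comment> \<open>Inclusion in \<open>base_hyperplane\<close> tells the two kinds of members
    apart, and slicing along \<open>vec_extend\<close> recovers the member of the original lattice
    in both cases.\<close>
  define \<psi> where "\<psi> Z = (if Z \<subseteq> base_hyperplane then cylinder (\<phi> {x. vec_extend x \<in> Z}) \<inter> base_hyperplane
      else cylinder (\<phi> {x. vec_extend x \<in> Z}))" for Z
  have base: "vec_extend x \<in> base_hyperplane" for x :: "complex ^ 'a"
    by (simp add: base_hyperplane_def vec_extend_def)
  have psi1: "\<psi> (cylinder X) = cylinder (\<phi> X)" if "X \<in> ?L" for X
    using not_cylinder_subset_base[OF zero_in_lattice[OF that]] by (simp add: \<psi>_def) (simp add: cylinder_def)
  have psi2: "\<psi> (cylinder X \<inter> base_hyperplane) = cylinder (\<phi> X) \<inter> base_hyperplane" for X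
    by (simp add: \<psi>_def base) (simp add: cylinder_def)
  have nb: "\<not> cylinder X \<subseteq> base_hyperplane" if "X \<in> ?L" for X
    using not_cylinder_subset_base zero_in_lattice that by blast
  have nb': "\<not> cylinder (\<phi> X) \<subseteq> base_hyperplane" if "X \<in> ?L" for X
    using not_cylinder_subset_base zero_in_lattice[of "\<phi> X" g'] that im by blast
  have order: "W \<subseteq> Z \<longleftrightarrow> \<psi> W \<subseteq> \<psi> Z"
    if "Z \<in> intersection_lattice (cone_poly g)" "W \<in> intersection_lattice (cone_poly g)" for Z W
  proof -
    obtain X Y where XY: "X \<in> ?L" "Z = cylinder X \<or> Z = cylinder X \<inter> base_hyperplane"
      "Y \<in> ?L" "W = cylinder Y \<or> W = cylinder Y \<inter> base_hyperplane"
      using \<open>Z \<in> _\<close> \<open>W \<in> _\<close> unfolding intersection_lattice_cone[OF g] by blast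
    show ?thesis using XY(2,4) ord[OF XY(1,3)] nb[OF XY(3)] nb'[OF XY(3)]
      by (elim disjE) (simp_all add: psi1[OF XY(1)] psi1[OF XY(3)] psi2)
  qed
  have "bij_betw \<psi> (intersection_lattice (cone_poly g)) (intersection_lattice (cone_poly g'))"
    unfolding bij_betw_def
  proof
    show "inj_on \<psi> (intersection_lattice (cone_poly g))"
    proof (rule inj_onI)
      fix Z W assume ZW: "Z \<in> intersection_lattice (cone_poly g)" "W \<in> intersection_lattice (cone_poly g)" "\<psi> Z = \<psi> W"
      show "Z = W" using order[OF ZW(1,2)] order[OF ZW(2,1)] ZW(3) by simp
    qed
    have "\<psi> ` (cylinder ` ?L) = cylinder ` ?L'"
      unfolding im[symmetric] image_image by (intro image_cong refl psi1)
    moreover have "\<psi> ` ((\<lambda>X. cylinder X \<inter> base_hyperplane) ` ?L) = (\<lambda>X. cylinder X \<inter> base_hyperplane) ` ?L'"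
      unfolding im[symmetric] image_image by (simp add: psi2)
    ultimately show "\<psi> ` intersection_lattice (cone_poly g) = intersection_lattice (cone_poly g')"
      unfolding intersection_lattice_cone[OF g] intersection_lattice_cone[OF g'] image_Un by simp
  qed
  thus ?thesis unfolding isomorphic_lattices_def using order by blast
qed

section \<open>Semicontinuity of the Hilbert function\<close>

interpretation cpx: vector_space_pair "\<lambda>c (p::'n cpoly). const_poly c * p" "(*) :: complex \<Rightarrow> complex \<Rightarrow> complex"
  by (rule vector_space_pair.intro[OF cp.vector_space_axioms complex_vector_space])

text \<open>A family whose matrix of coordinates is close to the identity is independent: compare
  coordinates at a coefficient of largest modulus.\<close>

lemma almost_dual_family_independent:
  fixes u :: "'y \<Rightarrow> 'n cpoly" and \<psi> :: "'y \<Rightarrow> 'n cpoly \<Rightarrow> complex"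
  assumes "finite Y" and lin: "\<And>y. y \<in> Y \<Longrightarrow> Vector_Spaces.linear (\<lambda>c (p::'n cpoly). const_poly c * p) (*) (\<psi> y)"
    and close: "\<And>x y. x \<in> Y \<Longrightarrow> y \<in> Y \<Longrightarrow> norm (\<psi> x (u y) - (if x = y then 1 else 0)) < 1 / (card Y + 1)"
    and zero: "(\<Sum>y\<in>Y. const_poly (c y) * u y) = 0" and "y \<in> Y"
  shows "c y = 0"
proof -
  let ?N = "(\<lambda>y. norm (c y)) ` Y"
  have "Max ?N \<in> ?N" using \<open>finite Y\<close> \<open>y \<in> Y\<close> by (intro Max_in) auto
  then obtain x where x: "Max ?N = norm (c x)" "x \<in> Y" by (rule imageE)
  have "norm (c y) \<le> norm (c x)" if "y \<in> Y" for y
    unfolding x(1)[symmetric] using \<open>finite Y\<close> that by (intro Max_ge) auto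
  note x = x(2) this
  interpret l: Vector_Spaces.linear "\<lambda>c (p::'n cpoly). const_poly c * p" "(*)" "\<psi> x" by (rule lin[OF x(1)])
  have "0 = \<psi> x (\<Sum>y\<in>Y. const_poly (c y) * u y)" using zero by simp
  also have "\<dots> = (\<Sum>y\<in>Y. c y * \<psi> x (u y))" by (simp add: l.sum l.scale)
  also have "\<dots> = (\<Sum>y\<in>Y. c y * (\<psi> x (u y) - (if x = y then 1 else 0)) + (if y = x then c x else 0))"
    by (intro sum.cong refl) (auto simp: algebra_simps)
  also have "\<dots> = (\<Sum>y\<in>Y. c y * (\<psi> x (u y) - (if x = y then 1 else 0))) + c x"
    using \<open>finite Y\<close> x(1) by (simp add: sum.distrib)
  finally have "c x = - (\<Sum>y\<in>Y. c y * (\<psi> x (u y) - (if x = y then 1 else 0)))"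
    by (simp add: eq_neg_iff_add_eq_0 add.commute)
  hence "norm (c x) = norm (\<Sum>y\<in>Y. c y * (\<psi> x (u y) - (if x = y then 1 else 0)))"
    by (metis norm_minus_cancel)
  also have "\<dots> \<le> (\<Sum>y\<in>Y. norm (c y * (\<psi> x (u y) - (if x = y then 1 else 0))))"
    by (rule norm_sum)
  also have "\<dots> \<le> (\<Sum>y\<in>Y. norm (c x) * (1 / (card Y + 1)))"
    unfolding norm_mult by (intro sum_mono mult_mono less_imp_le[OF close[OF x(1)]] x(2)) auto
  also have "\<dots> = norm (c x) * (card Y / (card Y + 1))" by simp
  finally have "norm (c x) * (card Y + 1) \<le> norm (c x) * card Y"
    by (simp add: field_simps)
  hence "norm (c x) = 0" by (simp add: distrib_left)
  thus ?thesis using x(2)[OF \<open>y \<in> Y\<close>] by simp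
qed

section \<open>Monomial multiples of the derivatives and their rank in a family\<close>

definition jacobian_generator :: "'n::finite cpoly \<Rightarrow> ('n \<Rightarrow>\<^sub>0 nat) \<times> 'n \<Rightarrow> 'n cpoly" where
  "jacobian_generator f x = Poly_Mapping.single (fst x) 1 * partial_deriv (snd x) f"

text \<open>The index set depends on the degree \<open>d\<close> alone, so all members of a family
  of constant degree share it. The form with addition leaves it empty for
  \<open>k < d - 1\<close>.\<close>

definition generator_index :: "nat \<Rightarrow> nat \<Rightarrow> (('n::finite \<Rightarrow>\<^sub>0 nat) \<times> 'n) set" where
  "generator_index d k = {m. (d - 1) + mdeg m = k} \<times> UNIV"

lemma finite_generator_index [simp]: "finite (generator_index d k)"
  unfolding generator_index_def
  by (intro finite_cartesian_product finite_class.finite_UNIV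
      finite_shifted_monomials[of "d - 1" k, unfolded shifted_monomials_def])

lemma jacobian_generator_in:
  assumes "homogeneous d f"
  shows "jacobian_generator f ` generator_index d k \<subseteq> jacobian_ideal f \<inter> graded_part k"
proof
  fix p assume "p \<in> jacobian_generator f ` generator_index d k"
  then obtain m i where p: "p = Poly_Mapping.single m 1 * partial_deriv i f" and m: "(d - 1) + mdeg m = k"
    by (auto simp: jacobian_generator_def generator_index_def)
  have "homogeneous (mdeg m + (d - 1)) p"
    unfolding p by (intro homogeneous_mult homogeneous_single homogeneous_partial_deriv assms refl)
  moreover have "p \<in> jacobian_ideal f"
    unfolding p jacobian_ideal_def by (intro ideal.span_scale ideal.span_base) blast
  ultimately show "p \<in> jacobian_ideal f \<inter> graded_part k"
    using m by (simp add: graded_part_def add.commute)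
qed

lemma jacobian_generator_span:
  fixes f :: "'n::finite cpoly"
  assumes "homogeneous d f"
  shows "jacobian_ideal f \<inter> graded_part k \<subseteq> cp.span (jacobian_generator f ` generator_index d k)"
proof
  fix p assume p: "p \<in> jacobian_ideal f \<inter> graded_part k"
  have "hcomp k p \<in> cp.span (jacobian_generator f ` generator_index d k)"
    using p[THEN IntD1] unfolding jacobian_ideal_def
  proof (induction rule: ideal.span_induct_alt)
    case base
    show ?case by (simp add: cp.span_zero)
  next
    case (step c x y)
    then obtain i where x: "x = partial_deriv i f" by blast
    have "hcomp k (c * x) \<in> cp.span (jacobian_generator f ` generator_index d k)"
    proof (cases "d - 1 \<le> k")
      case True
      let ?h = "hcomp (k - (d - 1)) c"
      have "hcomp k (c * x) = ?h * x"
        using hcomp_mult[OF homogeneous_partial_deriv[OF assms], of k c i] True by (simp add: x)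
      also have "\<dots> = (\<Sum>m\<in>monomials (k - (d - 1)). const_poly (Poly_Mapping.lookup ?h m) * jacobian_generator f (m, i))"
        by (subst homogeneous_expand[OF homogeneous_hcomp])
           (simp add: sum_distrib_right jacobian_generator_def x mult.assoc del: cp.scale_scale)
      also have "\<dots> \<in> cp.span (jacobian_generator f ` generator_index d k)"
        using True by (intro cp.span_sum cp.span_scale cp.span_base imageI)
          (auto simp: generator_index_def monomials_def)
      finally show ?thesis .
    next
      case False
      thus ?thesis
        using hcomp_mult[OF homogeneous_partial_deriv[OF assms], of k c i] by (simp add: x cp.span_zero)
    qed
    thus ?case using step(2) by (simp add: hcomp_add cp.span_add)
  qed
  thus "p \<in> cp.span (jacobian_generator f ` generator_index d k)"
    using p hcomp_homogeneous[of k p k] by (simp add: graded_part_def)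
qed

text \<open>Rank can only go up near \<open>t = 0\<close>: generators that form a basis of the
  degree \<open>k\<close> part of the Jacobian ideal at 0 stay independent for small
  \<open>t\<close>. The parameter found depends on \<open>k\<close>.\<close>

lemma milnor_dim_semicontinuous:
  fixes F :: "real \<Rightarrow> 'n::finite cpoly"
  assumes "0 < t0" and hom: "\<And>t. t \<in> {0..t0} \<Longrightarrow> homogeneous d (F t)"
    and cont: "\<And>m. ((\<lambda>t. Poly_Mapping.lookup (F t) m) \<longlongrightarrow> Poly_Mapping.lookup (F 0) m) (at 0 within {0..t0})"
  obtains t where "t \<in> {0<..t0}" "milnor_dim (F t) k \<le> milnor_dim (F 0) k"
proof -
  let ?X = "generator_index d k :: (('n \<Rightarrow>\<^sub>0 nat) \<times> 'n) set"
  let ?U = "\<lambda>t. jacobian_generator (F t)"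
  have hom0: "homogeneous d (F 0)" using hom assms(1) by simp
  obtain B where B: "B \<subseteq> ?U 0 ` ?X" "cp.independent B" "?U 0 ` ?X \<subseteq> cp.span B"
    using cp.maximal_independent_subset by blast
  have dim0: "cp.dim (jacobian_ideal (F 0) \<inter> graded_part k) = card B"
  proof (rule cp.dim_unique[OF _ _ B(2) refl])
    show "B \<subseteq> jacobian_ideal (F 0) \<inter> graded_part k"
      using B(1) jacobian_generator_in[OF hom0] by (rule order_trans)
    show "jacobian_ideal (F 0) \<inter> graded_part k \<subseteq> cp.span B"
      using jacobian_generator_span[OF hom0, of k] cp.span_minimal[OF B(3) cp.subspace_span] by (rule order_trans)
  qed
  \<comment> \<open>The basis is recorded by indices, since the generators themselves move with
    \<open>t\<close>.\<close>
  obtain Y where Y: "Y \<subseteq> ?X" "inj_on (?U 0) Y" "B = ?U 0 ` Y"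
    using B(1) unfolding subset_image_inj by blast
  have finY: "finite Y" using Y(1) by (rule finite_subset) simp
  have "\<forall>y. \<exists>\<phi>. Vector_Spaces.linear (\<lambda>c (p::'n cpoly). const_poly c * p) (*) \<phi> \<and>
      (\<forall>b\<in>B. \<phi> b = (if b = ?U 0 y then 1 else 0))"
    by (intro allI cpx.linear_independent_extend[OF B(2)])
  from choice[OF this] obtain \<psi> where \<psi>: "\<And>y. Vector_Spaces.linear (\<lambda>c (p::'n cpoly). const_poly c * p) (*) (\<psi> y)"
    "\<And>y b. b \<in> B \<Longrightarrow> \<psi> y b = (if b = ?U 0 y then 1 else 0)" by blast
  \<comment> \<open>The generators depend linearly on the coefficients of \<open>F t\<close>, so
    their coordinates are continuous at 0 and tend to the identity matrix.\<close>
  have coord: "\<psi> x (?U t y) = (\<Sum>M\<in>monomials d. Poly_Mapping.lookup (F t) M * \<psi> x (jacobian_generator (Poly_Mapping.single M 1) y))"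
    if "t \<in> {0..t0}" for x y t
  proof -
    interpret l: Vector_Spaces.linear "\<lambda>c (p::'n cpoly). const_poly c * p" "(*)" "\<psi> x" by (rule \<psi>(1))
    have "?U t y = (\<Sum>M\<in>monomials d. const_poly (Poly_Mapping.lookup (F t) M) * jacobian_generator (Poly_Mapping.single M 1) y)"
      unfolding jacobian_generator_def
      by (subst homogeneous_expand[OF hom[OF that]])
         (simp add: partial_deriv_sum partial_deriv_const_mult sum_distrib_left mult.left_commute)
    thus ?thesis by (simp add: l.sum l.scale)
  qed
  have lim: "((\<lambda>t. \<psi> x (?U t y)) \<longlongrightarrow> (if x = y then 1 else 0)) (at 0 within {0..t0})" if "x \<in> Y" "y \<in> Y" for x y
  proof -
    have "((\<lambda>t. \<Sum>M\<in>monomials d. Poly_Mapping.lookup (F t) M * \<psi> x (jacobian_generator (Poly_Mapping.single M 1) y))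
        \<longlongrightarrow> (\<Sum>M\<in>monomials d. Poly_Mapping.lookup (F 0) M * \<psi> x (jacobian_generator (Poly_Mapping.single M 1) y)))
        (at 0 within {0..t0})"
      by (intro tendsto_sum tendsto_mult cont tendsto_const)
    note lim_sum = this
    have lim_value: "(\<Sum>M\<in>monomials d. Poly_Mapping.lookup (F 0) M * \<psi> x (jacobian_generator (Poly_Mapping.single M 1) y))
        = (if x = y then 1 else 0)"
      using coord[of 0 x y] assms(1) \<psi>(2)[of "?U 0 y" x] Y(2,3) that by (auto simp: inj_on_eq_iff)
    have "\<forall>\<^sub>F t in at 0 within {0..t0}. (\<Sum>M\<in>monomials d. Poly_Mapping.lookup (F t) M * \<psi> x (jacobian_generator (Poly_Mapping.single M 1) y))
        = \<psi> x (?U t y)"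
      unfolding eventually_at_filter using coord by (intro always_eventually) auto
    from tendsto_cong[THEN iffD1, OF this lim_sum] show ?thesis by (simp only: lim_value)
  qed
  have "\<forall>\<^sub>F t in at 0 within {0..t0}. \<forall>x\<in>Y. \<forall>y\<in>Y. norm (\<psi> x (?U t y) - (if x = y then 1 else 0)) < 1 / (card Y + 1)"
    using finY lim by (intro eventually_ball_finite ballI) (auto simp: tendsto_iff dist_norm)
  then obtain \<delta> where \<delta>: "\<delta> > 0" "\<And>t. t \<in> {0..t0} \<Longrightarrow> t \<noteq> 0 \<Longrightarrow> dist t 0 < \<delta> \<Longrightarrow>
      \<forall>x\<in>Y. \<forall>y\<in>Y. norm (\<psi> x (?U t y) - (if x = y then 1 else 0)) < 1 / (card Y + 1)"
    unfolding eventually_at by blast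
  define t where "t = min t0 (\<delta> / 2)"
  have t: "t \<in> {0<..t0}" "t \<in> {0..t0}" "t \<noteq> 0" "dist t 0 < \<delta>" using assms(1) \<delta>(1) by (auto simp: t_def)
  have "card Y \<le> cp.dim (jacobian_ideal (F t) \<inter> graded_part k)"
  proof (rule cp.independent_family_card_le_dim[OF finY])
    show "c y = 0" if "(\<Sum>y\<in>Y. const_poly (c y) * ?U t y) = 0" "y \<in> Y" for c y
      by (rule almost_dual_family_independent[where \<psi> = \<psi>, OF finY \<psi>(1) _ that]) (use \<delta>(2)[OF t(2-4)] in blast)
    show "?U t ` Y \<subseteq> jacobian_ideal (F t) \<inter> graded_part k"
      using image_mono[OF Y(1)] jacobian_generator_in[OF hom[OF t(2)]] by (rule order_trans)
    show "jacobian_ideal (F t) \<inter> graded_part k \<subseteq> cp.span (?U t ` ?X)"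
      by (rule jacobian_generator_span[OF hom[OF t(2)]])
  qed simp
  hence "cp.dim (jacobian_ideal (F 0) \<inter> graded_part k) \<le> cp.dim (jacobian_ideal (F t) \<inter> graded_part k)"
    using card_image[OF Y(2)] dim0 Y(3) by simp
  hence "milnor_dim (F t) k \<le> milnor_dim (F 0) k"
    using milnor_dim_eq[of "F t" k] milnor_dim_eq[of "F 0" k] by linarith
  thus ?thesis using that t(1) by blast
qed

section \<open>Hilbert functions under (SPEC), and the theorem\<close>

lemma smooth_family_tendsto:
  assumes "smooth_family I F" "t \<in> I"
  shows "((\<lambda>t. Poly_Mapping.lookup (F t) m) \<longlongrightarrow> Poly_Mapping.lookup (F t) m) (at t within I)"
proof -
  obtain D where D: "D 0 = (\<lambda>t. Poly_Mapping.lookup (F t) m)"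
    "\<And>k t. t \<in> I \<Longrightarrow> (D k has_vector_derivative D (Suc k) t) (at t within I)"
    using assms(1) unfolding smooth_family_def smooth_on_def by metis
  have "continuous (at t within I) (D 0)"
    using D(2)[OF assms(2), of 0] by (rule has_vector_derivative_continuous)
  thus ?thesis by (simp add: D(1) continuous_within)
qed

text \<open>Constancy of the lattice fixes the degree, as semicontinuity requires; constancy of the
  Betti numbers moves the inequality from the small parameter, which varies with \<open>k\<close>,
  to \<open>t0\<close>.\<close>

lemma milnor_dim_le_of_SPEC:
  fixes g g' :: "'n::{finite,linorder} cpoly"
  assumes "condition_SPEC g g'"
  shows "milnor_dim g' k \<le> milnor_dim g k"
proof -
  obtain t0 F where F: "0 < t0" "smooth_family {0..t0} F" "F 0 = g" "F t0 = g'"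
    and arr: "\<And>t. t \<in> {0..t0} \<Longrightarrow> defines_arrangement (F t)"
    and iso: "\<And>t t'. t \<in> {0..t0} \<Longrightarrow> t' \<in> {0..t0} \<Longrightarrow> isomorphic_lattices (F t) (F t')"
    and betti: "\<And>t t'. t \<in> {0<..t0} \<Longrightarrow> t' \<in> {0<..t0} \<Longrightarrow> milnor_betti (F t) = milnor_betti (F t')"
    using assms unfolding condition_SPEC_def by metis
  define d where "d = card (arrangement g)"
  have hom: "homogeneous d (F t)" if t: "t \<in> {0..t0}" for t
  proof -
    obtain A where A: "F t = (\<Prod>a\<in>A. linear_form a)" "card A = card (arrangement (F t))"
      using defines_arrangement_degree[OF arr[OF t]] by metis
    have "card (arrangement (F t)) = d"
      unfolding d_def F(3)[symmetric] using iso[OF t, of 0] F(1) by (intro card_arrangement_eq) simp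
    thus ?thesis using homogeneous_prod_linear_forms[of A] A by simp
  qed
  obtain t where t: "t \<in> {0<..t0}" "milnor_dim (F t) k \<le> milnor_dim (F 0) k"
    by (rule milnor_dim_semicontinuous[OF F(1) hom smooth_family_tendsto[OF F(2)]]) (use F(1) in auto)
  have "milnor_dim (F t) k = milnor_dim (F t0) k"
    by (rule milnor_dim_eq_of_betti_eq[OF hom hom betti]) (use t(1) F(1) in auto)
  thus ?thesis using t(2) F(3,4) by simp
qed

theorem theorem1p3:
  fixes g g' :: "3 cpoly"
  assumes "defines_arrangement g" and "defines_arrangement g'"
  shows "(isomorphic_lattices g g' \<longrightarrow> isomorphic_lattices (cone_poly g) (cone_poly g')) \<and>
    (ziegler_pair g g' \<and> condition_SPEC g g' \<and> \<not> condition_HF g g' \<longrightarrow>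
      milnor_hilbert_poly (cone_poly g) \<noteq> milnor_hilbert_poly (cone_poly g'))"
proof (intro conjI impI)
  show "isomorphic_lattices (cone_poly g) (cone_poly g')" if "isomorphic_lattices g g'"
    using isomorphic_lattices_cone[OF assms that] .
next
  assume *: "ziegler_pair g g' \<and> condition_SPEC g g' \<and> \<not> condition_HF g g'"
  obtain A where A: "finite A" "0 \<notin> A" "\<forall>a\<in>A. \<forall>b\<in>A. a \<noteq> b \<longrightarrow> (\<forall>c. a \<noteq> c *s b)"
    "g = (\<Prod>a\<in>A. linear_form a)" "card A = card (arrangement g)"
    using defines_arrangement_degree[OF assms(1)] by metis
  obtain A' where A': "finite A'" "0 \<notin> A'" "\<forall>a\<in>A'. \<forall>b\<in>A'. a \<noteq> b \<longrightarrow> (\<forall>c. a \<noteq> c *s b)"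
    "g' = (\<Prod>a\<in>A'. linear_form a)" "card A' = card (arrangement g')"
    using defines_arrangement_degree[OF assms(2)] by metis
  have card: "card A' = card A"
    using card_arrangement_eq[of g g'] * A(5) A'(5) by (simp add: ziegler_pair_def)
  \<comment> \<open>For empty arrangements both polynomials are 1, so (HF) would hold. Positive
    degree is what Euler's formula needs later.\<close>
  have "A \<noteq> {}"
  proof
    assume "A = {}"
    hence "g = g'" using card A A' by simp
    thus False using * by (simp add: condition_HF_def)
  qed
  have "A' \<noteq> {}" using card \<open>A \<noteq> {}\<close> A(1) by auto
  show "milnor_hilbert_poly (cone_poly g) \<noteq> milnor_hilbert_poly (cone_poly g')"
  proof
    assume eq: "milnor_hilbert_poly (cone_poly g) = milnor_hilbert_poly (cone_poly g')"
    have "\<forall>\<^sub>F k in sequentially. milnor_dim (cone_poly g) k = milnor_dim (cone_poly g') k"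
      using milnor_hilbert_poly_eventually[OF cone_hilbert_polynomial_exists[OF A(1,2) \<open>A \<noteq> {}\<close> A(3,4)]]
        milnor_hilbert_poly_eventually[OF cone_hilbert_polynomial_exists[OF A'(1,2) \<open>A' \<noteq> {}\<close> A'(3,4)]]
      unfolding eq by eventually_elim simp
    then obtain K where K: "\<And>k. k \<ge> K \<Longrightarrow> milnor_dim (cone_poly g) k = milnor_dim (cone_poly g') k"
      by (auto simp: eventually_sequentially)
    have hom: "homogeneous (card A) g" "homogeneous (card A) g'"
      using homogeneous_prod_linear_forms[of A] homogeneous_prod_linear_forms[of A'] A(4) A'(4) card by simp_all
    have nz: "g \<noteq> 0" "g' \<noteq> 0" using A(1,2,4) A'(1,2,4) by auto
    have pos: "card A > 0" using A(1) \<open>A \<noteq> {}\<close> by (simp add: card_gt_0_iff)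
    have "milnor_dim g' i = milnor_dim g i" for i
    proof -
      \<comment> \<open>Large enough for the Hilbert functions of the cones to agree, for the
        dimension formula, and for \<open>i\<close> to occur in the sum.\<close>
      define k where "k = K + card A + Suc i"
      have "(\<Sum>i<k. milnor_dim g' i) = (\<Sum>i<k. milnor_dim g i)"
        using milnor_dim_cone[OF hom(1) nz(1) pos, of k] milnor_dim_cone[OF hom(2) nz(2) pos, of k] K[of k]
        by (simp add: k_def)
      moreover have "milnor_dim g' i \<le> milnor_dim g i" for i
        using * by (simp add: milnor_dim_le_of_SPEC)
      \<comment> \<open>Equal sums of termwise comparable numbers force equality of every
        term.\<close>
      ultimately show ?thesis
        by (rule sum_mono_inv[where I = "{..<k}"]) (auto simp: k_def)
    qed
    thus False using * by (simp add: condition_HF_def)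
  qed
qed

end
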